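(* (Case (r7-r14).) Let $H(x,y)=\frac{y^2}{2}+\frac{x^2(3x^2+8x+6)}{12}$ and, for $h\in(0,1/12)$, let $\gamma_h$ be the oval surrounding the origin inside the level curve $\{H(x,y)=h\}$, in the period annulus of the origin whose projection on the $x$-axis is $(-1,1/3)$. For $i=0,1,2$ define $$\widetilde I_i(h)=\int_{\gamma_h}(x+1)^{i-2}\,y\,dx .$$ Then $\{\widetilde I_0,\widetilde I_1,\widetilde I_2\}$ is an ECT-system on $(0,1/12)$.
   Context: The origin is a local minimum of $H$, and the period annulus is the punctured neighbourhood of the origin foliated by the closed curves (ovals) $\gamma_h\subset\{H=h\}$ surrounding the origin. An ordered tuple $(f_0,\ldots,f_{n-1})$ of analytic functions on an open interval $L$ is an extended complete Chebyshev system (ECT-system) on $L$ if, for all $k=1,\ldots,n$, any nontrivial linear combination $\alpha_0f_0+\cdots+\alpha_{k-1}f_{k-1}$ (which is understood not to vanish identically) has at most $k-1$ isolated zeros on $L$ counted with multiplicities; equivalently, the Wronskian $\det(f_j^{(i)}(x))_{0\le i,j\le k-1}\neq0$ for all $k=1,\ldots,n$ and all $x\in L$. A set $\{f_0,\ldots,f_{n-1}\}$ is called an ECT-system on $L$ if its elements form an ECT-system on $L$ when taken in some order. *)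

theory Defs
  imports "HOL-Complex_Analysis.Complex_Analysis" "HOL-Library.Multiset"
begin

section \<open>ECT-systems\<close>

definition real_analytic_on :: "(real \<Rightarrow> real) \<Rightarrow> real set \<Rightarrow> bool" where
  "real_analytic_on f S \<longleftrightarrow>
     (\<forall>x\<in>S. \<exists>r>0. \<exists>a :: nat \<Rightarrow> real. \<forall>y. \<bar>y - x\<bar> < r \<longrightarrow> (\<lambda>n. a n * (y - x) ^ n) sums f y)"

text \<open>
  Order of vanishing. The value is only meaningful if some derivative of \<open>f\<close> at \<open>x\<close> is nonzero,
  which is the case at an isolated zero of an analytic function.
\<close>
definition zero_multiplicity :: "(real \<Rightarrow> real) \<Rightarrow> real \<Rightarrow> nat" where
  "zero_multiplicity f x = (LEAST m. (deriv ^^ m) f x \<noteq> 0)"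

definition isolated_zeros :: "(real \<Rightarrow> real) \<Rightarrow> real set \<Rightarrow> real set" where
  "isolated_zeros f L = {x. x isolated_in {y \<in> L. f y = 0}}"

text \<open>
  Nontriviality of a linear combination refers to its coefficients; that it does not vanish
  identically on \<open>L\<close> is part of what is required.
\<close>
definition ECT_system :: "real set \<Rightarrow> (real \<Rightarrow> real) list \<Rightarrow> bool" where
  "ECT_system L fs \<longleftrightarrow>
     open L \<and> is_interval L \<and> (\<forall>f\<in>set fs. real_analytic_on f L) \<and>
     (\<forall>k\<in>{1..length fs}. \<forall>\<alpha> :: nat \<Rightarrow> real. (\<exists>j<k. \<alpha> j \<noteq> 0) \<longrightarrow>
        (let F = (\<lambda>x. \<Sum>j<k. \<alpha> j * (fs ! j) x) in
           (\<exists>x\<in>L. F x \<noteq> 0) \<and>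
           finite (isolated_zeros F L) \<and>
           (\<Sum>x\<in>isolated_zeros F L. zero_multiplicity F x) \<le> k - 1))"

text \<open>
  A multiset rather than a set, so that listing the same function twice is not silently
  collapsed.
\<close>
definition ECT_set :: "real set \<Rightarrow> (real \<Rightarrow> real) multiset \<Rightarrow> bool" where
  "ECT_set L M \<longleftrightarrow> (\<exists>fs. mset fs = M \<and> ECT_system L fs)"

section \<open>The Hamiltonian and its ovals\<close>

definition H :: "real \<Rightarrow> real \<Rightarrow> real" where
  "H x y = y\<^sup>2 / 2 + x\<^sup>2 * (3 * x\<^sup>2 + 8 * x + 6) / 12"

text \<open>
  The plane is identified with the type of complex numbers, \<open>z = x + i y\<close>, so that the library's
  notions for paths and winding numbers apply. An oval is given by a piecewise continuously
  differentiable parametrization over the unit interval.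
\<close>
definition is_oval :: "real \<Rightarrow> (real \<Rightarrow> complex) \<Rightarrow> bool" where
  "is_oval h g \<longleftrightarrow>
     valid_path g \<and> simple_path g \<and> pathfinish g = pathstart g \<and>
     path_image g \<subseteq> {z. H (Re z) (Im z) = h \<and> - 1 < Re z \<and> Re z < 1 / 3} \<and>
     0 \<in> inside (path_image g)"

text \<open>
  For every \<open>h\<close> in \<open>(0,1/12)\<close> the whole level curve is one such oval. Reversing the
  parametrization gives winding number \<open>-1\<close>, the orientation of the Hamiltonian flow.
\<close>
lemma oval_exists:
  assumes h: "0 < h" "h < 1 / 12"
  shows "\<exists>g. is_oval h g \<and> path_image g = {z. H (Re z) (Im z) = h} \<and> winding_number g 0 = 1"
proof -
  define q where "q = (\<lambda>x::real. (3 * x\<^sup>2 + 8 * x + 6) / 6)"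
  define S where "S = (\<lambda>x. x * sqrt (q x))"
  define J where "J = {-1..1 / 3 :: real}"
  define c where "c = sqrt (1 / 6 :: real)"
  define r where "r = sqrt (2 * h)"
  have q_ge: "q x \<ge> 1 / 9" for x
  proof -
    have "q x - 1 / 9 = (x + 4 / 3)\<^sup>2 / 2"
      unfolding q_def by (simp add: power2_eq_square field_simps)
    then show ?thesis by (smt (verit) zero_le_power2 divide_nonneg_nonneg)
  qed
  have q_pos: "q x > 0" for x using q_ge[of x] by linarith
  have H_eq: "H x y = (y\<^sup>2 + (S x)\<^sup>2) / 2" for x y
    using q_pos[of x] unfolding H_def S_def
    by (simp add: power_mult_distrib) (simp add: q_def field_simps)
  have DS: "(S has_real_derivative (x + 1)\<^sup>2 / sqrt (q x)) (at x)" for x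
  proof -
    have Dq: "(q has_real_derivative (6 * x + 8) / 6) (at x)"
      unfolding q_def by (auto intro!: derivative_eq_intros)
    have "(S has_real_derivative
            1 * sqrt (q x) + ((6 * x + 8) / 6 * (inverse (sqrt (q x)) / 2)) * x) (at x)"
      unfolding S_def
      by (rule DERIV_cong[OF DERIV_mult[OF DERIV_ident
            DERIV_chain2[OF DERIV_real_sqrt[OF q_pos] Dq]]]) (simp add: field_simps)
    moreover have "1 * sqrt (q x) + ((6 * x + 8) / 6 * (inverse (sqrt (q x)) / 2)) * x
        = (q x + (6 * x + 8) * x / 12) / sqrt (q x)"
      using q_pos[of x] by (simp add: field_simps)
    moreover have "q x + (6 * x + 8) * x / 12 = (x + 1)\<^sup>2"
      by (simp add: q_def field_simps power2_eq_square)
    ultimately show ?thesis by simp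
  qed
  have contS: "continuous_on A S" for A
    using DS by (meson DERIV_isCont continuous_at_imp_continuous_on)
  have S_less: "S x < S y" if "-1 \<le> x" "x < y" for x y
  proof (rule DERIV_pos_imp_increasing_open[OF that(2)])
    fix z assume "x < z" "z < y"
    then have "(z + 1)\<^sup>2 / sqrt (q z) > 0" using that q_pos[of z] by simp
    then show "\<exists>D. (S has_real_derivative D) (at z) \<and> D > 0" using DS by blast
  qed (rule contS)
  have injS: "inj_on S J"
    by (rule inj_onI) (metis S_less atLeastAtMost_iff J_def less_irrefl linorder_neqE_linordered_idom)
  have S_ends: "S (-1) = - c" "S (1 / 3) = c"
  proof -
    have "sqrt (3 / 2) = 3 * sqrt (1 / 6 :: real)"
      by (rule real_sqrt_unique) (simp_all add: power_mult_distrib)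
    then show "S (-1) = - c" "S (1 / 3) = c"
      by (simp_all add: S_def q_def c_def power2_eq_square)
  qed
  have imS: "S ` J = {-c..c}"
  proof
    show "S ` J \<subseteq> {-c..c}"
    proof (rule image_subsetI)
      fix x assume "x \<in> J"
      then show "S x \<in> {-c..c}"
        using S_less[of "-1" x] S_less[of x "1 / 3"] S_ends unfolding J_def
        by (smt (verit) atLeastAtMost_iff)
    qed
    show "{-c..c} \<subseteq> S ` J"
    proof
      fix s assume "s \<in> {-c..c}"
      then show "s \<in> S ` J"
        using IVT'[of S "-1" s "1 / 3"] S_ends contS unfolding J_def by fastforce
    qed
  qed
  define X where "X = the_inv_into J S"
  have X_S: "X (S x) = x" if "x \<in> J" for x
    using the_inv_into_f_f[OF injS that] by (simp add: X_def)
  have S_X: "S (X s) = s" if "s \<in> {-c..c}" for s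
    using f_the_inv_into_f[OF injS] that imS by (simp add: X_def)
  have X_in: "X s \<in> J" if "s \<in> {-c..c}" for s
    using the_inv_into_into[OF injS] that imS by (auto simp: X_def)
  have contX: "continuous_on {-c..c} X"
    using continuous_on_inv[OF contS, of J X] X_S imS unfolding J_def by auto
  have X_strict: "-1 < X s \<and> X s < 1 / 3" if "s \<in> {-c<..<c}" for s
  proof -
    have "X s \<in> J" "S (X s) = s" using X_in S_X that by auto
    then show ?thesis using S_ends that unfolding J_def
      by (metis atLeastAtMost_iff greaterThanLessThan_iff less_irrefl order.order_iff_strict)
  qed
  have DX: "(X has_real_derivative sqrt (q (X s)) / (X s + 1)\<^sup>2) (at s)"
    if "s \<in> {-c<..<c}" for s
  proof -
    have "isCont X s"
      using continuous_on_interior[OF contX] that by simp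
    moreover have "(X s + 1)\<^sup>2 / sqrt (q (X s)) \<noteq> 0"
      using X_strict[OF that] q_pos[of "X s"] by auto
    ultimately have "(X has_real_derivative inverse ((X s + 1)\<^sup>2 / sqrt (q (X s)))) (at s)"
      using DERIV_inverse_function[OF DS, of X s "-c" c] that S_X by auto
    then show ?thesis by simp
  qed
  have r: "0 < r" "r < c" "r\<^sup>2 = 2 * h" using h by (auto simp: r_def c_def)
  have rcos: "r * cos t \<in> {-c<..<c}" for t
  proof -
    have "\<bar>r * cos t\<bar> \<le> r * 1" using r by (auto simp: abs_mult intro!: mult_left_mono)
    then show ?thesis using r by auto
  qed
  define g where "g = (\<lambda>t. Complex (X (r * cos (2 * pi * t))) (r * sin (2 * pi * t)))"
  define D where "D = (\<lambda>t. Complex (sqrt (q (X (r * cos (2 * pi * t)))) / (X (r * cos (2 * pi * t)) + 1)\<^sup>2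
        * (r * (- sin (2 * pi * t) * (2 * pi)))) (r * (cos (2 * pi * t) * (2 * pi))))"
  have Dg: "(g has_vector_derivative D t) (at t)" for t
    unfolding g_def D_def has_vector_derivative_complex_iff complex.sel
  proof
    have "((\<lambda>t. r * cos (2 * pi * t)) has_real_derivative r * (- sin (2 * pi * t) * (2 * pi))) (at t)"
      by (auto intro!: derivative_eq_intros)
    from DERIV_chain2[OF DX[OF rcos] this]
    show "((\<lambda>t. X (r * cos (2 * pi * t))) has_real_derivative
       sqrt (q (X (r * cos (2 * pi * t)))) / (X (r * cos (2 * pi * t)) + 1)\<^sup>2
        * (r * (- sin (2 * pi * t) * (2 * pi)))) (at t)" .
    show "((\<lambda>t. r * sin (2 * pi * t)) has_real_derivative r * (cos (2 * pi * t) * (2 * pi))) (at t)"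
      by (auto intro!: derivative_eq_intros)
  qed
  have contXt: "continuous_on {0..1} (\<lambda>t. X (r * cos (2 * pi * t)))"
  proof (rule continuous_on_compose2[OF contX])
    show "continuous_on {0..1} (\<lambda>t. r * cos (2 * pi * t))"
      by (intro continuous_intros)
    show "(\<lambda>t. r * cos (2 * pi * t)) ` {0..1} \<subseteq> {-c..c}"
      using rcos greaterThanLessThan_subseteq_atLeastAtMost_iff[of "-c" c "-c" c] by blast
  qed
  have contD: "continuous_on {0..1} D"
  proof -
    have "X (r * cos (2 * pi * t)) + 1 \<noteq> 0" for t
      using X_strict[OF rcos, of "2 * pi * t"] by linarith
    then show ?thesis
      unfolding D_def Complex_eq q_def by (intro continuous_intros contXt ballI) simp_all
  qed
  have "g C1_differentiable_on {0..1}"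
    unfolding C1_differentiable_on_def using Dg contD by blast
  then have valid: "valid_path g"
    by (simp add: valid_path_def C1_differentiable_imp_piecewise)
  then have path: "path g" by (rule valid_path_imp_path)
  have closed: "pathfinish g = pathstart g"
    by (simp add: g_def pathfinish_def pathstart_def)
  have simple: "simple_path g"
    unfolding simple_path_def loop_free_def
  proof (intro conjI ballI impI)
    show "path g" by (rule path)
    fix s t :: real
    assume st: "s \<in> {0..1}" "t \<in> {0..1}" and eq: "g s = g t"
    have S_X': "S (X (r * cos u)) = r * cos u" for u
      using S_X[of "r * cos u"] rcos[of u] by simp
    have "X (r * cos (2 * pi * s)) = X (r * cos (2 * pi * t))"
      using eq unfolding g_def complex.inject by blast
    then have "r * cos (2 * pi * s) = r * cos (2 * pi * t)"
      by (metis S_X')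
    then have "cos (2 * pi * s) = cos (2 * pi * t)" using r(1) by simp
    moreover have "r * sin (2 * pi * s) = r * sin (2 * pi * t)"
      using eq unfolding g_def complex.inject by blast
    then have "sin (2 * pi * s) = sin (2 * pi * t)" using r(1) by simp
    moreover have "circlepath 0 1 u = Complex (cos (2 * pi * u)) (sin (2 * pi * u))" for u
      by (simp add: circlepath complex_eq_iff Re_exp Im_exp)
    ultimately have "circlepath 0 1 s = circlepath 0 1 t" by simp
    then show "s = t \<or> s = 0 \<and> t = 1 \<or> s = 1 \<and> t = 0"
      using simple_path_circlepath[of 0 1] st unfolding simple_path_def loop_free_def
      by (metis zero_neq_one)
  qed
  have strip: "-1 < x \<and> x < 1 / 3" if "H x y = h" for x y
  proof -
    have "(x + 1) ^ 3 * (3 * x - 1) / 12 = H x y - 1 / 12 - y\<^sup>2 / 2"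
      by (simp add: H_def field_simps eval_nat_numeral)
    then have neg: "(x + 1) ^ 3 * (3 * x - 1) < 0" using that h by (smt (verit) zero_le_power2 divide_nonneg_nonneg)
    then show ?thesis
      by (auto simp: mult_less_0_iff power_less_zero_eq)
  qed
  have image: "path_image g = {z. H (Re z) (Im z) = h}"
  proof (rule set_eqI)
    fix z
    show "z \<in> path_image g \<longleftrightarrow> z \<in> {z. H (Re z) (Im z) = h}"
    proof
      assume "z \<in> path_image g"
      then obtain t where t: "z = g t" by (auto simp: path_image_def)
      have "S (Re z) = r * cos (2 * pi * t)" using S_X rcos[of "2 * pi * t"] by (auto simp: t g_def)
      then have "H (Re z) (Im z) = r\<^sup>2 * ((sin (2 * pi * t))\<^sup>2 + (cos (2 * pi * t))\<^sup>2) / 2"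
        unfolding H_eq by (simp only: t g_def complex.sel power_mult_distrib distrib_left)
      then show "z \<in> {z. H (Re z) (Im z) = h}" using r by simp
    next
      assume "z \<in> {z. H (Re z) (Im z) = h}"
      then have z: "H (Re z) (Im z) = h" by simp
      have inJ: "Re z \<in> J" using strip[OF z] by (auto simp: J_def)
      have "(S (Re z) / r)\<^sup>2 + (Im z / r)\<^sup>2 = 1"
        using z r h by (simp add: H_eq power_divide add_divide_distrib[symmetric])
      then obtain \<theta> where \<theta>: "0 \<le> \<theta>" "\<theta> < 2 * pi" "S (Re z) / r = cos \<theta>" "Im z / r = sin \<theta>"
        using sincos_total_2pi by metis
      have "S (Re z) = r * cos \<theta>" "Im z = r * sin \<theta>" using \<theta>(3,4) r by (auto simp: field_simps)
      then have "z = g (\<theta> / (2 * pi))"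
        using X_S[OF inJ] by (simp add: g_def complex_eq_iff)
      moreover have "\<theta> / (2 * pi) \<in> {0..1}" using \<theta> by simp
      ultimately show "z \<in> path_image g" by (auto simp: path_image_def)
    qed
  qed
  have inside: "0 \<in> inside (path_image g)"
  proof -
    define C where "C = connected_component_set (- path_image g) 0"
    have H0: "H 0 0 = 0" by (simp add: H_def)
    have contH: "continuous_on A (\<lambda>z. H (Re z) (Im z))" for A
      unfolding H_def by (intro continuous_intros) auto
    have "H (Re z) (Im z) < h" if "z \<in> C" for z
    proof (rule ccontr)
      assume "\<not> H (Re z) (Im z) < h"
      moreover have "connected ((\<lambda>z. H (Re z) (Im z)) ` C)"
        unfolding C_def by (intro connected_continuous_image contH connected_connected_component)
      moreover have "0 \<in> C" using h H0 by (simp add: C_def image)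
      then have "0 \<in> (\<lambda>z. H (Re z) (Im z)) ` C" using H0 by force
      ultimately have "h \<in> (\<lambda>z. H (Re z) (Im z)) ` C"
        using connectedD_interval[of _ 0 "H (Re z) (Im z)" h] h that by auto
      moreover have "C \<subseteq> - path_image g" unfolding C_def by (rule connected_component_subset)
      ultimately show False by (auto simp: image)
    qed
    then have "C \<subseteq> {z. H (Re z) (Im z) < h}" by auto
    moreover have "bounded {z. H (Re z) (Im z) < h}"
    proof (rule boundedI)
      fix z assume "z \<in> {z. H (Re z) (Im z) < h}"
      then have "(Im z)\<^sup>2 + (S (Re z))\<^sup>2 < 1" using h by (simp add: H_eq)
      moreover have "(S (Re z))\<^sup>2 \<ge> (Re z)\<^sup>2 * (1 / 9)"
        using mult_left_mono[OF q_ge[of "Re z"], of "(Re z)\<^sup>2"] q_pos[of "Re z"]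
        by (simp add: S_def power_mult_distrib)
      ultimately have "(Im z)\<^sup>2 + (Re z)\<^sup>2 * (1 / 9) < 1" by linarith
      then have "(Re z)\<^sup>2 + (Im z)\<^sup>2 \<le> 3\<^sup>2"
        using zero_le_power2[of "Im z"] by (simp, linarith)
      then show "norm z \<le> 3"
        unfolding cmod_def by (rule real_le_lsqrt[rotated]) simp_all
    qed
    ultimately have "bounded C" by (rule bounded_subset[rotated])
    then show ?thesis using h H0 by (auto simp: inside_def C_def image)
  qed
  have oval: "is_oval h g"
    unfolding is_oval_def using valid simple closed inside image strip by auto
  consider "winding_number g 0 = 1" | "winding_number g 0 = -1"
    using simple_closed_path_winding_number_inside[OF simple] inside by metis
  then show ?thesis
  proof cases
    case 1
    then show ?thesis using oval image by blast
  next
    case 2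
    have "0 \<notin> path_image g" using inside by (simp add: inside_def)
    then have "winding_number (reversepath g) 0 = 1"
      using 2 path by (simp add: winding_number_reversepath)
    moreover have "is_oval h (reversepath g)"
      using oval by (simp add: is_oval_def simple_path_reversepath valid_path_imp_reverse)
    ultimately show ?thesis using image by (metis path_image_reversepath)
  qed
qed

text \<open>The line integral of the one-form \<open>F(x,y) dx\<close> along \<open>g\<close>.\<close>
definition line_integral_dx :: "(real \<Rightarrow> real \<Rightarrow> real) \<Rightarrow> (real \<Rightarrow> complex) \<Rightarrow> real" where
  "line_integral_dx F g =
     integral {0..1} (\<lambda>t. F (Re (g t)) (Im (g t)) * Re (vector_derivative g (at t within {0..1})))"

definition abelian_integral :: "(real \<Rightarrow> real \<Rightarrow> complex) \<Rightarrow> nat \<Rightarrow> real \<Rightarrow> real" where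
  "abelian_integral \<gamma> i h = line_integral_dx (\<lambda>x y. (x + 1) powi (int i - 2) * y) (\<gamma> h)"

end

theory Submission
  imports Defs
begin

text \<open>
  Put \<open>u = x + 1\<close>. Since \<open>2 H(x,0)\<close> has the smooth increasing signed square root \<open>sroot\<close>, the map
  \<open>(x,y) \<mapsto> (sroot x, y)\<close> turns the oval of level \<open>h\<close> into the circle of radius \<open>r = sqrt (2 h)\<close>, and
  every oval integral becomes, up to the winding number, a trigonometric integral
  \<open>r\<^sup>2 \<integral> g(r cos \<theta>) sin\<^sup>2 \<theta> d\<theta>\<close> (\<open>oval_line_integral\<close>); only the even part of \<open>g\<close> contributes.

  An ECT-system is recognised pointwise: it suffices that no nontrivial combination of the first
  \<open>k\<close> functions vanishes at a point to order \<open>k\<close>. Then zeros with multiplicity are counted by dividing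
  by the first function and applying Rolle's theorem (\<open>zeros_of_span\<close>). To check this condition, an
  integration by parts raises the exponent of \<open>sin\<close> from 2 to 4 (\<open>trig_weight_raised\<close>). With the exponent
  4 the integral, multiplied by \<open>h\<close>, may be differentiated twice, each derivative lowering the exponent by 2
  (\<open>DERIV_trig_sqrt\<close>), so a zero of order \<open>k\<close> makes \<open>k\<close> consecutive moments
  \<open>\<integral> g(r cos \<theta>) sin\<^bsup>2i\<^esup> \<theta> d\<theta>\<close> vanish. This is impossible if the even part of \<open>g\<close> has fewer than \<open>k\<close>
  positive zeros, because a polynomial in \<open>sin\<^sup>2 \<theta>\<close> of degree less than \<open>k\<close> can match its sign changes
  (\<open>trig_moments_nonzero\<close>).

  It remains to count the zeros of the even part, which compares the integrand at two points \<open>u > 1 > z\<close>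
  with the same value of \<open>H(x,0)\<close>. Their sum determines their product rationally, so in the parameter
  \<open>t = 3 (u + z) - 4\<close>, which runs through the interval from 0 to 2, the even part is a positive multiple of a
  combination of three explicit polynomials (\<open>raised_pairing\<close>). In the order 1, 2, 0 their Wronskians have
  nonnegative coefficients, hence are positive, and \<open>zeros_of_span\<close> applies once more (\<open>cheb_zeros\<close>).

  Analyticity in \<open>h\<close> is obtained by extending the inverse of \<open>sroot\<close> to a complex neighbourhood of each
  compact subinterval (\<open>sroot_inv_extension\<close>) and differentiating under the integral sign.
\<close>

section \<open>Smooth functions and order of vanishing\<close>

text \<open>
  The derivative is existentially quantified, so the notion depends on nothing but the values of the
  function near \<open>L\<close> and closure under sums and products follows by induction on the order.
\<close>
primrec Cdiff :: "nat \<Rightarrow> real set \<Rightarrow> (real \<Rightarrow> real) \<Rightarrow> bool" where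
  "Cdiff 0 L f \<longleftrightarrow> True"
| "Cdiff (Suc n) L f \<longleftrightarrow> (\<exists>f'. (\<forall>x\<in>L. (f has_real_derivative f' x) (at x)) \<and> Cdiff n L f')"

definition smooth :: "real set \<Rightarrow> (real \<Rightarrow> real) \<Rightarrow> bool" where
  "smooth L f \<longleftrightarrow> (\<forall>n. Cdiff n L f)"

lemma Cdiff_Suc_imp: "Cdiff (Suc n) L f \<Longrightarrow> Cdiff n L f"
proof (induction n arbitrary: f)
  case (Suc n)
  then show ?case by (metis Cdiff.simps(2))
qed simp

lemma Cdiff_cong:
  assumes "open L" "\<And>x. x \<in> L \<Longrightarrow> f x = g x" "Cdiff n L f"
  shows "Cdiff n L g"
proof (cases n)
  case (Suc k)
  with assms(3) obtain f' where
    f': "\<And>x. x \<in> L \<Longrightarrow> (f has_real_derivative f' x) (at x)" "Cdiff k L f'" by auto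
  have "(g has_real_derivative f' x) (at x)" if "x \<in> L" for x
    using has_field_derivative_transform_within_open[OF f'(1)[OF that] assms(1) that] assms(2)
    by blast
  with f'(2) Suc show ?thesis by auto
qed simp

lemma Cdiff_add: "Cdiff n L f \<Longrightarrow> Cdiff n L g \<Longrightarrow> Cdiff n L (\<lambda>x. f x + g x)"
proof (induction n arbitrary: f g)
  case (Suc n)
  then obtain f' g' where
    "\<forall>x\<in>L. (f has_real_derivative f' x) (at x)" "Cdiff n L f'"
    "\<forall>x\<in>L. (g has_real_derivative g' x) (at x)" "Cdiff n L g'" by auto
  then show ?case
    using Suc.IH by (auto intro!: exI[of _ "\<lambda>x. f' x + g' x"] derivative_intros)
qed simp

lemma Cdiff_mult: "Cdiff n L f \<Longrightarrow> Cdiff n L g \<Longrightarrow> Cdiff n L (\<lambda>x. f x * g x)"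
proof (induction n arbitrary: f g)
  case (Suc n)
  then obtain f' g' where
    *: "\<forall>x\<in>L. (f has_real_derivative f' x) (at x)" "Cdiff n L f'"
    "\<forall>x\<in>L. (g has_real_derivative g' x) (at x)" "Cdiff n L g'" by auto
  have "Cdiff n L (\<lambda>x. f' x * g x + g' x * f x)"
    by (intro Cdiff_add Suc.IH * Suc.prems[THEN Cdiff_Suc_imp])
  moreover have "\<forall>x\<in>L. ((\<lambda>x. f x * g x) has_real_derivative f' x * g x + g' x * f x) (at x)"
    using * by (auto intro: DERIV_mult)
  ultimately show ?case by (auto intro!: exI[of _ "\<lambda>x. f' x * g x + g' x * f x"])
qed simp

lemma Cdiff_const: "Cdiff n L (\<lambda>x. c)"
  by (induction n arbitrary: c) (auto intro!: exI[of _ "\<lambda>x. 0"])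

lemma smooth_const: "smooth L (\<lambda>x. c)"
  and smooth_add: "smooth L f \<Longrightarrow> smooth L g \<Longrightarrow> smooth L (\<lambda>x. f x + g x)"
  and smooth_mult: "smooth L f \<Longrightarrow> smooth L g \<Longrightarrow> smooth L (\<lambda>x. f x * g x)"
  by (simp_all add: smooth_def Cdiff_const Cdiff_add Cdiff_mult)

lemma smooth_diff: "smooth L f \<Longrightarrow> smooth L g \<Longrightarrow> smooth L (\<lambda>x. f x - g x)"
  using smooth_add[OF _ smooth_mult[OF smooth_const[of L "-1"]], of f g] by simp

lemma smooth_sum: "(\<And>j. j \<in> J \<Longrightarrow> smooth L (f j)) \<Longrightarrow> smooth L (\<lambda>x. \<Sum>j\<in>J. f j x)"
  by (induction J rule: infinite_finite_induct) (auto intro: smooth_const smooth_add)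

lemma smooth_DERIV:
  assumes "smooth L f" "x \<in> L"
  shows "(f has_real_derivative deriv f x) (at x)"
proof -
  have "Cdiff (Suc 0) L f" using assms(1) unfolding smooth_def by blast
  then show ?thesis using assms(2) by (auto simp: DERIV_imp_deriv)
qed

lemma smooth_deriv:
  assumes "open L" "smooth L f"
  shows "smooth L (deriv f)"
  unfolding smooth_def
proof
  fix n
  have "Cdiff (Suc n) L f" using assms(2) unfolding smooth_def by blast
  then obtain f' where "\<forall>x\<in>L. (f has_real_derivative f' x) (at x)" "Cdiff n L f'" by auto
  then show "Cdiff n L (deriv f)"
    using Cdiff_cong[OF assms(1), of f' "deriv f" n] by (metis DERIV_imp_deriv)
qed

lemma smooth_coinduct:
  assumes "P f"
    and step: "\<And>f. P f \<Longrightarrow> \<exists>f'. P f' \<and> (\<forall>x\<in>L. (f has_real_derivative f' x) (at x))"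
  shows "smooth L f"
proof -
  have "Cdiff n L f" for n
    using \<open>P f\<close>
  proof (induction n arbitrary: f)
    case (Suc n)
    then show ?case using step[OF Suc.prems] by auto
  qed simp
  then show ?thesis by (simp add: smooth_def)
qed

text \<open>
  An order of vanishing only for functions that are smooth near \<open>x\<close>, since \<open>deriv\<close> is arbitrary where no
  derivative exists.
\<close>
definition vanishes :: "nat \<Rightarrow> (real \<Rightarrow> real) \<Rightarrow> real \<Rightarrow> bool" where
  "vanishes m f x \<longleftrightarrow> (\<forall>i<m. (deriv ^^ i) f x = 0)"

lemma vanishes_0 [simp]: "vanishes 0 f x"
  by (simp add: vanishes_def)

lemma vanishes_Suc: "vanishes (Suc m) f x \<longleftrightarrow> f x = 0 \<and> vanishes m (deriv f) x"
  unfolding vanishes_def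
  by (subst All_less_Suc2) (simp add: funpow_swap1)

lemma vanishes_mono: "vanishes m f x \<Longrightarrow> k \<le> m \<Longrightarrow> vanishes k f x"
  by (auto simp: vanishes_def)

lemma vanishes_cong:
  assumes "open L" "x \<in> L" "\<And>y. y \<in> L \<Longrightarrow> f y = g y"
  shows "vanishes m f x \<longleftrightarrow> vanishes m g x"
  using assms(2,3)
proof (induction m arbitrary: f g x)
  case (Suc m)
  have "deriv f y = deriv g y" if "y \<in> L" for y
    using that Suc.prems(2) assms(1) by (intro deriv_cong_ev) (auto simp: eventually_nhds)
  then have "vanishes m (deriv f) x \<longleftrightarrow> vanishes m (deriv g) x"
    using Suc.prems(1) by (intro Suc.IH) auto
  then show ?case using Suc.prems by (simp add: vanishes_Suc)
qed simp

lemma vanishes_add: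
  assumes "open L" "x \<in> L" "smooth L f" "smooth L g" "vanishes m f x" "vanishes m g x"
  shows "vanishes m (\<lambda>y. f y + g y) x"
  using assms(3-)
proof (induction m arbitrary: f g)
  case (Suc m)
  have "deriv (\<lambda>y. f y + g y) y = deriv f y + deriv g y" if "y \<in> L" for y
    by (intro DERIV_imp_deriv DERIV_add smooth_DERIV[OF _ that] Suc.prems)
  then have "vanishes m (deriv (\<lambda>y. f y + g y)) x \<longleftrightarrow> vanishes m (\<lambda>y. deriv f y + deriv g y) x"
    by (intro vanishes_cong[OF assms(1,2)])
  then show ?case using Suc by (simp add: vanishes_Suc smooth_deriv[OF assms(1)])
qed simp

lemma deriv_mult_smooth:
  assumes "smooth L f" "smooth L g" "y \<in> L"
  shows "deriv (\<lambda>y. f y * g y) y = deriv f y * g y + f y * deriv g y"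
  using DERIV_mult[OF smooth_DERIV[OF assms(1,3)] smooth_DERIV[OF assms(2,3)]]
  by (auto dest!: DERIV_imp_deriv simp: mult.commute)

lemma vanishes_deriv_mult:
  assumes "open L" "x \<in> L" "smooth L f" "smooth L g"
  shows "vanishes m (deriv (\<lambda>y. f y * g y)) x \<longleftrightarrow>
    vanishes m (\<lambda>y. deriv f y * g y + f y * deriv g y) x"
  by (rule vanishes_cong[OF assms(1,2)]) (rule deriv_mult_smooth[OF assms(3,4)])

lemma vanishes_mult:
  assumes "open L" "x \<in> L" "smooth L f" "smooth L g" "vanishes m f x"
  shows "vanishes m (\<lambda>y. f y * g y) x"
  using assms(3-)
proof (induction m arbitrary: f g)
  case (Suc m)
  have "vanishes m (\<lambda>y. deriv f y * g y + f y * deriv g y) x"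
    using Suc.prems vanishes_mono[OF Suc.prems(3), of m]
    by (intro vanishes_add[OF assms(1,2)] smooth_mult Suc.IH smooth_deriv assms(1))
       (auto simp: vanishes_Suc)
  then have "vanishes m (deriv (\<lambda>y. f y * g y)) x"
    using vanishes_deriv_mult[OF assms(1,2) Suc.prems(1,2)] by blast
  then show ?case using Suc.prems by (simp add: vanishes_Suc)
qed simp

lemma vanishes_diff:
  assumes "open L" "x \<in> L" "smooth L f" "smooth L g" "vanishes m f x" "vanishes m g x"
  shows "vanishes m (\<lambda>y. f y - g y) x"
  using vanishes_add[OF assms(1-3) _ assms(5), of "\<lambda>y. g y * (- 1)"]
    vanishes_mult[OF assms(1,2,4) smooth_const assms(6), of "-1"]
    smooth_mult[OF assms(4) smooth_const, of "-1"] by simp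

lemma vanishes_cancel:
  assumes "open L" "x \<in> L" "smooth L f" "smooth L g" "g x \<noteq> 0" "vanishes m (\<lambda>y. f y * g y) x"
  shows "vanishes m f x"
  using assms(3-)
proof (induction m arbitrary: f)
  case (Suc m)
  note sm = Suc.prems(1) Suc.prems(2) smooth_deriv[OF assms(1) Suc.prems(1)]
    smooth_deriv[OF assms(1) Suc.prems(2)]
  have f: "vanishes m f x"
    using Suc.IH[OF sm(1,2) Suc.prems(3)] vanishes_mono[OF Suc.prems(4), of m] by simp
  have "vanishes m (deriv (\<lambda>y. f y * g y)) x" using Suc.prems(4) by (simp add: vanishes_Suc)
  then have "vanishes m (\<lambda>y. deriv f y * g y + f y * deriv g y) x"
    using vanishes_deriv_mult[OF assms(1,2) sm(1,2)] by blast
  then have "vanishes m (\<lambda>y. (deriv f y * g y + f y * deriv g y) - f y * deriv g y) x"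
    by (rule vanishes_diff[OF assms(1,2), rotated 2])
       (intro smooth_add smooth_mult sm vanishes_mult[OF assms(1,2)] f)+
  then have "vanishes m (deriv f) x" using Suc.IH[OF sm(3,2) Suc.prems(3)] by simp
  then show ?case using Suc.prems by (simp add: vanishes_Suc)
qed simp

text \<open>
  The Wronskian \<open>f' g - f g'\<close> is \<open>g\<^sup>2\<close> times the derivative of \<open>f / g\<close>, so it loses exactly one order of
  vanishing at a zero of \<open>f\<close>. Arguing with the Wronskian avoids derivatives of quotients.
\<close>
lemma vanishes_of_wronskian:
  assumes L: "open L" "x \<in> L" and sm: "smooth L f" "smooth L g" and g: "g x \<noteq> 0"
    and f: "f x = 0" and W: "vanishes k (\<lambda>y. deriv f y * g y - f y * deriv g y) x"
  shows "vanishes (Suc k) f x"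
proof -
  note sm' = sm smooth_deriv[OF L(1) sm(1)] smooth_deriv[OF L(1) sm(2)]
  have "i \<le> k \<Longrightarrow> vanishes (Suc i) f x" for i
  proof (induction i)
    case 0
    then show ?case using f by (simp add: vanishes_Suc)
  next
    case (Suc i)
    have "vanishes (Suc i) (\<lambda>y. (deriv f y * g y - f y * deriv g y) + f y * deriv g y) x"
      using Suc vanishes_mono[OF W, of "Suc i"]
      by (intro vanishes_add[OF L] smooth_diff smooth_mult sm' vanishes_mult[OF L]) auto
    then have "vanishes (Suc i) (deriv f) x"
      using vanishes_cancel[OF L sm'(3,2) g] by simp
    then show ?case using f by (simp add: vanishes_Suc[of "Suc i"])
  qed
  then show ?thesis by simp
qed

section \<open>Counting zeros by division and derivation\<close>

text \<open>
  The new zeros are strictly between consecutive elements of \<open>Z\<close>, hence disjoint from \<open>Z\<close>; this is what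
  allows them to be counted in addition to the multiplicities that survive on \<open>Z\<close>.
\<close>
lemma Rolle_finite:
  fixes \<phi> \<phi>' :: "real \<Rightarrow> real"
  assumes L: "is_interval L" and D: "\<And>x. x \<in> L \<Longrightarrow> (\<phi> has_real_derivative \<phi>' x) (at x)"
    and "finite Z" "Z \<noteq> {}" "Z \<subseteq> L" "\<And>z. z \<in> Z \<Longrightarrow> \<phi> z = 0"
  shows "\<exists>Y. finite Y \<and> Y \<subseteq> L \<and> Y \<inter> Z = {} \<and> Suc (card Y) = card Z \<and> (\<forall>y\<in>Y. \<phi>' y = 0 \<and> y < Max Z)"
  using assms(3-)
proof (induction Z rule: finite_linorder_max_induct)
  case (insert b A)
  show ?case
  proof (cases "A = {}")
    case True
    then show ?thesis by (intro exI[of _ "{}"]) auto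
  next
    case False
    with insert obtain Y where Y: "finite Y" "Y \<subseteq> L" "Y \<inter> A = {}" "Suc (card Y) = card A"
      "\<forall>y\<in>Y. \<phi>' y = 0 \<and> y < Max A" by auto
    define a where "a = Max A"
    have a: "a \<in> A" "a < b" "\<And>x. x \<in> A \<Longrightarrow> x \<le> a"
      using False insert.hyps by (auto simp: a_def)
    have "a \<in> L" using a(1) \<open>insert b A \<subseteq> L\<close> by blast
    moreover have "b \<in> L" using \<open>insert b A \<subseteq> L\<close> by blast
    ultimately have sub: "{a..b} \<subseteq> L"
      using L[unfolded is_interval_1, THEN bspec, THEN bspec, of a b] by (simp add: subset_iff)
    have "\<exists>z>a. z < b \<and> \<phi>' z = 0"
    proof -
      have "continuous_on {a..b} \<phi>"
        using sub by (intro continuous_at_imp_continuous_on ballI DERIV_isCont[OF D]) blast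
      moreover have "\<phi> a = \<phi> b" using a(1) insert.prems(3) by simp
      moreover have "\<phi> differentiable (at x)" if "a < x" "x < b" for x
        using D[of x] sub that real_differentiable_def by (meson atLeastAtMost_iff less_imp_le subsetD)
      ultimately obtain z where z: "a < z" "z < b" "(\<phi> has_real_derivative 0) (at z)"
        using Rolle[OF a(2)] by blast
      then have "\<phi>' z = 0" using DERIV_unique[OF D z(3)] sub by (simp add: subset_iff)
      then show ?thesis using z by blast
    qed
    then obtain z where z: "a < z" "z < b" "\<phi>' z = 0" by blast
    have "z \<notin> Y" using Y(5) z(1) by (auto simp: a_def)
    moreover have "b \<notin> A" using insert.hyps by blast
    moreover have "b \<notin> Y" using Y(5) a(2) by (auto simp: a_def)
    moreover have "z \<notin> A" using a(3)[of z] z(1) by auto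
    moreover have "Max (insert b A) = b"
      using a(2,3) insert.hyps by (intro Max_eqI) (auto intro: less_imp_le)
    moreover have "y < b" if "y \<in> Y" for y
      using Y(5) a(2) that unfolding a_def by (meson less_trans)
    moreover have "z \<in> L" using sub z by auto
    ultimately show ?thesis
      using Y z(2,3) insert.hyps(1) by (intro exI[of _ "insert z Y"]) simp
  qed
qed simp

text \<open>
  The induction divides by the first function \<open>f 0\<close>. The functions \<open>(f j / f 0)'\<close>, up to the factor
  \<open>(f 0)\<^sup>2\<close>, satisfy the hypothesis for one function less: a combination of them vanishing to order \<open>k\<close> at \<open>x\<close>
  lifts to a combination of the \<open>f j\<close> vanishing to order \<open>k + 1\<close>, the coefficient of \<open>f 0\<close> being chosen
  to make the value at \<open>x\<close> zero. By Rolle's theorem the passage costs at most one zero.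
\<close>
lemma zeros_of_span:
  assumes L: "open L" "is_interval L"
    and "\<And>j. j < n \<Longrightarrow> smooth L (f j)"
    and "\<And>k x \<alpha>. k \<le> n \<Longrightarrow> x \<in> L \<Longrightarrow> \<exists>j<k. \<alpha> j \<noteq> 0 \<Longrightarrow> \<not> vanishes k (\<lambda>y. \<Sum>j<k. \<alpha> j * f j y) x"
    and "\<exists>j<n. \<alpha> j \<noteq> 0" "finite Z" "Z \<subseteq> L"
    and "\<And>z. z \<in> Z \<Longrightarrow> vanishes (m z) (\<lambda>y. \<Sum>j<n. \<alpha> j * f j y) z"
  shows "(\<Sum>z\<in>Z. m z) < n"
  using assms(3-)
proof (induction n arbitrary: f \<alpha> m Z)
  case 0
  then show ?case by simp
next
  case (Suc n)
  define F where "F = (\<lambda>y. \<Sum>j<Suc n. \<alpha> j * f j y)"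
  have sF: "smooth L F" unfolding F_def
    by (intro smooth_sum smooth_mult smooth_const Suc.prems(1)) auto
  have s0: "smooth L (f 0)" by (rule Suc.prems(1)) simp
  have f0: "f 0 x \<noteq> 0" if "x \<in> L" for x
    using Suc.prems(2)[of 1 x "\<lambda>_. 1"] that by (simp add: vanishes_Suc)
  define g where "g = (\<lambda>j y. deriv (f (Suc j)) y * f 0 y - f (Suc j) y * deriv (f 0) y)"
  have smg: "smooth L (g j)" if "j < n" for j
    unfolding g_def using that
    by (intro smooth_diff smooth_mult smooth_deriv L Suc.prems(1)) auto
  have wr: "deriv (\<lambda>y. \<Sum>j<Suc k. \<beta> j * f j y) y * f 0 y - (\<Sum>j<Suc k. \<beta> j * f j y) * deriv (f 0) y
      = (\<Sum>j<k. \<beta> (Suc j) * g j y)" if "k \<le> n" "y \<in> L" for k \<beta> y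
  proof -
    have "((\<lambda>y. \<Sum>j<Suc k. \<beta> j * f j y) has_real_derivative (\<Sum>j<Suc k. \<beta> j * deriv (f j) y)) (at y)"
      using that by (intro DERIV_sum DERIV_cmult smooth_DERIV[where L = L] Suc.prems(1)) auto
    then have "deriv (\<lambda>y. \<Sum>j<Suc k. \<beta> j * f j y) y = (\<Sum>j<Suc k. \<beta> j * deriv (f j) y)"
      by (rule DERIV_imp_deriv)
    then show ?thesis
      unfolding g_def sum.lessThan_Suc_shift o_def
      by (simp add: algebra_simps sum_subtractf sum_distrib_left)
  qed
  show ?case
  proof (cases "\<exists>j<n. \<alpha> (Suc j) \<noteq> 0")
    case False
    then have F: "F = (\<lambda>y. \<alpha> 0 * f 0 y)"
      unfolding F_def sum.lessThan_Suc_shift by auto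
    have "\<alpha> 0 \<noteq> 0" using False Suc.prems(3) by (metis less_Suc_eq_0_disj)
    then have "F z \<noteq> 0" if "z \<in> L" for z using f0[OF that] F by simp
    then have "m z = 0" if "z \<in> Z" for z
      using Suc.prems(6)[OF that] that Suc.prems(5) unfolding F_def
      by (cases "m z") (auto simp: vanishes_Suc)
    then show ?thesis by simp
  next
    case True
    define Z1 where "Z1 = {z \<in> Z. m z > 0}"
    have Z1: "finite Z1" "Z1 \<subseteq> L" using Suc.prems by (auto simp: Z1_def)
    have sum1: "sum m Z = sum m Z1"
      unfolding Z1_def using Suc.prems(4) by (intro sum.mono_neutral_right) auto
    show ?thesis
    proof (cases "Z1 = {}")
      case True
      then show ?thesis by (simp add: sum1)
    next
      case False
      define G where "G = (\<lambda>y. deriv F y * f 0 y - F y * deriv (f 0) y)"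
      have G: "G y = (\<Sum>j<n. \<alpha> (Suc j) * g j y)" if "y \<in> L" for y
        using wr[OF order.refl that] by (simp add: G_def F_def)
      have vF: "vanishes (m z) F z" if "z \<in> Z" for z
        using Suc.prems(6)[OF that] by (simp add: F_def)
      have F0: "F z = 0" if "z \<in> Z1" for z
        using vF[of z] that by (cases "m z") (auto simp: Z1_def vanishes_Suc)
      have "((\<lambda>y. F y / f 0 y) has_real_derivative G y / (f 0 y * f 0 y)) (at y)" if "y \<in> L" for y
        unfolding G_def
        using DERIV_divide[OF smooth_DERIV[OF sF that] smooth_DERIV[OF s0 that] f0[OF that]] .
      moreover have "F z / f 0 z = 0" if "z \<in> Z1" for z using F0[OF that] by simp
      ultimately have "\<exists>Y. finite Y \<and> Y \<subseteq> L \<and> Y \<inter> Z1 = {} \<and> Suc (card Y) = card Z1 \<and>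
          (\<forall>y\<in>Y. G y / (f 0 y * f 0 y) = 0 \<and> y < Max Z1)"
        by (rule Rolle_finite[OF L(2) _ Z1(1) False Z1(2)])
      then obtain Y where Y: "finite Y" "Y \<subseteq> L" "Y \<inter> Z1 = {}" "Suc (card Y) = card Z1"
        "\<And>y. y \<in> Y \<Longrightarrow> G y / (f 0 y * f 0 y) = 0" by blast
      \<comment> \<open>The Wronskian keeps all but one of the multiplicities on \<open>Z1\<close> and gains the Rolle zeros.\<close>
      define m' where "m' = (\<lambda>z. if z \<in> Y then 1 else m z - 1)"
      have "(\<Sum>z\<in>Z1 \<union> Y. m' z) < n"
      proof (rule Suc.IH[of g "\<lambda>j. \<alpha> (Suc j)"])
        show "finite (Z1 \<union> Y)" "Z1 \<union> Y \<subseteq> L" using Y Z1 by auto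
        show "\<exists>j<n. \<alpha> (Suc j) \<noteq> 0" by fact
        show "smooth L (g j)" if "j < n" for j by (rule smg[OF that])
        show "vanishes (m' z) (\<lambda>y. \<Sum>j<n. \<alpha> (Suc j) * g j y) z" if z: "z \<in> Z1 \<union> Y" for z
        proof -
          have zL: "z \<in> L" using z Y Z1 by auto
          have "vanishes (m' z) G z"
          proof (cases "z \<in> Y")
            case True
            then have "G z = 0" using Y(5)[OF True] f0[OF zL] by simp
            then show ?thesis using True by (simp add: m'_def vanishes_Suc)
          next
            case False
            then have "z \<in> Z1" using z by blast
            then have v: "vanishes (Suc (m z - 1)) F z" using vF by (auto simp: Z1_def)
            then have "vanishes (m z - 1) G z"
              unfolding G_def
              by (intro vanishes_diff[OF L(1) zL] smooth_mult smooth_deriv L sF s0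
                  vanishes_mult[OF L(1) zL] vanishes_mono[OF v])
                (auto simp: vanishes_Suc)
            then show ?thesis using False by (simp add: m'_def)
          qed
          moreover have "vanishes (m' z) G z \<longleftrightarrow> vanishes (m' z) (\<lambda>y. \<Sum>j<n. \<alpha> (Suc j) * g j y) z"
            by (rule vanishes_cong[OF L(1) zL]) (rule G)
          ultimately show ?thesis by blast
        qed
        show "\<not> vanishes k (\<lambda>y. \<Sum>j<k. \<beta> j * g j y) x"
          if k: "k \<le> n" and x: "x \<in> L" and \<beta>: "\<exists>j<k. \<beta> j \<noteq> 0" for k x \<beta>
        proof
          assume v: "vanishes k (\<lambda>y. \<Sum>j<k. \<beta> j * g j y) x"
          define \<beta>' where "\<beta>' = case_nat (- (\<Sum>j<k. \<beta> j * f (Suc j) x) / f 0 x) \<beta>"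
          define \<Phi> where "\<Phi> = (\<lambda>y. \<Sum>j<Suc k. \<beta>' j * f j y)"
          have "\<Phi> x = 0"
            unfolding \<Phi>_def sum.lessThan_Suc_shift using f0[OF x] by (simp add: \<beta>'_def)
          moreover have "smooth L \<Phi>" unfolding \<Phi>_def using k
            by (intro smooth_sum smooth_mult smooth_const Suc.prems(1)) auto
          moreover have "vanishes k (\<lambda>y. deriv \<Phi> y * f 0 y - \<Phi> y * deriv (f 0) y) x"
          proof -
            have "vanishes k (\<lambda>y. deriv \<Phi> y * f 0 y - \<Phi> y * deriv (f 0) y) x \<longleftrightarrow>
                vanishes k (\<lambda>y. \<Sum>j<k. \<beta> j * g j y) x"
            proof (rule vanishes_cong[OF L(1) x])
              fix y assume "y \<in> L"
              then show "deriv \<Phi> y * f 0 y - \<Phi> y * deriv (f 0) y = (\<Sum>j<k. \<beta> j * g j y)"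
                using wr[OF k, of y \<beta>'] by (simp add: \<Phi>_def \<beta>'_def del: sum.lessThan_Suc)
            qed
            then show ?thesis using v by blast
          qed
          ultimately have "vanishes (Suc k) \<Phi> x"
            by (intro vanishes_of_wronskian[OF L(1) x _ s0 f0[OF x]])
          moreover have "\<exists>j<Suc k. \<beta>' j \<noteq> 0" using \<beta> by (auto simp: \<beta>'_def intro: exI[of _ "Suc _"])
          ultimately show False
            using Suc.prems(2)[of "Suc k" x \<beta>'] k x unfolding \<Phi>_def by simp
        qed
      qed
      moreover have "(\<Sum>z\<in>Z1 \<union> Y. m' z) = (\<Sum>z\<in>Z1. m z - 1) + card Y"
      proof -
        have "(\<Sum>z\<in>Z1. m' z) = (\<Sum>z\<in>Z1. m z - 1)"
          using Y(3) by (intro sum.cong) (auto simp: m'_def)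
        then show ?thesis using Y Z1
          by (subst sum.union_disjoint) (auto simp: m'_def)
      qed
      moreover have "sum m Z1 = (\<Sum>z\<in>Z1. m z - 1) + card Z1"
      proof -
        have "sum m Z1 = (\<Sum>z\<in>Z1. (m z - 1) + 1)"
          by (intro sum.cong) (auto simp: Z1_def)
        then show ?thesis by (simp only: sum.distrib sum_constant) simp
      qed
      ultimately show ?thesis using sum1 Y(4) by simp
    qed
  qed
qed

section \<open>Real analytic functions and ECT-systems\<close>

text \<open>
  Termwise differentiation of the local power series.
\<close>
lemma real_analytic_deriv:
  assumes "real_analytic_on f L"
  shows "real_analytic_on (deriv f) L" "x \<in> L \<Longrightarrow> (f has_real_derivative deriv f x) (at x)"
proof -
  have *: "\<exists>r>0. \<exists>a :: nat \<Rightarrow> real. \<forall>z. \<bar>z\<bar> < r \<longrightarrow>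
      (f has_real_derivative (deriv f (x + z))) (at (x + z)) \<and> (\<lambda>n. a n * z ^ n) sums deriv f (x + z)"
    if xL: "x \<in> L" for x
  proof -
    obtain r a where r: "r > 0" and a: "\<And>y. \<bar>y - x\<bar> < r \<Longrightarrow> (\<lambda>n. a n * (y - x) ^ n) sums f y"
      using bspec[OF assms[unfolded real_analytic_on_def] xL] by auto
    have sums: "(\<lambda>n. a n * z ^ n) sums f (x + z)" if "norm z < r" for z :: real
      using a[of "x + z"] that by simp
    have D: "((\<lambda>z. f (x + z)) has_real_derivative (\<Sum>n. diffs a n * z ^ n)) (at z)"
      if z: "norm z < r" for z :: real
    proof -
      have "((\<lambda>z. \<Sum>n. a n * z ^ n) has_real_derivative (\<Sum>n. diffs a n * z ^ n)) (at z)"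
        using sums sums_summable z by (intro termdiffs_strong'[of r]) blast+
      then show ?thesis
        by (rule has_field_derivative_transform_within_open[of _ _ _ "ball 0 r"])
          (use z sums in \<open>auto simp: sums_iff\<close>)
    qed
    have "(f has_real_derivative (\<Sum>n. diffs a n * z ^ n)) (at (x + z))" if z: "norm z < r" for z
      using D[OF z] unfolding add.commute[of x] by (simp only: DERIV_shift)
    moreover have "(\<lambda>n. diffs a n * z ^ n) sums (\<Sum>n. diffs a n * z ^ n)" if z: "norm z < r" for z :: real
      using termdiffs_sums_strong[OF sums D[OF z] z] by (simp add: sums_iff)
    ultimately show ?thesis
      using r DERIV_imp_deriv
      by (intro exI[of _ r] exI[of _ "diffs a"] conjI allI impI) (force simp: real_norm_def)+
  qed
  show "real_analytic_on (deriv f) L"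
    unfolding real_analytic_on_def
  proof
    fix x assume "x \<in> L"
    from *[OF this] obtain r a where ra: "r > 0"
      "\<And>z. \<bar>z\<bar> < r \<Longrightarrow> (\<lambda>n. a n * z ^ n) sums deriv f (x + z)" by blast
    have "(\<lambda>n. a n * (y - x) ^ n) sums deriv f y" if "\<bar>y - x\<bar> < r" for y
      using ra(2)[OF that] by simp
    then show "\<exists>r>0. \<exists>a :: nat \<Rightarrow> real. \<forall>y. \<bar>y - x\<bar> < r \<longrightarrow> (\<lambda>n. a n * (y - x) ^ n) sums deriv f y"
      using ra(1) by blast
  qed
  show "(f has_real_derivative deriv f x) (at x)" if "x \<in> L"
    using *[OF that] by (metis abs_zero add.right_neutral)
qed

lemma real_analytic_smooth: "real_analytic_on f L \<Longrightarrow> smooth L f"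
  by (rule smooth_coinduct[where P = "\<lambda>f. real_analytic_on f L"]) (use real_analytic_deriv in blast)+

text \<open>
  The real power series consists of the real parts of the Taylor coefficients of the extension.
\<close>
lemma real_analytic_onI:
  assumes "\<And>x. x \<in> S \<Longrightarrow> \<exists>r>0. \<exists>F. F holomorphic_on ball (of_real x) r \<and>
      (\<forall>y. \<bar>y - x\<bar> < r \<longrightarrow> F (of_real y) = of_real (f y))"
  shows "real_analytic_on f S"
  unfolding real_analytic_on_def
proof
  fix x assume "x \<in> S"
  then obtain r F where r: "r > 0" and F: "F holomorphic_on ball (of_real x) r"
    "\<And>y. \<bar>y - x\<bar> < r \<Longrightarrow> F (of_real y) = of_real (f y)" using assms by blast
  define a where "a = (\<lambda>n. Re ((deriv ^^ n) F (of_real x) / fact n))"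
  have "(\<lambda>n. a n * (y - x) ^ n) sums f y" if y: "\<bar>y - x\<bar> < r" for y
  proof -
    have "complex_of_real y \<in> ball (of_real x) r"
      using y by (simp add: dist_of_real dist_real_def)
    from sums_Re[OF holomorphic_power_series[OF F(1) this]]
    have "(\<lambda>n. Re ((deriv ^^ n) F (of_real x) / fact n * of_real ((y - x) ^ n))) sums f y"
      by (simp only: F(2)[OF y] of_real_power of_real_diff Re_complex_of_real)
    then show ?thesis by (simp only: a_def times_complex.sel Re_complex_of_real Im_complex_of_real mult_zero_right diff_zero)
  qed
  then show "\<exists>r>0. \<exists>a :: nat \<Rightarrow> real. \<forall>y. \<bar>y - x\<bar> < r \<longrightarrow> (\<lambda>n. a n * (y - x) ^ n) sums f y"
    using r by blast
qed

text \<open>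
  The order of vanishing given by \<open>zero_multiplicity\<close> is a least index, so all earlier derivatives are
  zero; hence the sum in the definition is bounded by \<open>zeros_of_span\<close> even at points where the least index
  is meaningless.
\<close>
lemma ECT_systemI:
  assumes L: "open L" "is_interval L" "L \<noteq> {}"
    and an: "\<And>f. f \<in> set fs \<Longrightarrow> real_analytic_on f L"
    and nd: "\<And>k x \<alpha>. k \<le> length fs \<Longrightarrow> x \<in> L \<Longrightarrow> \<exists>j<k. \<alpha> j \<noteq> 0 \<Longrightarrow>
      \<not> vanishes k (\<lambda>y. \<Sum>j<k. \<alpha> j * (fs ! j) y) x"
  shows "ECT_system L fs"
  unfolding ECT_system_def
proof (intro conjI ballI allI impI)
  fix k and \<alpha> :: "nat \<Rightarrow> real"
  assume k: "k \<in> {1..length fs}" and \<alpha>: "\<exists>j<k. \<alpha> j \<noteq> 0"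
  define F where "F = (\<lambda>y. \<Sum>j<k. \<alpha> j * (fs ! j) y)"
  have count: "(\<Sum>z\<in>Z. m z) < k"
    if "finite Z" "Z \<subseteq> L" "\<And>z. z \<in> Z \<Longrightarrow> vanishes (m z) F z" for Z m
    using that unfolding F_def
  proof (intro zeros_of_span[OF L(1,2) _ _ \<alpha>])
    show "smooth L ((!) fs j)" if "j < k" for j
      using that k by (intro real_analytic_smooth an) auto
    show "\<not> vanishes i (\<lambda>y. \<Sum>j<i. \<beta> j * (fs ! j) y) x"
      if "i \<le> k" "x \<in> L" "\<exists>j<i. \<beta> j \<noteq> 0" for i x \<beta>
      using nd[of i x \<beta>] that k by auto
  qed auto
  have card: "finite {y \<in> L. F y = 0}"
  proof (rule ccontr)
    assume "infinite {y \<in> L. F y = 0}"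
    then obtain Z where Z: "finite Z" "card Z = k" "Z \<subseteq> {y \<in> L. F y = 0}"
      using infinite_arbitrarily_large by blast
    then have "(\<Sum>z\<in>Z. 1) < k" by (intro count) (auto simp: vanishes_Suc)
    then show False using Z by simp
  qed
  have sub: "isolated_zeros F L \<subseteq> {y \<in> L. F y = 0}"
    by (auto simp: isolated_zeros_def isolated_in_def)
  have "\<exists>x\<in>L. F x \<noteq> 0"
  proof (rule ccontr)
    assume "\<not> (\<exists>x\<in>L. F x \<noteq> 0)"
    then have "finite L" using card by (metis (mono_tags, lifting) Collect_cong Collect_mem_eq)
    then show False using L(1,3) using finite_imp_not_open by blast
  qed
  moreover have fin: "finite (isolated_zeros F L)" using finite_subset[OF sub card] .
  moreover have "(\<Sum>x\<in>isolated_zeros F L. zero_multiplicity F x) < k"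
    using sub by (intro count fin) (auto simp: vanishes_def zero_multiplicity_def dest: not_less_Least)
  ultimately show "let F = \<lambda>x. \<Sum>j<k. \<alpha> j * (fs ! j) x in (\<exists>x\<in>L. F x \<noteq> 0) \<and>
      finite (isolated_zeros F L) \<and> (\<Sum>x\<in>isolated_zeros F L. zero_multiplicity F x) \<le> k - 1"
    by (simp add: Let_def F_def)
qed (use L an in auto)

section \<open>Straightening the ovals\<close>

definition quad :: "real \<Rightarrow> real" where
  "quad x = (3 * x\<^sup>2 + 8 * x + 6) / 6"

text \<open>
  The signed square root of \<open>2 H(x,0) = x\<^sup>2 quad x\<close>: smooth and increasing through the minimum at 0.
\<close>
definition sroot :: "real \<Rightarrow> real" where
  "sroot x = x * sqrt (quad x)"

text \<open>
  The half-width of the range of \<open>sroot\<close> on the projection of the annulus; its square is \<open>2 / 12\<close>.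
\<close>
definition sroot_max :: real where
  "sroot_max = sqrt (1 / 6)"

definition sroot_inv :: "real \<Rightarrow> real" where
  "sroot_inv = the_inv_into {-1..1 / 3} sroot"

definition sroot_inv' :: "real \<Rightarrow> real" where
  "sroot_inv' s = sqrt (quad (sroot_inv s)) / (sroot_inv s + 1)\<^sup>2"

lemma quad_pos: "quad x > 0"
proof -
  have "quad x - 1 / 9 = (x + 4 / 3)\<^sup>2 / 2"
    by (simp add: quad_def power2_eq_square field_simps)
  moreover have "(x + 4 / 3)\<^sup>2 / 2 \<ge> 0" by simp
  ultimately show ?thesis by linarith
qed

lemma H_eq_sroot: "H x y = ((sroot x)\<^sup>2 + y\<^sup>2) / 2"
  using quad_pos[of x] unfolding H_def sroot_def
  by (simp add: power_mult_distrib) (simp add: quad_def field_simps)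

text \<open>
  Away from 0 the derivative is \<open>H\<^sub>x(x,0) / sroot x\<close>, and \<open>H\<^sub>x(x,0) = x (x + 1)\<^sup>2\<close>.
\<close>
lemma DERIV_sroot: "(sroot has_real_derivative (x + 1)\<^sup>2 / sqrt (quad x)) (at x)"
proof -
  have Dq: "(quad has_real_derivative (6 * x + 8) / 6) (at x)"
    unfolding quad_def by (auto intro!: derivative_eq_intros)
  have "(sroot has_real_derivative
          1 * sqrt (quad x) + ((6 * x + 8) / 6 * (inverse (sqrt (quad x)) / 2)) * x) (at x)"
    unfolding sroot_def
    by (rule DERIV_cong[OF DERIV_mult[OF DERIV_ident
          DERIV_chain2[OF DERIV_real_sqrt[OF quad_pos] Dq]]]) (simp add: field_simps)
  moreover have "1 * sqrt (quad x) + ((6 * x + 8) / 6 * (inverse (sqrt (quad x)) / 2)) * x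
      = (quad x + (6 * x + 8) * x / 12) / sqrt (quad x)"
    using quad_pos[of x] by (simp add: field_simps)
  moreover have "quad x + (6 * x + 8) * x / 12 = (x + 1)\<^sup>2"
    by (simp add: quad_def field_simps power2_eq_square)
  ultimately show ?thesis by simp
qed

lemma continuous_sroot: "continuous_on A sroot"
  using DERIV_sroot by (meson DERIV_isCont continuous_at_imp_continuous_on)

lemma sroot_strict_mono: 
  assumes "-1 \<le> x" "x < y" shows "sroot x < sroot y"
proof (rule DERIV_pos_imp_increasing_open[OF assms(2)])
  fix z assume "x < z" "z < y"
  then have "(z + 1)\<^sup>2 / sqrt (quad z) > 0" using assms quad_pos[of z] by simp
  then show "\<exists>D. (sroot has_real_derivative D) (at z) \<and> D > 0" using DERIV_sroot by blast
qed (rule continuous_sroot)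

lemma inj_on_sroot: "inj_on sroot {-1..1 / 3}"
  by (rule inj_onI)
    (metis sroot_strict_mono atLeastAtMost_iff less_irrefl linorder_neqE_linordered_idom)

lemma sroot_ends: "sroot (-1) = - sroot_max" "sroot (1 / 3) = sroot_max"
proof -
  have "sqrt (3 / 2) = 3 * sqrt (1 / 6 :: real)"
    by (rule real_sqrt_unique) (simp_all add: power_mult_distrib)
  then show "sroot (-1) = - sroot_max" "sroot (1 / 3) = sroot_max"
    by (simp_all add: sroot_def quad_def sroot_max_def power2_eq_square)
qed

lemma sroot_image: "sroot ` {-1..1 / 3} = {- sroot_max..sroot_max}"
proof
  show "sroot ` {-1..1 / 3} \<subseteq> {- sroot_max..sroot_max}"
  proof (rule image_subsetI)
    fix x :: real assume "x \<in> {-1..1 / 3}"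
    then show "sroot x \<in> {- sroot_max..sroot_max}"
      using sroot_strict_mono[of "-1" x] sroot_strict_mono[of x "1 / 3"] sroot_ends
      by (smt (verit) atLeastAtMost_iff)
  qed
  show "{- sroot_max..sroot_max} \<subseteq> sroot ` {-1..1 / 3}"
  proof
    fix s assume "s \<in> {- sroot_max..sroot_max}"
    then show "s \<in> sroot ` {-1..1 / 3}"
      using IVT'[of sroot "-1" s "1 / 3"] sroot_ends continuous_sroot by fastforce
  qed
qed

lemma sroot_inv_sroot: "x \<in> {-1..1 / 3} \<Longrightarrow> sroot_inv (sroot x) = x"
  using the_inv_into_f_f[OF inj_on_sroot] by (simp add: sroot_inv_def)

lemma sroot_sroot_inv: "s \<in> {- sroot_max..sroot_max} \<Longrightarrow> sroot (sroot_inv s) = s"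
  using f_the_inv_into_f[OF inj_on_sroot] sroot_image by (simp add: sroot_inv_def)

lemma sroot_inv_in: "s \<in> {- sroot_max..sroot_max} \<Longrightarrow> sroot_inv s \<in> {-1..1 / 3}"
  unfolding sroot_inv_def by (rule the_inv_into_into[OF inj_on_sroot]) (simp_all add: sroot_image)

lemma continuous_sroot_inv: "continuous_on {- sroot_max..sroot_max} sroot_inv"
  using continuous_on_inv[OF continuous_sroot, of "{-1..1/3}" sroot_inv] sroot_inv_sroot sroot_image by auto

lemma sroot_inv_strict:
  assumes "s \<in> {- sroot_max<..<sroot_max}" shows "-1 < sroot_inv s \<and> sroot_inv s < 1 / 3"
proof -
  have "sroot_inv s \<in> {-1..1/3}" "sroot (sroot_inv s) = s" using sroot_inv_in sroot_sroot_inv assms by auto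
  then show ?thesis using sroot_ends assms
    by (metis atLeastAtMost_iff greaterThanLessThan_iff less_irrefl order.order_iff_strict)
qed

lemma DERIV_sroot_inv:
  assumes "s \<in> {- sroot_max<..<sroot_max}" shows "(sroot_inv has_real_derivative sroot_inv' s) (at s)"
proof -
  have "isCont sroot_inv s"
    using continuous_on_interior[OF continuous_sroot_inv] assms by simp
  moreover have "(sroot_inv s + 1)\<^sup>2 / sqrt (quad (sroot_inv s)) \<noteq> 0"
    using sroot_inv_strict[OF assms] quad_pos[of "sroot_inv s"] by auto
  ultimately have "(sroot_inv has_real_derivative inverse ((sroot_inv s + 1)\<^sup>2 / sqrt (quad (sroot_inv s)))) (at s)"
    using DERIV_inverse_function[OF DERIV_sroot, of sroot_inv s "- sroot_max" sroot_max] assms sroot_sroot_inv by auto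
  then show ?thesis by (simp add: sroot_inv'_def)
qed

lemma continuous_sroot_inv':
  "continuous_on {- sroot_max<..<sroot_max} sroot_inv'"
  unfolding sroot_inv'_def quad_def
  by (intro continuous_intros continuous_on_subset[OF continuous_sroot_inv] ballI)
    (use sroot_inv_strict in force)+

lemma continuous_on_comp_sroot_inv:
  assumes "continuous_on {-1<..<1 / 3} W"
  shows "continuous_on {- sroot_max<..<sroot_max} (\<lambda>s. W (sroot_inv s))"
  by (rule continuous_on_compose2[OF assms continuous_on_subset[OF continuous_sroot_inv]])
    (use sroot_inv_strict in auto)

section \<open>Integrals along ovals as trigonometric integrals\<close>

text \<open>
  A continuous logarithm of a differentiable curve differs near each point from the principal logarithm of a
  quotient only by a constant.
\<close>
lemma has_vector_derivative_log:
  fixes p :: "real \<Rightarrow> complex"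
  assumes "isCont p t" "eventually (\<lambda>s. c s = exp (p s)) (nhds t)"
    and c: "(c has_vector_derivative c') (at t)"
  shows "(p has_vector_derivative c' / c t) (at t)"
proof -
  have ct: "c t = exp (p t)" using assms(2) by (rule eventually_nhds_x_imp_x)
  have "((\<lambda>s. c s / c t) has_vector_derivative c' / c t) (at t)"
    using c by (auto intro!: derivative_eq_intros)
  moreover have "(Ln has_field_derivative 1) (at (c t / c t))"
    using has_field_derivative_Ln[of 1] ct by simp
  ultimately have "((\<lambda>s. Ln (c s / c t)) has_vector_derivative c' / c t) (at t)"
    using field_vector_diff_chain_at[of "\<lambda>s. c s / c t" "c' / c t" t Ln 1] by (simp add: o_def)
  then have "((\<lambda>s. p t + Ln (c s / c t)) has_vector_derivative c' / c t) (at t)"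
    by (auto intro!: derivative_eq_intros)
  moreover have "eventually (\<lambda>s. p t + Ln (c s / c t) = p s) (nhds t)"
  proof -
    have "(p \<longlongrightarrow> p t) (nhds t)"
      using assms(1) by (simp add: isCont_def tendsto_at_iff_tendsto_nhds)
    then have "eventually (\<lambda>s. dist (p s) (p t) < pi) (nhds t)"
      using pi_gt_zero by (rule tendstoD)
    then show ?thesis using assms(2)
    proof eventually_elim
      case (elim s)
      have "c s / c t = exp (p s - p t)" using elim ct by (simp add: exp_diff)
      moreover have "\<bar>Im (p s - p t)\<bar> < pi"
        using elim(1) abs_Im_le_cmod[of "p s - p t"] by (simp add: dist_norm)
      ultimately show ?case by (simp add: Ln_exp abs_less_iff)
    qed
  qed
  ultimately show ?thesis
    using has_vector_derivative_cong_ev[where S = UNIV and f = "\<lambda>s. p t + Ln (c s / c t)" and g = p] eventually_nhds_x_imp_x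
    by auto
qed

lemma periodic_antideriv:
  fixes \<Theta> K :: "real \<Rightarrow> real"
  assumes "\<And>x. (\<Theta> has_real_derivative K x) (at x)" "\<And>x. K (x + p) = K x"
  shows "\<Theta> (x + p) - \<Theta> x = \<Theta> p - \<Theta> 0"
proof -
  have "((\<lambda>x. \<Theta> (x + p) - \<Theta> x) has_real_derivative 0) (at x)" for x
    using DERIV_diff[OF assms(1)[of "x + p", unfolded DERIV_shift] assms(1)[of x]] assms(2) by simp
  then show ?thesis using DERIV_isconst_all[of "\<lambda>x. \<Theta> (x + p) - \<Theta> x" x 0] by simp
qed

lemma ex_antideriv:
  fixes K :: "real \<Rightarrow> real"
  assumes "continuous_on UNIV K"
  shows "\<exists>\<Theta>. (\<forall>x. (\<Theta> has_real_derivative K x) (at x)) \<and>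
    (\<forall>a b. a \<le> b \<longrightarrow> (K has_integral (\<Theta> b - \<Theta> a)) {a..b})"
proof -
  obtain \<Theta> where D: "\<And>x. (\<Theta> has_vector_derivative K x) (at x)"
    using einterval_antiderivative[of "-\<infinity>" "\<infinity>" K] assms
    by (auto simp: continuous_on_eq_continuous_at)
  have int: "(K has_integral (\<Theta> b - \<Theta> a)) {a..b}" if "a \<le> b" for a b
    using that D by (intro fundamental_theorem_of_calculus) (auto intro: has_vector_derivative_at_within)
  show ?thesis
    by (rule exI[of _ \<Theta>]) (simp add: has_real_derivative_iff_has_vector_derivative D int)
qed

text \<open>
  The curve \<open>(sroot x, y)\<close> runs on a circle, so it has a continuous argument \<open>\<phi>\<close>, and the
  integrand is the derivative of \<open>- \<Theta>(\<phi>)\<close> with \<open>\<Theta>\<close> an antiderivative of a periodic function. The increment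
  of \<open>\<phi>\<close> over the whole curve is determined by the winding number about 0. This agrees with the winding number of the oval
  itself, because the two curves are homotopic by a straight-line homotopy that never meets 0.
\<close>
lemma oval_line_integral:
  assumes h: "0 < h" "h < 1 / 12" and g: "is_oval h g"
    and W: "continuous_on {-1<..<1 / 3} W"
  shows "line_integral_dx (\<lambda>x y. W x * y) g = - Re (winding_number g 0) *
      (2 * h * integral {0..2 * pi} (\<lambda>\<theta>. W (sroot_inv (sqrt (2 * h) * cos \<theta>)) *
         sroot_inv' (sqrt (2 * h) * cos \<theta>) * (sin \<theta>)\<^sup>2))"
    and "winding_number g 0 = 1 \<or> winding_number g 0 = - 1"
proof -
  define r where "r = sqrt (2 * h)"
  have r: "0 < r" "r < sroot_max" "r\<^sup>2 = 2 * h" using h by (auto simp: r_def sroot_max_def)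
  have rcos: "r * cos t \<in> {- sroot_max<..<sroot_max}" for t
  proof -
    have "\<bar>r * cos t\<bar> \<le> r * 1" using r by (auto simp: abs_mult intro!: mult_left_mono)
    then show ?thesis using r by auto
  qed
  define K where "K = (\<lambda>\<theta>. W (sroot_inv (r * cos \<theta>)) * sroot_inv' (r * cos \<theta>) * (r * sin \<theta>)\<^sup>2)"
  have contK: "continuous_on UNIV K"
  proof -
    have "continuous_on UNIV (\<lambda>\<theta>. r * cos \<theta>)" by (intro continuous_intros)
    then show ?thesis unfolding K_def
      using rcos
      by (intro continuous_on_mult continuous_on_power continuous_on_compose2[OF continuous_on_comp_sroot_inv[OF W]]
        continuous_on_compose2[OF continuous_sroot_inv'] continuous_intros) auto
  qed
  obtain \<Theta> where \<Theta>: "\<And>x. (\<Theta> has_real_derivative K x) (at x)"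
    and int: "\<And>a b. a \<le> b \<Longrightarrow> (K has_integral (\<Theta> b - \<Theta> a)) {a..b}"
    using ex_antideriv[OF contK] by blast
  define I where "I = \<Theta> (2 * pi) - \<Theta> 0"
  have shift: "\<Theta> (x + 2 * pi) = \<Theta> x + I" for x
  proof -
    have "K (y + 2 * pi) = K y" for y by (simp add: K_def)
    from periodic_antideriv[OF \<Theta> this] show ?thesis by (simp add: I_def diff_eq_eq)
  qed
  have I: "I = 2 * h * integral {0..2 * pi} (\<lambda>\<theta>. W (sroot_inv (r * cos \<theta>)) * sroot_inv' (r * cos \<theta>) * (sin \<theta>)\<^sup>2)"
  proof -
    have "I = integral {0..2 * pi} K" unfolding I_def using int[of 0 "2 * pi"] by (simp add: integral_unique)
    also have "\<dots> = integral {0..2 * pi} (\<lambda>\<theta>. 2 * h * (W (sroot_inv (r * cos \<theta>)) * sroot_inv' (r * cos \<theta>) * (sin \<theta>)\<^sup>2))"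
      by (simp add: K_def power_mult_distrib r(3) mult_ac)
    finally show ?thesis by simp
  qed
  have vp: "valid_path g" and sp: "simple_path g" and cl: "pathfinish g = pathstart g"
    and im: "path_image g \<subseteq> {z. H (Re z) (Im z) = h \<and> - 1 < Re z \<and> Re z < 1 / 3}"
    and ins: "0 \<in> inside (path_image g)"
    using g by (auto simp: is_oval_def)
  show w: "winding_number g 0 = 1 \<or> winding_number g 0 = - 1"
    using simple_closed_path_winding_number_inside[OF sp] ins by metis
  define c where "c = (\<lambda>t. Complex (sroot (Re (g t))) (Im (g t)))"
  have gt: "(sroot (Re (g t)))\<^sup>2 + (Im (g t))\<^sup>2 = r\<^sup>2" "- 1 < Re (g t)" "Re (g t) < 1 / 3"
    if "t \<in> {0..1}" for t
  proof -
    have "g t \<in> path_image g" using that by (simp add: path_image_def)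
    then show "(sroot (Re (g t)))\<^sup>2 + (Im (g t))\<^sup>2 = r\<^sup>2" "- 1 < Re (g t)" "Re (g t) < 1 / 3"
      using im by (auto simp: H_eq_sroot r)
  qed
  have cn: "cmod (c t) = r" if "t \<in> {0..1}" for t
    using gt(1)[OF that] r(1) by (simp add: c_def cmod_def)
  have pg: "path g" using vp by (rule valid_path_imp_path)
  have pc: "path c"
    using pg unfolding path_def c_def Complex_eq
    by (intro continuous_intros continuous_on_compose2[OF continuous_sroot[of UNIV]]) auto
  have c0: "0 \<notin> path_image c" using cn r by (force simp: path_image_def)
  have wc: "winding_number c 0 = winding_number g 0"
  proof (rule winding_number_homotopic_loops[symmetric], rule homotopic_loops_linear)
    show "path g" "path c" "pathfinish g = pathstart g" by fact+
    show "pathfinish c = pathstart c" using cl by (simp add: c_def pathfinish_def pathstart_def)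
    show "closed_segment (g t) (c t) \<subseteq> - {0}" if t: "t \<in> {0..1}" for t
    proof -
      have "0 \<notin> closed_segment (g t) (c t)"
      proof
        assume "0 \<in> closed_segment (g t) (c t)"
        then obtain u where u: "0 \<le> u" "u \<le> 1" "0 = (1 - u) *\<^sub>R g t + u *\<^sub>R c t"
          by (auto simp: in_segment)
        have "Im (g t) = 0" using arg_cong[OF u(3), of Im] by (simp add: c_def algebra_simps)
        moreover have "Re (g t) * ((1 - u) + u * sqrt (quad (Re (g t)))) = 0"
          using arg_cong[OF u(3), of Re] by (simp add: c_def sroot_def algebra_simps)
        moreover have "(1 - u) + u * sqrt (quad (Re (g t))) > 0"
          using u quad_pos[of "Re (g t)"] by (cases "u = 1") (auto intro!: add_pos_nonneg)
        ultimately have "Im (g t) = 0" "Re (g t) = 0" by auto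
        then show False using gt(1)[OF t] r by (simp add: sroot_def)
      qed
      then show ?thesis by blast
    qed
  qed
  obtain p where p: "path p" and pe: "pathfinish p - pathstart p = 2 * of_real pi * \<i> * winding_number c 0"
    and pc: "\<And>t. t \<in> {0..1} \<Longrightarrow> c t = 0 + exp (p t)"
    using winding_number_as_continuous_log[OF pc c0] by metis
  define \<phi> where "\<phi> = (\<lambda>t. Im (p t))"
  have c_eq: "sroot (Re (g t)) = r * cos (\<phi> t)" "Im (g t) = r * sin (\<phi> t)" if "t \<in> {0..1}" for t
  proof -
    have "cmod (c t) = exp (Re (p t))" using pc[OF that] by simp
    then have "c t = of_real r * cis (\<phi> t)"
      using pc[OF that] cn[OF that] by (simp add: exp_eq_polar \<phi>_def)
    then show "sroot (Re (g t)) = r * cos (\<phi> t)" "Im (g t) = r * sin (\<phi> t)"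
      by (simp_all add: c_def complex_eq_iff)
  qed
  have contp: "continuous_on {0..1} p" using p by (simp add: path_def)
  obtain N where N: "finite N" and gN: "g C1_differentiable_on ({0..1} - N)"
    using vp by (auto simp: valid_path_def piecewise_C1_differentiable_on_def)
  define D where "D = (\<lambda>t. vector_derivative g (at t))"
  have D: "(g has_vector_derivative D t) (at t)" if "t \<in> {0..1} - N" for t
  proof -
    have "g differentiable (at t)"
      using gN that unfolding C1_differentiable_on_eq by (elim conjE) (rule bspec)
    then show ?thesis unfolding D_def by (rule vector_derivative_works[THEN iffD1])
  qed
  have "((\<lambda>t. W (Re (g t)) * Im (g t) * Re (vector_derivative g (at t within {0..1}))) has_integral
        (- \<Theta> (\<phi> 1) - - \<Theta> (\<phi> 0))) {0..1}"
  proof (rule fundamental_theorem_of_calculus_interior_strong[OF N, where f = "\<lambda>t. - \<Theta> (\<phi> t)"])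
    show "continuous_on {0..1} (\<lambda>t. - \<Theta> (\<phi> t))"
    proof -
      have "continuous_on UNIV \<Theta>"
        by (intro continuous_at_imp_continuous_on ballI DERIV_isCont[OF \<Theta>])
      moreover have "continuous_on {0..1} \<phi>"
        unfolding \<phi>_def by (rule continuous_on_Im[OF contp])
      ultimately show ?thesis
        by (rule continuous_on_minus[OF continuous_on_compose2]) simp
    qed
    fix t :: real assume t: "t \<in> {0<..<1} - N"
    then have t01: "t \<in> {0..1}" by auto
    have Dt: "(g has_vector_derivative D t) (at t)" using D t by auto
    have "vector_derivative g (at t within {0..1}) = D t"
      using Dt t by (intro vector_derivative_at_within_ivl) auto
    moreover have "((\<lambda>t. - \<Theta> (\<phi> t)) has_real_derivative W (Re (g t)) * Im (g t) * Re (D t)) (at t)"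
    proof -
      define x where "x = Re (g t)"
      define s' where "s' = (x + 1)\<^sup>2 / sqrt (quad x) * Re (D t)"
      define y' where "y' = Im (D t)"
      have DRe: "((\<lambda>t. Re (g t)) has_real_derivative Re (D t)) (at t)"
        and DIm: "((\<lambda>t. Im (g t)) has_real_derivative y') (at t)"
        using Dt by (auto simp: has_vector_derivative_complex_iff y'_def)
      have Ds: "((\<lambda>t. sroot (Re (g t))) has_real_derivative s') (at t)"
        unfolding s'_def x_def by (rule DERIV_chain2[OF DERIV_sroot DRe])
      have Dc: "(c has_vector_derivative Complex s' y') (at t)"
        unfolding c_def has_vector_derivative_complex_iff using Ds DIm by simp
      have ev: "eventually (\<lambda>s. s \<in> {0..1}) (nhds t)"
        using t eventually_nhds_in_open[of "{0<..<1}" t] by (auto elim: eventually_mono)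
      have "isCont p t" using continuous_on_interior[OF contp] t by simp
      moreover have "eventually (\<lambda>s. c s = exp (p s)) (nhds t)"
        using ev by eventually_elim (use pc in auto)
      ultimately have "(p has_vector_derivative Complex s' y' / c t) (at t)"
        using Dc by (rule has_vector_derivative_log)
      then have "(\<phi> has_real_derivative Im (Complex s' y' / c t)) (at t)"
        by (simp add: has_vector_derivative_complex_iff \<phi>_def)
      moreover have "Im (Complex s' y' / c t) = (y' * sroot x - s' * Im (g t)) / r\<^sup>2"
        using gt(1)[OF t01] by (simp add: c_def x_def Im_divide)
      ultimately have D\<phi>: "(\<phi> has_real_derivative (y' * sroot x - s' * Im (g t)) / r\<^sup>2) (at t)" by simp
      have orth: "sroot x * s' + Im (g t) * y' = 0"
      proof -
        have "((\<lambda>t. (sroot (Re (g t)))\<^sup>2 + (Im (g t))\<^sup>2) has_real_derivative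
            2 * sroot x * s' + 2 * Im (g t) * y') (at t)"
          unfolding x_def
          by (rule DERIV_cong[OF DERIV_add[OF DERIV_power[OF Ds] DERIV_power[OF DIm]]]) simp
        moreover have "((\<lambda>t. (sroot (Re (g t)))\<^sup>2 + (Im (g t))\<^sup>2) has_real_derivative 0) (at t)"
          by (rule has_field_derivative_transform_within_open[of "\<lambda>_. r\<^sup>2" _ _ "{0<..<1}"])
            (use t gt(1) in auto)
        ultimately have "2 * sroot x * s' + 2 * Im (g t) * y' = 0" by (rule DERIV_unique)
        then show ?thesis by simp
      qed
      have xx: "sroot_inv (r * cos (\<phi> t)) = x"
        using c_eq(1)[OF t01] sroot_inv_sroot[of x] gt(2,3)[OF t01] by (simp add: x_def)
      have "K (\<phi> t) = W x * sroot_inv' (sroot x) * (Im (g t))\<^sup>2"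
        using c_eq[OF t01] xx by (simp add: K_def x_def)
      moreover have "sroot_inv' (sroot x) * s' = Re (D t)"
      proof -
        have "sroot_inv (sroot x) = x" using xx c_eq(1)[OF t01] by (simp add: x_def)
        then show ?thesis
          unfolding sroot_inv'_def s'_def using quad_pos[of x] gt(2)[OF t01] by (simp add: x_def)
      qed
      moreover have "Im (g t) * ((y' * sroot x - s' * Im (g t)) / r\<^sup>2) = - s'"
      proof -
        have "Im (g t) * (y' * sroot x - s' * Im (g t)) = sroot x * (Im (g t) * y') - s' * (Im (g t))\<^sup>2"
          by (simp add: algebra_simps power2_eq_square)
        also have "\<dots> = - s' * ((sroot x)\<^sup>2 + (Im (g t))\<^sup>2)"
          using orth by (simp add: algebra_simps power2_eq_square) algebra
        also have "\<dots> = - s' * r\<^sup>2" using gt(1)[OF t01] by (simp add: x_def)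
        finally show ?thesis using r(1) by simp
      qed
      ultimately have "- (K (\<phi> t) * ((y' * sroot x - s' * Im (g t)) / r\<^sup>2)) = W x * Im (g t) * Re (D t)"
        by (simp add: power2_eq_square) algebra
      then show ?thesis
        using DERIV_minus[OF DERIV_chain2[OF \<Theta> D\<phi>]] by (simp add: x_def)
    qed
    ultimately show "((\<lambda>t. - \<Theta> (\<phi> t)) has_vector_derivative
        W (Re (g t)) * Im (g t) * Re (vector_derivative g (at t within {0..1}))) (at t)"
      by (simp add: has_real_derivative_iff_has_vector_derivative)
  qed simp
  then have L: "line_integral_dx (\<lambda>x y. W x * y) g = \<Theta> (\<phi> 0) - \<Theta> (\<phi> 1)"
    unfolding line_integral_dx_def by (simp add: integral_unique)
  have \<phi>1: "\<phi> 1 = \<phi> 0 + 2 * pi * Re (winding_number g 0)"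
    using arg_cong[OF pe, of Im] w by (auto simp: wc \<phi>_def pathfinish_def pathstart_def)
  from w have "\<Theta> (\<phi> 1) - \<Theta> (\<phi> 0) = Re (winding_number g 0) * I"
  proof
    assume "winding_number g 0 = 1"
    then show ?thesis using \<phi>1 shift[of "\<phi> 0"] by simp
  next
    assume "winding_number g 0 = - 1"
    then show ?thesis using \<phi>1 shift[of "\<phi> 1"] by simp
  qed
  then show "line_integral_dx (\<lambda>x y. W x * y) g = - Re (winding_number g 0) *
      (2 * h * integral {0..2 * pi} (\<lambda>\<theta>. W (sroot_inv (sqrt (2 * h) * cos \<theta>)) *
         sroot_inv' (sqrt (2 * h) * cos \<theta>) * (sin \<theta>)\<^sup>2))"
    using L I by (simp add: r_def algebra_simps)
qed

section \<open>Trigonometric integrals and their derivatives in the level\<close>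

definition trig :: "nat \<Rightarrow> (real \<Rightarrow> real) \<Rightarrow> real \<Rightarrow> real" where
  "trig n g r = integral {0..2 * pi} (\<lambda>\<theta>. g (r * cos \<theta>) * sin \<theta> ^ (2 * n))"

lemma mult_cos_in:
  fixes r c :: real
  assumes "r \<in> {- c<..<c}" shows "r * cos \<theta> \<in> {- c<..<c}"
proof -
  have "\<bar>r * cos \<theta>\<bar> \<le> \<bar>r\<bar> * 1" unfolding abs_mult by (intro mult_left_mono) auto
  then show ?thesis using assms by auto
qed

lemma continuous_comp_cos:
  fixes g :: "real \<Rightarrow> real"
  assumes "continuous_on {- c<..<c} g" "r \<in> {- c<..<c}"
  shows "continuous_on A (\<lambda>\<theta>. g (r * cos \<theta>))"
  by (rule continuous_on_compose2[OF assms(1)])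
    (use mult_cos_in[OF assms(2)] in \<open>auto intro!: continuous_intros\<close>)

lemma integral_trig_deriv:
  assumes "\<And>\<theta>. (F has_real_derivative f \<theta>) (at \<theta>)" "F (2 * pi) = F 0"
  shows "(f has_integral 0) {0..2 * pi}"
  using fundamental_theorem_of_calculus[of 0 "2 * pi" F f] assms
  by (simp add: has_real_derivative_iff_has_vector_derivative has_vector_derivative_at_within)

lemma trig_has_integral:
  assumes "continuous_on {- c<..<c} g" "r \<in> {- c<..<c}"
  shows "((\<lambda>\<theta>. g (r * cos \<theta>) * sin \<theta> ^ (2 * n)) has_integral trig n g r) {0..2 * pi}"
  unfolding trig_def
  by (intro integrable_integral integrable_continuous_interval continuous_intros
      continuous_comp_cos[OF assms])

text \<open>
  Integration by parts: \<open>cos\<^sup>2 \<theta> sin\<^sup>2 \<theta>\<close> is \<open>cos \<theta>\<close> times the derivative of \<open>sin\<^sup>3 \<theta> / 3\<close>, and one factor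
  \<open>r cos \<theta>\<close> is absorbed in \<open>s * g s\<close>.
\<close>
lemma trig_raise:
  assumes g: "continuous_on {- c<..<c} g" and g': "continuous_on {- c<..<c} P'"
    and P: "\<And>s. s \<in> {- c<..<c} \<Longrightarrow> ((\<lambda>s. s * g s) has_real_derivative P' s) (at s)"
    and r: "r \<in> {- c<..<c}" "r \<noteq> 0"
  shows "trig 1 g r = trig 2 (\<lambda>s. g s + P' s / 3) r"
proof -
  have cont: "continuous_on {- c<..<c} (\<lambda>s. g s + P' s / 3)"
    using g g' by (intro continuous_intros) simp_all
  define F where "F = (\<lambda>\<theta>. (r * cos \<theta> * g (r * cos \<theta>)) * sin \<theta> ^ 3 / 3)"
  define f where "f = (\<lambda>\<theta>. r * (g (r * cos \<theta>) * sin \<theta> ^ (2 * 1)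
      - (g (r * cos \<theta>) + P' (r * cos \<theta>) / 3) * sin \<theta> ^ (2 * 2)))"
  have "(F has_real_derivative f \<theta>) (at \<theta>)" for \<theta>
  proof -
    have "((\<lambda>\<theta>. r * cos \<theta>) has_real_derivative - (r * sin \<theta>)) (at \<theta>)"
      by (auto intro!: derivative_eq_intros)
    from DERIV_chain2[OF P[OF mult_cos_in[OF r(1)]] this]
    have D: "((\<lambda>\<theta>. r * cos \<theta> * g (r * cos \<theta>)) has_real_derivative P' (r * cos \<theta>) * - (r * sin \<theta>)) (at \<theta>)" .
    have "(F has_real_derivative P' (r * cos \<theta>) * - (r * sin \<theta>) * (sin \<theta> ^ 3 / 3)
        + sin \<theta> ^ 2 * cos \<theta> * (r * cos \<theta> * g (r * cos \<theta>))) (at \<theta>)"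
    proof -
      have "((\<lambda>\<theta>. sin \<theta> ^ 3 / 3) has_real_derivative sin \<theta> ^ 2 * cos \<theta>) (at \<theta>)"
        by (auto intro!: derivative_eq_intros)
      from DERIV_mult[OF D this] show ?thesis unfolding F_def by (simp add: algebra_simps)
    qed
    moreover have "P' (r * cos \<theta>) * - (r * sin \<theta>) * (sin \<theta> ^ 3 / 3)
        + sin \<theta> ^ 2 * cos \<theta> * (r * cos \<theta> * g (r * cos \<theta>)) = f \<theta>"
    proof -
      have "sin \<theta> ^ 2 * cos \<theta> * (r * cos \<theta> * g (r * cos \<theta>))
          = r * g (r * cos \<theta>) * (sin \<theta> ^ 2 * (cos \<theta>)\<^sup>2)"
        by (simp add: power2_eq_square)
      also have "(cos \<theta>)\<^sup>2 = 1 - (sin \<theta>)\<^sup>2" by (rule cos_squared_eq)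
      finally show ?thesis unfolding f_def by (simp add: algebra_simps eval_nat_numeral)
    qed
    ultimately show ?thesis by simp
  qed
  then have "(f has_integral 0) {0..2 * pi}"
    by (rule integral_trig_deriv) (simp add: F_def)
  moreover have "(f has_integral (r * (trig 1 g r - trig 2 (\<lambda>s. g s + P' s / 3) r))) {0..2 * pi}"
    unfolding f_def
    by (intro has_integral_mult_right has_integral_diff trig_has_integral[OF g r(1)]
        trig_has_integral[OF cont r(1)])
  ultimately have "0 = r * (trig 1 g r - trig 2 (\<lambda>s. g s + P' s / 3) r)"
    by (rule has_integral_unique)
  then show ?thesis using r(2) by simp
qed

text \<open>
  In the variable \<open>s = r cos \<theta>\<close> the function on the left is twice the integral of \<open>g(s) (r\<^sup>2 - s\<^sup>2)\<^bsup>n + 1/2\<^esup>\<close>, whose derivative in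
  \<open>r\<close> is evident. The angular form keeps the domain fixed, and the term with \<open>g'\<close> is removed by integration
  by parts.
\<close>
lemma DERIV_trig:
  assumes g: "\<And>s. s \<in> {- c<..<c} \<Longrightarrow> (g has_real_derivative g' s) (at s)"
    and g': "continuous_on {- c<..<c} g'" and r: "r \<in> {0<..<c}"
  shows "((\<lambda>r. r ^ (2 * Suc n) * trig (Suc n) g r) has_real_derivative
    real (2 * n + 1) * r ^ (2 * n + 1) * trig n g r) (at r)"
proof -
  have r': "r \<in> {- c<..<c}" using r by auto
  have contg: "continuous_on {- c<..<c} g"
    by (intro continuous_at_imp_continuous_on ballI DERIV_isCont[OF g])
  define V where "V = integral {0..2 * pi} (\<lambda>\<theta>. g' (r * cos \<theta>) * cos \<theta> * sin \<theta> ^ (2 * Suc n))"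
  have DT: "(trig (Suc n) g has_real_derivative V) (at r)"
  proof -
    have "((\<lambda>r. integral (cbox 0 (2 * pi)) (\<lambda>\<theta>. g (r * cos \<theta>) * sin \<theta> ^ (2 * Suc n))) has_field_derivative
        integral (cbox 0 (2 * pi)) (\<lambda>\<theta>. g' (r * cos \<theta>) * cos \<theta> * sin \<theta> ^ (2 * Suc n)))
        (at r within {- c<..<c})"
    proof (rule leibniz_rule_field_derivative[OF _ _ _ r'])
      show "((\<lambda>r. g (r * cos \<theta>) * sin \<theta> ^ (2 * Suc n)) has_real_derivative
          g' (x * cos \<theta>) * cos \<theta> * sin \<theta> ^ (2 * Suc n)) (at x within {- c<..<c})"
        if "x \<in> {- c<..<c}" for x \<theta>
      proof -
        have "((\<lambda>r. r * cos \<theta>) has_real_derivative cos \<theta>) (at x)"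
          by (auto intro!: derivative_eq_intros)
        from DERIV_chain2[OF g[OF mult_cos_in[OF that]] this]
        show ?thesis by (rule has_field_derivative_at_within[OF DERIV_cmult_right])
      qed
      show "(\<lambda>\<theta>. g (x * cos \<theta>) * sin \<theta> ^ (2 * Suc n)) integrable_on cbox 0 (2 * pi)"
        if "x \<in> {- c<..<c}" for x
        using trig_has_integral[OF contg that, of "Suc n"] unfolding cbox_interval
        by (rule has_integral_integrable)
      show "continuous_on ({- c<..<c} \<times> cbox 0 (2 * pi))
          (\<lambda>(x, \<theta>). g' (x * cos \<theta>) * cos \<theta> * sin \<theta> ^ (2 * Suc n))"
        unfolding split_beta
        by (intro continuous_intros continuous_on_compose2[OF g'])
          (use mult_cos_in in auto)
    qed simp
    then show ?thesis
      using r' by (simp add: trig_def[abs_def] V_def at_within_open[of r "{- c<..<c}"] del: mult_Suc_right)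
  qed
  have parts: "r * V = real (2 * n + 1) * trig n g r - real (2 * n + 2) * trig (Suc n) g r"
  proof -
    define F where "F = (\<lambda>\<theta>. g (r * cos \<theta>) * (cos \<theta> * sin \<theta> ^ (2 * n + 1)))"
    define f where "f = (\<lambda>\<theta>. real (2 * n + 1) * (g (r * cos \<theta>) * sin \<theta> ^ (2 * n))
        - real (2 * n + 2) * (g (r * cos \<theta>) * sin \<theta> ^ (2 * Suc n))
        - r * (g' (r * cos \<theta>) * cos \<theta> * sin \<theta> ^ (2 * Suc n)))"
    have "(F has_real_derivative f \<theta>) (at \<theta>)" for \<theta>
    proof -
      have "((\<lambda>\<theta>. r * cos \<theta>) has_real_derivative - (r * sin \<theta>)) (at \<theta>)"
        by (auto intro!: derivative_eq_intros)
      from DERIV_chain2[OF g[OF mult_cos_in[OF r']] this]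
      have D: "((\<lambda>\<theta>. g (r * cos \<theta>)) has_real_derivative g' (r * cos \<theta>) * - (r * sin \<theta>)) (at \<theta>)" .
      have Dpow: "((\<lambda>\<theta>. sin \<theta> ^ (2 * n + 1)) has_real_derivative real (2 * n + 1) * (cos \<theta> * sin \<theta> ^ (2 * n))) (at \<theta>)"
        by (rule DERIV_cong[OF DERIV_power[OF DERIV_sin]]) simp
      have "((\<lambda>\<theta>. cos \<theta> * sin \<theta> ^ (2 * n + 1)) has_real_derivative
          - sin \<theta> * sin \<theta> ^ (2 * n + 1) + real (2 * n + 1) * (cos \<theta> * sin \<theta> ^ (2 * n)) * cos \<theta>) (at \<theta>)"
        by (rule DERIV_mult[OF DERIV_cos Dpow])
      also have "- sin \<theta> * sin \<theta> ^ (2 * n + 1) + real (2 * n + 1) * (cos \<theta> * sin \<theta> ^ (2 * n)) * cos \<theta>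
         = real (2 * n + 1) * sin \<theta> ^ (2 * n) - real (2 * n + 2) * sin \<theta> ^ (2 * Suc n)"
      proof -
        have "cos \<theta> * cos \<theta> = 1 - (sin \<theta>)\<^sup>2" by (simp add: cos_squared_eq flip: power2_eq_square)
        then have "real (2 * n + 1) * (cos \<theta> * sin \<theta> ^ (2 * n)) * cos \<theta>
          = real (2 * n + 1) * (sin \<theta> ^ (2 * n) * (1 - (sin \<theta>)\<^sup>2))" by (simp add: mult_ac)
        then show ?thesis by (simp add: algebra_simps power2_eq_square)
      qed
      finally have D2: "((\<lambda>\<theta>. cos \<theta> * sin \<theta> ^ (2 * n + 1)) has_real_derivative
          real (2 * n + 1) * sin \<theta> ^ (2 * n) - real (2 * n + 2) * sin \<theta> ^ (2 * Suc n)) (at \<theta>)" .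
      have "g' (r * cos \<theta>) * - (r * sin \<theta>) * (cos \<theta> * sin \<theta> ^ (2 * n + 1)) +
          (real (2 * n + 1) * sin \<theta> ^ (2 * n) - real (2 * n + 2) * sin \<theta> ^ (2 * Suc n)) * g (r * cos \<theta>) = f \<theta>"
        unfolding f_def by (simp add: algebra_simps)
      then show ?thesis unfolding F_def using DERIV_mult[OF D D2] by simp
    qed
    then have "(f has_integral 0) {0..2 * pi}"
      by (rule integral_trig_deriv) (simp add: F_def)
    moreover have "(f has_integral (real (2 * n + 1) * trig n g r - real (2 * n + 2) * trig (Suc n) g r
        - r * V)) {0..2 * pi}"
      unfolding f_def V_def
      by (intro has_integral_mult_right has_integral_diff trig_has_integral[OF contg r']
          integrable_integral integrable_continuous_interval continuous_intros
          continuous_comp_cos[OF g' r'])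
    ultimately have "real (2 * n + 1) * trig n g r - real (2 * n + 2) * trig (Suc n) g r - r * V = 0"
      by (rule has_integral_unique[symmetric])
    then show ?thesis by simp
  qed
  have "((\<lambda>r. r ^ (2 * Suc n) * trig (Suc n) g r) has_real_derivative
      real (2 * Suc n) * r ^ (2 * n + 1) * trig (Suc n) g r + V * r ^ (2 * Suc n)) (at r)"
    using DERIV_mult[OF DERIV_pow[of "2 * Suc n" r] DT] by simp
  also have "real (2 * Suc n) * r ^ (2 * n + 1) * trig (Suc n) g r + V * r ^ (2 * Suc n)
      = r ^ (2 * n + 1) * (real (2 * n + 2) * trig (Suc n) g r + r * V)"
    by (simp add: algebra_simps)
  also have "\<dots> = real (2 * n + 1) * r ^ (2 * n + 1) * trig n g r"
    unfolding parts by simp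
  finally show ?thesis .
qed

lemma DERIV_trig_sqrt:
  assumes g: "\<And>s. s \<in> {- c<..<c} \<Longrightarrow> (g has_real_derivative g' s) (at s)"
    and g': "continuous_on {- c<..<c} g'" and h: "0 < h" "sqrt (2 * h) < c"
  shows "((\<lambda>h. (2 * h) ^ Suc n * trig (Suc n) g (sqrt (2 * h))) has_real_derivative
    real (2 * n + 1) * ((2 * h) ^ n * trig n g (sqrt (2 * h)))) (at h)"
proof -
  define r where "r = sqrt (2 * h)"
  have r: "r \<in> {0<..<c}" "r \<noteq> 0" using h by (auto simp: r_def)
  have r2: "r\<^sup>2 = 2 * h" using h by (simp add: r_def)
  have "((\<lambda>h. sqrt (2 * h)) has_real_derivative 1 / r) (at h)"
    using h by (auto intro!: derivative_eq_intros simp: r_def field_simps)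
  from DERIV_chain2[OF DERIV_trig[OF g g' r(1)[unfolded r_def]] this]
  have "((\<lambda>h. sqrt (2 * h) ^ (2 * Suc n) * trig (Suc n) g (sqrt (2 * h))) has_real_derivative
      real (2 * n + 1) * r ^ (2 * n + 1) * trig n g r * (1 / r)) (at h)" by (simp add: r_def)
  moreover have "real (2 * n + 1) * r ^ (2 * n + 1) * trig n g r * (1 / r)
      = real (2 * n + 1) * ((2 * h) ^ n * trig n g r)"
    using r(2) by (simp add: power_mult r2)
  ultimately have "((\<lambda>h. sqrt (2 * h) ^ (2 * Suc n) * trig (Suc n) g (sqrt (2 * h))) has_real_derivative
      real (2 * n + 1) * ((2 * h) ^ n * trig n g r)) (at h)" by simp
  then show ?thesis unfolding r_def
    by (rule has_field_derivative_transform_within_open[of _ _ _ "{0<..}"])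
      (use h in \<open>auto simp: power_mult simp del: mult_Suc_right power_Suc\<close>)
qed

text \<open>
  Every derivative in \<open>h\<close> lowers the exponent of \<open>sin\<close> by two, up to a nonzero factor.
\<close>
lemma vanishes_trig:
  assumes g: "\<And>s. s \<in> {- c<..<c} \<Longrightarrow> (g has_real_derivative g' s) (at s)"
    and g': "continuous_on {- c<..<c} g'" and L: "open L" "\<And>h. h \<in> L \<Longrightarrow> 0 < h \<and> sqrt (2 * h) < c"
    and h: "h \<in> L" and "a \<noteq> 0" "k \<le> Suc n"
    and "vanishes k (\<lambda>h. a * ((2 * h) ^ n * trig n g (sqrt (2 * h)))) h" "j < k"
  shows "trig (n - j) g (sqrt (2 * h)) = 0"
  using assms(6-)
proof (induction k arbitrary: n a j)
  case (Suc k)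
  have 0: "trig n g (sqrt (2 * h)) = 0"
    using Suc.prems L(2)[OF h] by (simp add: vanishes_Suc)
  show ?case
  proof (cases "j")
    case 0
    then show ?thesis using \<open>trig n g (sqrt (2 * h)) = 0\<close> by simp
  next
    case (Suc i)
    then obtain m where n: "n = Suc m" using Suc.prems(2,4) by (cases n) auto
    have "deriv (\<lambda>h. a * ((2 * h) ^ n * trig n g (sqrt (2 * h)))) y
        = (a * real (2 * m + 1)) * ((2 * y) ^ m * trig m g (sqrt (2 * y)))" if "y \<in> L" for y
      unfolding n using L(2)[OF that]
      by (intro DERIV_imp_deriv DERIV_cong[OF DERIV_cmult[OF DERIV_trig_sqrt[OF g g']]]) auto
    from vanishes_cong[OF L(1) h this]
    have "vanishes k (\<lambda>y. (a * real (2 * m + 1)) * ((2 * y) ^ m * trig m g (sqrt (2 * y)))) h"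
      using Suc.prems(3) by (simp add: vanishes_Suc)
    from Suc.IH[OF _ _ this, of i] show ?thesis
      using Suc.prems n Suc by auto
  qed
qed simp

section \<open>Sign changes and vanishing moments\<close>

lemma constant_sign:
  fixes f :: "real \<Rightarrow> real"
  assumes "continuous_on {a<..<b} f" "\<And>x. x \<in> {a<..<b} \<Longrightarrow> f x \<noteq> 0"
  obtains s :: real where "s \<noteq> 0" "\<And>x. x \<in> {a<..<b} \<Longrightarrow> f x * s > 0"
proof -
  have conn: "connected (f ` {a<..<b})"
    by (rule connected_continuous_image[OF assms(1)]) simp
  have "\<not> (f x < 0 \<and> f y > 0)" if "x \<in> {a<..<b}" "y \<in> {a<..<b}" for x y
  proof
    assume "f x < 0 \<and> f y > 0"
    then have "0 \<in> f ` {a<..<b}"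
      using connectedD_interval[OF conn, of "f x" "f y" 0] that by auto
    then show False using assms(2) by auto
  qed
  then have "(\<forall>x\<in>{a<..<b}. f x > 0) \<or> (\<forall>x\<in>{a<..<b}. f x < 0)"
    using assms(2) by (metis linorder_neqE_linordered_idom)
  then show ?thesis
  proof
    assume "\<forall>x\<in>{a<..<b}. f x > 0"
    then show ?thesis by (intro that[of 1]) auto
  next
    assume "\<forall>x\<in>{a<..<b}. f x < 0"
    then show ?thesis by (intro that[of "-1"]) auto
  qed
qed

text \<open>
  The set \<open>Z\<close> collects those zeros at which the sign changes. It is built from left to right, a zero being
  added exactly if the sign on the next interval would otherwise be wrong.
\<close>
lemma sign_polynomial:
  fixes f :: "real \<Rightarrow> real"
  assumes "continuous_on {a<..<b} f" "finite {x \<in> {a<..<b}. f x = 0}"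
  shows "\<exists>Z e. Z \<subseteq> {x \<in> {a<..<b}. f x = 0} \<and> e \<noteq> 0 \<and> (\<forall>x\<in>{a<..<b}. f x * (e * (\<Prod>z\<in>Z. z - x)) \<ge> 0)"
  using assms
proof (induction "card {x \<in> {a<..<b}. f x = 0}" arbitrary: b rule: less_induct)
  case less
  define Z0 where "Z0 = {x \<in> {a<..<b}. f x = 0}"
  show ?case
  proof (cases "Z0 = {}")
    case True
    then obtain s where "s \<noteq> 0" "\<And>x. x \<in> {a<..<b} \<Longrightarrow> f x * s > 0"
      using constant_sign[OF less.prems(1)] by (auto simp: Z0_def)
    then show ?thesis by (intro exI[of _ "{}"] exI[of _ s]) (auto intro: less_imp_le)
  next
    case False
    have fin: "finite Z0" using less.prems(2) by (simp add: Z0_def)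
    define m where "m = Max Z0"
    have m: "m \<in> Z0" and max: "\<And>x. x \<in> Z0 \<Longrightarrow> x \<le> m"
      using fin False by (auto simp: m_def)
    have mab: "a < m" "m < b" "f m = 0" using m by (auto simp: Z0_def)
    have sub: "{x \<in> {a<..<m}. f x = 0} \<subset> Z0"
      using m mab by (auto simp: Z0_def)
    have "continuous_on {a<..<m} f"
      by (rule continuous_on_subset[OF less.prems(1)]) (use mab in auto)
    moreover have "card {x \<in> {a<..<m}. f x = 0} < card {x \<in> {a<..<b}. f x = 0}"
      using psubset_card_mono[OF fin sub] by (simp add: Z0_def)
    moreover have "finite {x \<in> {a<..<m}. f x = 0}"
      using fin sub finite_subset by blast
    ultimately have "\<exists>Z e. Z \<subseteq> {x \<in> {a<..<m}. f x = 0} \<and> e \<noteq> 0 \<and>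
        (\<forall>x\<in>{a<..<m}. f x * (e * (\<Prod>z\<in>Z. z - x)) \<ge> 0)"
      using less.hyps[of m] by simp
    then obtain Z e where Z: "Z \<subseteq> {x \<in> {a<..<m}. f x = 0}" "e \<noteq> 0"
      and pos: "\<And>x. x \<in> {a<..<m} \<Longrightarrow> f x * (e * (\<Prod>z\<in>Z. z - x)) \<ge> 0"
      by auto
    have ZZ0: "Z \<subseteq> Z0" using Z(1) mab by (auto simp: Z0_def)
    then have finZ: "finite Z" using fin by (rule finite_subset)
    have "continuous_on {m<..<b} f"
      by (rule continuous_on_subset[OF less.prems(1)]) (use mab in auto)
    moreover have "f x \<noteq> 0" if "x \<in> {m<..<b}" for x
      using max[of x] that mab by (auto simp: Z0_def)
    ultimately obtain s where s: "s \<noteq> 0" "\<And>x. x \<in> {m<..<b} \<Longrightarrow> f x * s > 0"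
      using constant_sign by metis
    have prod: "(\<Prod>z\<in>Z. z - x) * (-1) ^ card Z > 0" if "x > m" for x
    proof -
      have "(\<Prod>z\<in>Z. z - x) * (-1) ^ card Z = (\<Prod>z\<in>Z. (z - x) * (-1))"
        by (simp only: prod.distrib prod_constant)
      also have "\<dots> > 0" using Z(1) that by (intro prod_pos) auto
      finally show ?thesis .
    qed
    define d where "d = e * (-1) ^ card Z * s"
    have d: "d \<noteq> 0" using Z(2) s(1) by (simp add: d_def)
    have right: "f x * (e * (\<Prod>z\<in>Z. z - x)) * d \<ge> 0" if "x \<in> {m<..<b}" for x
    proof -
      have "f x * (e * (\<Prod>z\<in>Z. z - x)) * d = (f x * s) * ((\<Prod>z\<in>Z. z - x) * (-1) ^ card Z) * e\<^sup>2"
        by (simp add: d_def power2_eq_square mult_ac)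
      moreover have "f x * s \<ge> 0" "(\<Prod>z\<in>Z. z - x) * (-1) ^ card Z \<ge> 0"
        using s(2)[OF that] prod[of x] that by auto
      ultimately show ?thesis by (simp only: mult_nonneg_nonneg zero_le_power2)
    qed
    show ?thesis
    proof (cases "d > 0")
      case True
      have "f x * (e * (\<Prod>z\<in>Z. z - x)) \<ge> 0" if xab: "x \<in> {a<..<b}" for x
      proof -
        consider "x \<in> {a<..<m}" | "x = m" | "x \<in> {m<..<b}" using xab by force
        then show ?thesis
          using pos mab right True by cases (auto simp: zero_le_mult_iff)
      qed
      then show ?thesis using Z(2) ZZ0 unfolding Z0_def by (intro exI[of _ Z] exI[of _ e]) auto
    next
      case False
      have "f x * (e * (\<Prod>z\<in>insert m Z. z - x)) \<ge> 0" if xab: "x \<in> {a<..<b}" for x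
      proof -
        have "m \<notin> Z" using Z(1) by auto
        then have eq: "f x * (e * (\<Prod>z\<in>insert m Z. z - x)) = f x * (e * (\<Prod>z\<in>Z. z - x)) * (m - x)"
          using finZ by simp
        consider "x \<in> {a<..<m}" | "x = m" | "x \<in> {m<..<b}" using xab by force
        then show ?thesis
        proof cases
          case 1
          then show ?thesis unfolding eq using pos[OF 1] by (intro mult_nonneg_nonneg[of "_ * _"]) auto
        next
          case 3
          then have "f x * (e * (\<Prod>z\<in>Z. z - x)) \<le> 0"
            using right[OF 3] False d by (simp add: zero_le_mult_iff)
          then show ?thesis unfolding eq using 3 by (intro mult_nonpos_nonpos[of "_ * _"]) auto
        qed (use mab in simp)
      qed
      moreover have "insert m Z \<subseteq> Z0" using ZZ0 m by simp
      ultimately show ?thesis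
        using Z(2) unfolding Z0_def by (intro exI[of _ "insert m Z"] exI[of _ e]) blast
    qed
  qed
qed

text \<open>
  The substitution \<open>\<theta> \<mapsto> \<theta> + \<pi>\<close>.
\<close>
lemma trig_reflect:
  assumes "continuous_on {- c<..<c} g" "r \<in> {- c<..<c}"
  shows "trig n (\<lambda>s. g (- s)) r = trig n g r"
proof -
  define K where "K = (\<lambda>\<theta>. g (r * cos \<theta>) * sin \<theta> ^ (2 * n))"
  have "continuous_on UNIV K"
    unfolding K_def by (intro continuous_intros continuous_comp_cos[OF assms])
  then obtain \<Theta> where \<Theta>: "\<And>x. (\<Theta> has_real_derivative K x) (at x)"
    and int: "\<And>a b. a \<le> b \<Longrightarrow> (K has_integral (\<Theta> b - \<Theta> a)) {a..b}"
    using ex_antideriv by blast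
  have "K (y + 2 * pi) = K y" for y by (simp add: K_def)
  from periodic_antideriv[OF \<Theta> this]
  have per: "\<Theta> (x + 2 * pi) - \<Theta> x = \<Theta> (2 * pi) - \<Theta> 0" for x .
  have "((\<lambda>\<theta>. g (- (r * cos \<theta>)) * sin \<theta> ^ (2 * n)) has_integral (\<Theta> (2 * pi + pi) - \<Theta> (0 + pi))) {0..2 * pi}"
  proof (rule fundamental_theorem_of_calculus)
    fix \<theta> :: real
    have "((\<lambda>\<theta>. \<Theta> (\<theta> + pi)) has_real_derivative K (\<theta> + pi)) (at \<theta>)"
      using \<Theta>[of "\<theta> + pi"] by (simp add: DERIV_shift)
    moreover have "K (\<theta> + pi) = g (- (r * cos \<theta>)) * sin \<theta> ^ (2 * n)"
      by (simp add: K_def power_mult)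
    ultimately show "((\<lambda>\<theta>. \<Theta> (\<theta> + pi)) has_vector_derivative g (- (r * cos \<theta>)) * sin \<theta> ^ (2 * n))
        (at \<theta> within {0..2 * pi})"
      by (simp add: has_real_derivative_iff_has_vector_derivative has_vector_derivative_at_within)
  qed simp
  moreover have "\<Theta> (2 * pi + pi) - \<Theta> (0 + pi) = \<Theta> (2 * pi) - \<Theta> 0"
    using per[of pi] by (simp add: add.commute)
  moreover have "trig n g r = \<Theta> (2 * pi) - \<Theta> 0"
    using int[of 0 "2 * pi"] by (simp add: trig_def K_def integral_unique)
  ultimately show ?thesis by (simp add: trig_def integral_unique)
qed

text \<open>
  As \<open>z\<^sup>2 - s\<^sup>2 = (z\<^sup>2 - r\<^sup>2) + r\<^sup>2 sin\<^sup>2 \<theta>\<close> for \<open>s = r cos \<theta>\<close>, each factor is of degree one in \<open>sin\<^sup>2 \<theta>\<close>.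
\<close>
lemma trig_orthogonal:
  assumes g: "continuous_on {- c<..<c} g" and r: "r \<in> {- c<..<c}"
    and 0: "\<And>i. m \<le> i \<Longrightarrow> i \<le> m + card Z \<Longrightarrow> trig i g r = 0" and "finite Z"
  shows "trig m (\<lambda>s. g s * (\<Prod>z\<in>Z. z\<^sup>2 - s\<^sup>2)) r = 0"
  using assms(4,3)
proof (induction Z arbitrary: m rule: finite_induct)
  case (insert z Z)
  define Q where "Q = (\<lambda>s. g s * (\<Prod>z\<in>Z. z\<^sup>2 - s\<^sup>2))"
  have Q: "continuous_on {- c<..<c} Q" unfolding Q_def by (intro continuous_intros g)
  have "trig m (\<lambda>s. g s * (\<Prod>z\<in>insert z Z. z\<^sup>2 - s\<^sup>2)) r =
      integral {0..2 * pi} (\<lambda>\<theta>. (z\<^sup>2 - r\<^sup>2) * (Q (r * cos \<theta>) * sin \<theta> ^ (2 * m))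
        + r\<^sup>2 * (Q (r * cos \<theta>) * sin \<theta> ^ (2 * Suc m)))"
    unfolding trig_def
  proof (intro integral_cong)
    fix \<theta> :: real
    define x where "x = r * cos \<theta>"
    have "z\<^sup>2 - x\<^sup>2 = (z\<^sup>2 - r\<^sup>2) + r\<^sup>2 * (sin \<theta>)\<^sup>2"
      by (simp add: x_def power_mult_distrib cos_squared_eq algebra_simps)
    then have "g x * (\<Prod>z\<in>insert z Z. z\<^sup>2 - x\<^sup>2) = ((z\<^sup>2 - r\<^sup>2) + r\<^sup>2 * (sin \<theta>)\<^sup>2) * Q x"
      using insert.hyps by (simp add: Q_def)
    then have "g x * (\<Prod>z\<in>insert z Z. z\<^sup>2 - x\<^sup>2) * sin \<theta> ^ (2 * m) =
        (z\<^sup>2 - r\<^sup>2) * (Q x * sin \<theta> ^ (2 * m)) + r\<^sup>2 * (Q x * sin \<theta> ^ (2 * Suc m))"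
      by (simp only:) (simp add: algebra_simps power2_eq_square)
    then show "g (r * cos \<theta>) * (\<Prod>z\<in>insert z Z. z\<^sup>2 - (r * cos \<theta>)\<^sup>2) * sin \<theta> ^ (2 * m) =
        (z\<^sup>2 - r\<^sup>2) * (Q (r * cos \<theta>) * sin \<theta> ^ (2 * m)) + r\<^sup>2 * (Q (r * cos \<theta>) * sin \<theta> ^ (2 * Suc m))"
      unfolding x_def .
  qed
  also have "\<dots> = (z\<^sup>2 - r\<^sup>2) * trig m Q r + r\<^sup>2 * trig (Suc m) Q r"
    by (intro integral_unique has_integral_add has_integral_mult_right trig_has_integral[OF Q r])
  also have "\<dots> = 0"
  proof -
    have "trig m Q r = 0" unfolding Q_def using insert.hyps by (intro insert.IH insert.prems) auto
    moreover have "trig (Suc m) Q r = 0"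
      unfolding Q_def using insert.hyps by (intro insert.IH insert.prems) auto
    ultimately show ?thesis by simp
  qed
  finally show ?case .
qed (use 0 in auto)

text \<open>
  If the moments vanished, the even part of \<open>g\<close>, times the nonnegative weight \<open>sin\<^bsup>2m\<^esup> \<theta>\<close>, would be
  orthogonal to every polynomial of degree at most \<open>k\<close> in
  \<open>sin\<^sup>2 \<theta>\<close>, in particular to the one that changes sign exactly where the even part does. The product has
  constant sign, so it would vanish identically.
\<close>
lemma trig_moments_nonzero:
  assumes g: "continuous_on {- c<..<c} g" and r: "r \<in> {0<..<c}"
    and zeros: "finite {s \<in> {0<..<c}. g s + g (- s) = 0}" "card {s \<in> {0<..<c}. g s + g (- s) = 0} \<le> k"
  shows "\<exists>i\<in>{m..m + k}. trig i g r \<noteq> 0"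
proof (rule ccontr)
  assume "\<not> (\<exists>i\<in>{m..m + k}. trig i g r \<noteq> 0)"
  then have 0: "trig i g r = 0" if "m \<le> i" "i \<le> m + k" for i using that by auto
  have r': "r \<in> {- c<..<c}" using r by auto
  define E where "E = (\<lambda>s. g s + g (- s))"
  have gm: "continuous_on {- c<..<c} (\<lambda>s. g (- s))"
    by (rule continuous_on_compose2[OF g]) (auto intro!: continuous_intros)
  have E: "continuous_on {- c<..<c} E"
    unfolding E_def by (intro continuous_intros g gm)
  have "continuous_on {0<..<c} E" by (rule continuous_on_subset[OF E]) auto
  from sign_polynomial[OF this] zeros(1)
  obtain Z e where Z: "Z \<subseteq> {s \<in> {0<..<c}. E s = 0}" "e \<noteq> 0"
    and sgn: "\<And>s. s \<in> {0<..<c} \<Longrightarrow> E s * (e * (\<Prod>z\<in>Z. z - s)) \<ge> 0"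
    unfolding E_def by blast
  have finZ: "finite Z" and cardZ: "card Z \<le> k"
    using Z(1) zeros unfolding E_def by (auto intro: finite_subset le_trans[OF card_mono])
  define Q where "Q = (\<lambda>s. E s * (\<Prod>z\<in>Z. z\<^sup>2 - s\<^sup>2))"
  have Q: "continuous_on {- c<..<c} Q" unfolding Q_def by (intro continuous_intros E)
  have "trig i E r = trig i g r + trig i (\<lambda>s. g (- s)) r" for i
    using has_integral_add[OF trig_has_integral[OF g r'] trig_has_integral[OF gm r']]
    unfolding trig_def E_def by (intro integral_unique) (simp add: algebra_simps trig_def)
  then have "trig i E r = 0" if "m \<le> i" "i \<le> m + k" for i
    using 0[OF that] trig_reflect[OF g r'] by simp
  then have Q0: "trig m Q r = 0"
    unfolding Q_def using cardZ by (intro trig_orthogonal[OF E r' _ finZ]) auto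
  have pos: "e * Q s \<ge> 0" if s: "s \<in> {0<..<c}" for s
  proof -
    have "(\<Prod>z\<in>Z. z\<^sup>2 - s\<^sup>2) = (\<Prod>z\<in>Z. z - s) * (\<Prod>z\<in>Z. z + s)"
      unfolding prod.distrib[symmetric] by (intro prod.cong) (simp_all add: power2_eq_square algebra_simps)
    moreover have "(\<Prod>z\<in>Z. z + s) \<ge> 0" using Z(1) s by (intro prod_nonneg) auto
    ultimately show ?thesis
      using mult_nonneg_nonneg[OF sgn[OF s], of "\<Prod>z\<in>Z. z + s"] by (simp add: Q_def mult_ac)
  qed
  have even: "Q (- s) = Q s" for s by (simp add: Q_def E_def)
  have pos': "e * Q s \<ge> 0" if s: "s \<in> {- c<..<c}" for s
  proof (cases "s = 0")
    case False
    then show ?thesis using pos[of s] pos[of "- s"] even s by (cases "s > 0") auto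
  next
    case True
    have "isCont Q 0" using continuous_on_interior[OF Q, of 0] r by simp
    then have "((\<lambda>s. e * Q s) \<longlongrightarrow> e * Q 0) (at_right 0)"
      by (intro tendsto_intros) (simp add: isCont_def filterlim_at_split)
    moreover have "eventually (\<lambda>s. e * Q s \<ge> 0) (at_right 0)"
      using r pos unfolding eventually_at_right_field by (intro exI[of _ c]) auto
    ultimately show ?thesis using True by (intro tendsto_lowerbound) auto
  qed
  define f where "f = (\<lambda>\<theta>. e * (Q (r * cos \<theta>) * sin \<theta> ^ (2 * m)))"
  have "(f has_integral 0) {0..2 * pi}"
    using has_integral_mult_right[OF trig_has_integral[OF Q r', of m], of e] Q0 by (simp add: f_def)
  moreover have "continuous_on {0..2 * pi} f"
    unfolding f_def by (intro continuous_intros continuous_comp_cos[OF Q r'])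
  moreover have "f \<theta> \<ge> 0" for \<theta>
    using pos'[OF mult_cos_in[OF r', of \<theta>]] unfolding f_def
    by (simp add: mult.assoc[symmetric] zero_le_even_power)
  ultimately have f0: "f \<theta> = 0" if "\<theta> \<in> {0..2 * pi}" for \<theta>
    using has_integral_0_cbox_imp_0[of 0 "2 * pi" f \<theta>] that by (simp add: not_le)
  have "Q s = 0" if s: "s \<in> {0<..<r}" for s
  proof -
    define \<theta> where "\<theta> = arccos (s / r)"
    have sr: "s / r \<in> {0<..<1}" using s by auto
    then have "0 < \<theta>" "\<theta> < pi" "cos \<theta> = s / r"
      using arccos_lt_bounded[of "s / r"] cos_arccos[of "s / r"] by (auto simp: \<theta>_def)
    then have "sin \<theta> > 0" "r * cos \<theta> = s" using r sin_gt_zero by auto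
    moreover have "f \<theta> = 0" using f0 \<open>0 < \<theta>\<close> \<open>\<theta> < pi\<close> by auto
    ultimately show ?thesis using Z(2) by (simp add: f_def)
  qed
  then have "{0<..<r} - Z \<subseteq> {s \<in> {0<..<c}. E s = 0}"
  proof (intro subsetI)
    fix s assume s: "s \<in> {0<..<r} - Z"
    then have "(\<Prod>z\<in>Z. z\<^sup>2 - s\<^sup>2) \<noteq> 0"
      using finZ Z(1) by (auto simp: power2_eq_iff)
    then show "s \<in> {s \<in> {0<..<c}. E s = 0}"
      using \<open>\<And>s. s \<in> {0<..<r} \<Longrightarrow> Q s = 0\<close>[of s] s r by (auto simp: Q_def)
  qed
  then have "finite ({0<..<r} - Z)" using zeros(1) unfolding E_def by (rule finite_subset)
  then have "finite {0<..<r}" using finZ by simp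
  then show False using r infinite_Ioo[of 0 r] by simp
qed

section \<open>A Chebyshev system of three polynomials\<close>

text \<open>
  The polynomial \<open>cheb i\<close> is the even part belonging to the integral with index \<open>i\<close>, cleared of positive factors and
  expressed in the parameter \<open>t\<close> between 0 and 2; see \<open>pairing_num_cheb\<close> and \<open>raised_pairing\<close>.
\<close>
definition cheb :: "nat \<Rightarrow> real poly" where
  "cheb i = [
   [:1327104, 2654208, 1981440, 728064, 213696, 93600, 18144, -11736, -7020, -1332, -90:],
   [:0, 331776, 654336, 493824, 224832, 116832, 66816, 25512, 5556, 636, 30:],
   [:0, 0, 73728, 141312, 104448, 60544, 48160, 38496, 21080, 7124, 1422, 154, 7:]] ! i"

definition wronski2 :: "real poly \<Rightarrow> real poly \<Rightarrow> real poly" where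
  "wronski2 p q = p * pderiv q - q * pderiv p"

text \<open>
  The three-by-three Wronskian, expanded along its row of second derivatives.
\<close>
definition wronski3 :: "real poly \<Rightarrow> real poly \<Rightarrow> real poly \<Rightarrow> real poly" where
  "wronski3 p q r = pderiv (pderiv r) * wronski2 p q - pderiv (pderiv q) * wronski2 p r
     + pderiv (pderiv p) * wronski2 q r"

lemma poly_Poly_pos:
  fixes x :: real
  assumes "x > 0" "list_all (\<lambda>a. a \<ge> 0) as" "list_ex (\<lambda>a. a > 0) as"
  shows "poly (Poly as) x > 0"
proof -
  have nn: "poly (Poly as) x \<ge> 0" if "list_all (\<lambda>a. a \<ge> 0) as" for as
    using that assms(1) by (induction as) auto
  show ?thesis
    using assms(2,3)
  proof (induction as)
    case (Cons a as)
    then show ?case using assms(1) nn[of as]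
      by (cases "a > 0") (auto intro: add_pos_nonneg)
  qed simp
qed

lemma cheb1_pos: "x > 0 \<Longrightarrow> poly (cheb 1) x > 0"
proof -
  assume x: "x > 0"
  have e: "cheb 1 = Poly [0, 331776, 654336, 493824, 224832, 116832, 66816, 25512, 5556, 636, 30]"
    by (simp add: cheb_def)
  show ?thesis unfolding e by (rule poly_Poly_pos[OF x]) simp_all
qed

lemma wronski_cheb12_pos: "x > 0 \<Longrightarrow> poly (wronski2 (cheb 1) (cheb 2)) x > 0"
proof -
  assume x: "x > 0"
  have e: "wronski2 (cheb 1) (cheb 2) = Poly [0, 0, 24461180928, 93767860224, 160016891904, 183883530240, 192706117632, 209755373568,
    209930059776, 168529809408, 104224349184, 51048247296, 21217475328, 8010690048, 2755085184,
    809341632, 188716704, 33058128, 4150464, 351456, 17976, 420]"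
    by (simp add: cheb_def wronski2_def pderiv_pCons numeral_2_eq_2)
  show ?thesis unfolding e by (rule poly_Poly_pos[OF x]) simp_all
qed

lemma wronski_cheb120_pos: "x > 0 \<Longrightarrow> poly (wronski3 (cheb 1) (cheb 2) (cheb 0)) x > 0"
proof -
  assume x: "x > 0"
  have d: "pderiv (pderiv (cheb 0)) = [:3962880, 4368384, 2564352, 1872000, 544320, -492912, -393120, -95904, -8100:]"
    "pderiv (pderiv (cheb 1)) = [:1308672, 2962944, 2697984, 2336640, 2004480, 1071504, 311136, 45792, 2700:]"
    "pderiv (pderiv (cheb 2)) = [:147456, 847872, 1253376, 1210880, 1444800, 1616832, 1180480, 512928, 127980, 16940, 924:]"
    by (simp_all add: cheb_def pderiv_pCons numeral_2_eq_2)
  have w: "wronski2 (cheb 1) (cheb 2) = [:0, 0, 24461180928, 93767860224, 160016891904, 183883530240, 192706117632, 209755373568,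
    209930059776, 168529809408, 104224349184, 51048247296, 21217475328, 8010690048, 2755085184,
    809341632, 188716704, 33058128, 4150464, 351456, 17976, 420:]"
    "wronski2 (cheb 1) (cheb 0) = [:-440301256704, -1736743845888, -3045417025536, -3331816685568, -2854880280576, -2259523731456,
    -1662531747840, -1048391368704, -541257596928, -228929531904, -81872114688, -26252190720,
    -7908585984, -2160186624, -482118912, -79266816, -8767872, -578880, -17280:]"
    "wronski2 (cheb 2) (cheb 0) = [:0, -195689447424, -758296608768, -1304596316160, -1459743621120, -1408669581312,
    -1381787762688, -1274921091072, -963117932544, -559394942976, -249178549248, -88621922304,
    -27052298496, -7346253312, -1572041088, -154332864, 43046496, 22637808, 4906944, 606816, 41832,
    1260:]"
    by (simp_all add: cheb_def wronski2_def pderiv_pCons numeral_2_eq_2)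
  have m: "pderiv (pderiv (cheb 0)) * wronski2 (cheb 1) (cheb 2) = [:0, 0, 96936724675952640, 478446609311465472, 1106468839140360192, 1713968725239005184,
    2166132871935295488, 2483125928016740352, 2617880851500761088, 2465560279929323520,
    2022386846115299328, 1413541697355251712, 806026634403250176, 336272463518367744,
    65339264773324800, -36167503426928640, -46104593318166528, -29338331087572992,
    -14369997542952960, -6057393794684928, -2245275184472064, -713554073031168, -187453310821632,
    -39469946160384, -6493308361344, -812613290688, -74598542784, -4735874304, -185885280,
    -3402000:]"
    "pderiv (pderiv (cheb 2)) * wronski2 (cheb 1) (cheb 0) = [:-64925062108545024, -629412407663394816, -2473464518940819456, -5783365225763831808,
    -9802111557071536128, -13838547692587843584, -17501414173257498624, -19866926632082079744,
    -19842449911962402816, -17425200703994855424, -13708037932566183936, -9829641899244257280,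
    -6426510075113766912, -3775923408780656640, -1962410872340348928, -895304083849740288,
    -359799048360787968, -129019256147017728, -41954282462195712, -12470179202998272,
    -3351206275577856, -790587801031680, -157572058005504, -25516256090112, -3227692451328,
    -304718747904, -20119235328, -827608320, -15966720:]"
    "pderiv (pderiv (cheb 1)) * wronski2 (cheb 2) (cheb 0) = [:0, -256093300539260928, -1572178413697892352, -4482046055550025728, -8278899339665866752,
    -11852526800993255424, -14698525320995143680, -16462517726556979200, -16626321683543752704,
    -15083116551714373632, -12356184562942869504, -9158777359764553728, -6072373421876183040,
    -3528142149449023488, -1764528032362659840, -754121368804737024, -276737021202235392,
    -88138796640768000, -24341551271129088, -5580553635035136, -909653884084224, -35110237100544,
    37708471980288, 15173229885696, 3416584316544, 521971964352, 55401603264, 3946005504, 170644320,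
    3402000:]"
    unfolding d w by simp_all
  have e: "wronski3 (cheb 1) (cheb 2) (cheb 0) = Poly [64925062108545024, 373319107124133888, 998222829918879744, 1779765779525271552,
    2629681056546029568, 3699989616833593344, 4969021724197650432, 5887534833541840896,
    5834009079919411200, 4807644432209805312, 3374240215738613760, 2084406236834955264,
    1160163287640834048, 584053722850000896, 263222104751013888, 105015211618074624,
    36957433840386048, 11542128418676736, 3242733648113664, 832231773278208, 196277207021568,
    41923490899968, 7827219164160, 1219539815424, 150968406528, 14077421568, 922295808, 37739520,
    725760]"
    unfolding wronski3_def m by simp
  show ?thesis unfolding e by (rule poly_Poly_pos[OF x]) simp_all
qed

lemma vanishes_poly_Suc:
  "vanishes (Suc k) (poly p) x \<longleftrightarrow> poly p x = 0 \<and> vanishes k (poly (pderiv p)) x"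
proof -
  have "deriv (poly p) = poly (pderiv p)"
    by (intro ext DERIV_imp_deriv poly_DERIV)
  then show ?thesis by (simp add: vanishes_Suc)
qed

lemma smooth_poly: "smooth L (poly p)"
  by (rule smooth_coinduct[where P = "\<lambda>f. \<exists>p. f = poly p"]) (use poly_DERIV in blast)+

text \<open>
  Cramer's rule for the values and derivatives of the polynomials at \<open>x\<close>, the determinants being the three
  Wronskians.
\<close>
lemma cheb_nondegenerate:
  assumes "k \<le> 3" "x > 0" "\<exists>j<k. \<alpha> j \<noteq> 0"
  shows "\<not> vanishes k (\<lambda>y. \<Sum>j<k. \<alpha> j * poly (cheb ([1, 2, 0] ! j)) y) x"
proof
  assume v: "vanishes k (\<lambda>y. \<Sum>j<k. \<alpha> j * poly (cheb ([1, 2, 0] ! j)) y) x"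
  define R where "R = (\<Sum>j<k. smult (\<alpha> j) (cheb ([1, 2, 0] ! j)))"
  have "(\<lambda>y. \<Sum>j<k. \<alpha> j * poly (cheb ([1, 2, 0] ! j)) y) = poly R"
    by (rule ext) (simp add: R_def poly_sum)
  then have vR: "vanishes k (poly R) x" using v by simp
  define p q r where pqr: "p = cheb 1" "q = cheb 2" "r = cheb 0"
  define p0 q0 r0 where 0: "p0 = poly p x" "q0 = poly q x" "r0 = poly r x"
  define p1 q1 r1 where 1: "p1 = poly (pderiv p) x" "q1 = poly (pderiv q) x" "r1 = poly (pderiv r) x"
  define p2 q2 r2 where 2: "p2 = poly (pderiv (pderiv p)) x" "q2 = poly (pderiv (pderiv q)) x"
    "r2 = poly (pderiv (pderiv r)) x"
  have W1: "p0 \<noteq> 0" using cheb1_pos[OF assms(2)] by (simp add: 0 pqr)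
  have W2: "p0 * q1 - q0 * p1 \<noteq> 0"
    using wronski_cheb12_pos[OF assms(2)] by (simp add: 0 1 pqr wronski2_def)
  have W3: "r2 * (p0 * q1 - q0 * p1) - q2 * (p0 * r1 - r0 * p1) + p2 * (q0 * r1 - r0 * q1) \<noteq> 0"
    using wronski_cheb120_pos[OF assms(2)] by (simp add: 0 1 2 pqr wronski2_def wronski3_def)
  consider "k = 0" | "k = 1" | "k = 2" | "k = 3" using assms(1) by linarith
  then show False
  proof cases
    case 1
    then show ?thesis using assms(3) by simp
  next
    case 2
    then have "\<alpha> 0 * p0 = 0" using vR by (simp add: R_def vanishes_poly_Suc 0 pqr)
    then show ?thesis using assms(3) W1 2 by auto
  next
    case 3
    define a b where ab: "a = \<alpha> 0" "b = \<alpha> 1"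
    have e: "a * p0 + b * q0 = 0" "a * p1 + b * q1 = 0"
      using vR unfolding 3 R_def
      by (simp_all add: eval_nat_numeral vanishes_poly_Suc 0 1 pqr ab pderiv_add pderiv_smult)
    have "a * (p0 * q1 - q0 * p1) = 0" "b * (p0 * q1 - q0 * p1) = 0" using e by algebra+
    then show ?thesis using assms(3) W2 3 by (auto simp: ab less_2_cases_iff)
  next
    case 4
    define a b c where abc: "a = \<alpha> 0" "b = \<alpha> 1" "c = \<alpha> 2"
    have e: "a * p0 + b * q0 + c * r0 = 0" "a * p1 + b * q1 + c * r1 = 0" "a * p2 + b * q2 + c * r2 = 0"
      using vR unfolding 4 R_def
      by (simp_all add: eval_nat_numeral vanishes_poly_Suc 0 1 2 pqr abc pderiv_add pderiv_smult)
    let ?W = "r2 * (p0 * q1 - q0 * p1) - q2 * (p0 * r1 - r0 * p1) + p2 * (q0 * r1 - r0 * q1)"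
    have "a * ?W = 0" "b * ?W = 0" "c * ?W = 0" using e by algebra+
    then have "a = 0" "b = 0" "c = 0" using W3 by auto
    moreover obtain j where "j < 3" "\<alpha> j \<noteq> 0" using assms(3) 4 by auto
    ultimately show ?thesis unfolding abc by (auto simp: less_Suc_eq numeral_3_eq_3 numeral_2_eq_2)
  qed
qed

lemma cheb_zeros:
  assumes "k \<le> 3" "\<exists>j<k. \<alpha> j \<noteq> 0"
  shows "finite {t \<in> {0<..<2}. (\<Sum>j<k. \<alpha> j * poly (cheb ([1, 2, 0] ! j)) t) = 0}"
    "card {t \<in> {0<..<2}. (\<Sum>j<k. \<alpha> j * poly (cheb ([1, 2, 0] ! j)) t) = 0} < k"
proof -
  let ?Z = "{t \<in> {0<..<2}. (\<Sum>j<k. \<alpha> j * poly (cheb ([1, 2, 0] ! j)) t) = 0}"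
  have *: "card Z < k" if "finite Z" "Z \<subseteq> ?Z" for Z
  proof -
    have "(\<Sum>z\<in>Z. 1 :: nat) < k"
    proof (rule zeros_of_span[of "{0<..<2}", OF _ _ _ _ assms(2) that(1)])
      show "\<not> vanishes i (\<lambda>y. \<Sum>j<i. \<beta> j * poly (cheb ([1, 2, 0] ! j)) y) x"
        if "i \<le> k" "x \<in> {0<..<2}" "\<exists>j<i. \<beta> j \<noteq> 0" for i x \<beta>
        using that assms(1) by (intro cheb_nondegenerate) auto
    qed (use that in \<open>auto simp: smooth_poly vanishes_Suc is_interval_1\<close>)
    then show ?thesis by simp
  qed
  show "finite ?Z"
  proof (rule ccontr)
    assume "infinite ?Z"
    then obtain Z where "finite Z" "card Z = k" "Z \<subseteq> ?Z"
      using infinite_arbitrarily_large by blast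
    then show False using *[of Z] by simp
  qed
  then show "card ?Z < k" by (rule *) simp
qed

section \<open>Symmetric functions of two conjugate points\<close>

text \<open>
  The numerator over \<open>18 u\<^sup>5\<close> of the weight that accompanies \<open>sin\<^sup>4\<close> once the weight \<open>u\<^bsup>i - 2\<^esup>\<close> has been raised by
  \<open>trig_raise\<close>.
\<close>
definition raised_num :: "nat \<Rightarrow> real \<Rightarrow> real" where
  "raised_num i u = (15 + 3 * real i) * u ^ (i + 3) - (real i - 2) * u ^ (i + 2)
     - (real i - 3) * u ^ (i + 1) - (real i - 4) * u ^ i"

text \<open>
  With \<open>\<sigma> = u + z\<close> and \<open>u z = \<sigma>\<^sup>2 \<pi>\<close>, the complete homogeneous symmetric polynomial of degree \<open>m\<close> in \<open>u\<close> and \<open>z\<close> is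
  \<open>\<sigma>\<^sup>m eta m \<pi>\<close>.
\<close>
fun eta :: "nat \<Rightarrow> real \<Rightarrow> real" where
  "eta 0 \<pi> = 1"
| "eta (Suc 0) \<pi> = 1"
| "eta (Suc (Suc m)) \<pi> = eta (Suc m) \<pi> - \<pi> * eta m \<pi>"

lemma eta_power:
  fixes u z :: real
  assumes p: "u * z = (u + z)\<^sup>2 * \<pi>"
  shows "u ^ Suc m - z ^ Suc m = (u - z) * (u + z) ^ m * eta m \<pi>"
  using p
proof (induction m \<pi> rule: eta.induct)
  case (3 m \<pi>)
  have "u ^ Suc (Suc (Suc m)) - z ^ Suc (Suc (Suc m)) =
      (u + z) * (u ^ Suc (Suc m) - z ^ Suc (Suc m)) - (u * z) * (u ^ Suc m - z ^ Suc m)"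
    by (simp add: algebra_simps)
  also have "\<dots> = (u + z) * ((u - z) * (u + z) ^ Suc m * eta (Suc m) \<pi>)
      - ((u + z)\<^sup>2 * \<pi>) * ((u - z) * (u + z) ^ m * eta m \<pi>)"
    by (simp only: "3.IH"(1)[OF "3.prems"] "3.IH"(2)[OF "3.prems"] "3.prems")
  also have "\<dots> = (u - z) * (u + z) ^ Suc (Suc m) * (eta (Suc m) \<pi> - \<pi> * eta m \<pi>)"
    by (simp only: power_Suc power2_eq_square) (simp only: algebra_simps)
  finally show ?case by simp
qed (simp_all add: algebra_simps power2_eq_square)

text \<open>
  The contribution of the power \<open>u\<^bsup>7 - m\<^esup>\<close> in a numerator, after removal of the antisymmetric factor \<open>u - z\<close>
  and of \<open>\<sigma>\<^sup>6\<close>.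
\<close>
definition pairing :: "nat \<Rightarrow> real \<Rightarrow> real \<Rightarrow> real" where
  "pairing m \<sigma> \<pi> = \<sigma> ^ (7 - m) * \<pi> ^ (7 - m) * (\<sigma> * eta m \<pi> - eta (m - 1) \<pi>)"

lemma pairing_eq:
  fixes u z :: real
  assumes p: "u * z = (u + z)\<^sup>2 * \<pi>" and m: "m \<in> {1..7}"
  shows "u ^ (7 - m) * z ^ 7 * (z - 1) - z ^ (7 - m) * u ^ 7 * (u - 1)
    = - ((u - z) * (u + z) ^ 6 * pairing m (u + z) \<pi>)"
proof -
  obtain n where n: "m = Suc n" using m by (cases m) auto
  define l where "l = 7 - m"
  have 7: "u ^ 7 = u ^ l * u ^ m" "z ^ 7 = z ^ l * z ^ m"
    using m by (simp_all add: l_def flip: power_add)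
  define \<sigma> where "\<sigma> = u + z"
  have p: "u * z = \<sigma>\<^sup>2 * \<pi>" using p by (simp add: \<sigma>_def)
  have 6: "\<sigma> ^ 6 = \<sigma> ^ l * \<sigma> ^ n"
    using m by (simp add: l_def n flip: power_add)
  have pr: "pairing m \<sigma> \<pi> = \<sigma> ^ l * \<pi> ^ l * (\<sigma> * eta m \<pi> - eta n \<pi>)"
    by (simp add: pairing_def l_def n)
  have "u ^ l * z ^ 7 * (z - 1) - z ^ l * u ^ 7 * (u - 1)
      = (u * z) ^ l * ((u ^ m - z ^ m) - (u ^ Suc m - z ^ Suc m))"
    unfolding 7 by (simp add: algebra_simps power_mult_distrib)
  also have "\<dots> = (\<sigma>\<^sup>2 * \<pi>) ^ l * ((u - z) * \<sigma> ^ n * (eta n \<pi> - \<sigma> * eta m \<pi>))"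
  proof -
    have "u ^ m - z ^ m = (u - z) * \<sigma> ^ n * eta n \<pi>"
      "u ^ Suc m - z ^ Suc m = (u - z) * (\<sigma> * \<sigma> ^ n) * eta m \<pi>"
      using eta_power[of u z \<pi> n] eta_power[of u z \<pi> m] p by (simp_all add: \<sigma>_def n)
    then show ?thesis unfolding p by (simp only:) (simp add: algebra_simps)
  qed
  also have "\<dots> = - ((u - z) * \<sigma> ^ 6 * pairing m \<sigma> \<pi>)"
    unfolding 6 pr by (simp add: algebra_simps power_mult_distrib power2_eq_square)
  finally show ?thesis by (simp add: l_def \<sigma>_def)
qed

definition pairing_num :: "nat \<Rightarrow> real \<Rightarrow> real \<Rightarrow> real" where
  "pairing_num i \<sigma> \<pi> = (15 + 3 * real i) * pairing (4 - i) \<sigma> \<pi> - (real i - 2) * pairing (5 - i) \<sigma> \<pi>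
     - (real i - 3) * pairing (6 - i) \<sigma> \<pi> - (real i - 4) * pairing (7 - i) \<sigma> \<pi>"

lemma pairing_num_eq:
  fixes u z :: real
  assumes p: "u * z = (u + z)\<^sup>2 * \<pi>" and i: "i < 3"
  shows "raised_num i u * z ^ 7 * (z - 1) - raised_num i z * u ^ 7 * (u - 1)
    = - ((u - z) * (u + z) ^ 6 * pairing_num i (u + z) \<pi>)"
proof -
  define d where "d = (\<lambda>m. u ^ (7 - m) * z ^ 7 * (z - 1) - z ^ (7 - m) * u ^ 7 * (u - 1))"
  have e: "7 - (4 - i) = i + 3" "7 - (5 - i) = i + 2" "7 - (6 - i) = i + 1" "7 - (7 - i) = i"
    using i by auto
  define C where "C = (u - z) * (u + z) ^ 6"
  have D: "d m = - (C * pairing m (u + z) \<pi>)" if "m \<in> {1..7}" for m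
    unfolding d_def C_def by (rule pairing_eq[OF p that])
  have d: "d (4 - i) = - (C * pairing (4 - i) (u + z) \<pi>)" "d (5 - i) = - (C * pairing (5 - i) (u + z) \<pi>)"
    "d (6 - i) = - (C * pairing (6 - i) (u + z) \<pi>)" "d (7 - i) = - (C * pairing (7 - i) (u + z) \<pi>)"
    by (use i in \<open>intro D; auto\<close>)+
  have lin: "a * - (C * P) - b * - (C * Q) - c * - (C * R) - e * - (C * S) = - (C * (a * P - b * Q - c * R - e * S))"
    for a b c e P Q R S :: real by (simp add: algebra_simps)
  have "raised_num i u * z ^ 7 * (z - 1) - raised_num i z * u ^ 7 * (u - 1) =
      (15 + 3 * real i) * d (4 - i) - (real i - 2) * d (5 - i)
     - (real i - 3) * d (6 - i) - (real i - 4) * d (7 - i)"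
    unfolding d_def e raised_num_def by (simp add: algebra_simps)
  then show ?thesis
    unfolding d lin by (simp only: pairing_num_def C_def)
qed

lemma eta_simps:
  "eta 2 \<pi> = 1 - \<pi>" "eta 3 \<pi> = 1 - 2 * \<pi>" "eta 4 \<pi> = 1 - 3 * \<pi> + \<pi>\<^sup>2"
  "eta 5 \<pi> = 1 - 4 * \<pi> + 3 * \<pi>\<^sup>2" "eta 6 \<pi> = 1 - 5 * \<pi> + 6 * \<pi>\<^sup>2 - \<pi> ^ 3"
  "eta 7 \<pi> = 1 - 6 * \<pi> + 10 * \<pi>\<^sup>2 - 4 * \<pi> ^ 3"
  by (simp_all add: eval_nat_numeral algebra_simps)

text \<open>
  The denominators are powers of \<open>y\<close>; it is substituted by \<open>2 (t + 2)\<close>, the denominator of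
  \<open>u z / (u + z)\<^sup>2\<close> as a function of \<open>t\<close>.
\<close>
lemma pairing_scaled:
  assumes t: "t = \<pi> * y"
  shows "y ^ 6 * pairing 2 \<sigma> \<pi> = \<sigma> ^ 5 * t ^ 5 * (\<sigma> * (y - t) - y)"
    "y ^ 6 * pairing 3 \<sigma> \<pi> = \<sigma> ^ 4 * t ^ 4 * y * (\<sigma> * (y - 2 * t) - (y - t))"
    "y ^ 6 * pairing 4 \<sigma> \<pi> = \<sigma> ^ 3 * t ^ 3 * y * (\<sigma> * (y\<^sup>2 - 3 * t * y + t\<^sup>2) - y * (y - 2 * t))"
    "y ^ 6 * pairing 5 \<sigma> \<pi> = \<sigma>\<^sup>2 * t\<^sup>2 * y\<^sup>2 * (\<sigma> * (y\<^sup>2 - 4 * t * y + 3 * t\<^sup>2) - (y\<^sup>2 - 3 * t * y + t\<^sup>2))"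
    "y ^ 6 * pairing 6 \<sigma> \<pi> = \<sigma> * t * y\<^sup>2 *
      (\<sigma> * (y ^ 3 - 5 * t * y\<^sup>2 + 6 * t\<^sup>2 * y - t ^ 3) - y * (y\<^sup>2 - 4 * t * y + 3 * t\<^sup>2))"
    "y ^ 6 * pairing 7 \<sigma> \<pi> = y ^ 3 *
      (\<sigma> * (y ^ 3 - 6 * t * y\<^sup>2 + 10 * t\<^sup>2 * y - 4 * t ^ 3) - (y ^ 3 - 5 * t * y\<^sup>2 + 6 * t\<^sup>2 * y - t ^ 3))"
  unfolding t by (simp_all add: pairing_def eta_simps) algebra+

text \<open>
  Written in \<open>\<sigma> = (t + 4) / 3\<close>, both \<open>t\<close> and the denominator \<open>y\<close> have integer coefficients, and the claim is
  a polynomial identity in one variable.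
\<close>
lemma pairing_num_cheb:
  assumes "t > 0" "i < 3"
  shows "15552 * (t + 2) ^ 6 * pairing_num i ((t + 4) / 3) (t / (2 * (t + 2))) = poly (cheb i) t"
proof -
  define \<sigma> where "\<sigma> = (t + 4) / 3"
  define y where "y = 2 * (t + 2)"
  have t: "t = 3 * \<sigma> - 4" and y: "y = 6 * \<sigma> - 4" by (simp_all add: \<sigma>_def y_def field_simps)
  have "t = t / y * y" using assms(1) by (simp add: y_def)
  note sc = pairing_scaled[OF this, of \<sigma>]
  have "15552 * (t + 2) ^ 6 = 243 * y ^ 6" unfolding y_def power_mult_distrib by simp
  then have *: "15552 * (t + 2) ^ 6 * pairing_num i \<sigma> (t / y) =
     243 * ((15 + 3 * real i) * (y ^ 6 * pairing (4 - i) \<sigma> (t / y)) - (real i - 2) * (y ^ 6 * pairing (5 - i) \<sigma> (t / y))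
     - (real i - 3) * (y ^ 6 * pairing (6 - i) \<sigma> (t / y)) - (real i - 4) * (y ^ 6 * pairing (7 - i) \<sigma> (t / y)))"
    unfolding pairing_num_def by (simp only:) (simp only: algebra_simps)
  consider "i = 0" | "i = 1" | "i = 2" using assms(2) by linarith
  then have "15552 * (t + 2) ^ 6 * pairing_num i \<sigma> (t / y) = poly (cheb i) t"
  proof cases
    case 1
    show ?thesis unfolding * unfolding 1 by (simp add: sc cheb_def) (unfold t y, algebra)
  next
    case 2
    show ?thesis unfolding * unfolding 2 by (simp add: sc cheb_def) (unfold t y, algebra)
  next
    case 3
    show ?thesis unfolding * unfolding 3 by (simp add: sc cheb_def) (unfold t y, algebra)
  qed
  then show ?thesis by (simp add: \<sigma>_def y_def)
qed

section \<open>Analytic dependence on the level\<close>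

text \<open>
  For complex \<open>z\<close> near \<open>h\<close> the points \<open>csqrt (2 z) cos \<theta>\<close> stay close to the segment from \<open>- r\<close> to \<open>r\<close>, where the
  extension of \<open>g\<close> is holomorphic; then one differentiates under the integral sign.
\<close>
lemma real_analytic_trig:
  assumes g: "continuous_on {- c<..<c} g"
    and ext: "\<And>b. 0 < b \<Longrightarrow> b < c \<Longrightarrow> \<exists>W G. open W \<and> complex_of_real ` {- b..b} \<subseteq> W \<and>
      G holomorphic_on W \<and> (\<forall>s\<in>{- b..b}. G (of_real s) = of_real (g s))"
    and L: "\<And>h. h \<in> L \<Longrightarrow> 0 < h \<and> sqrt (2 * h) < c"
  shows "real_analytic_on (\<lambda>h. 2 * h * trig n g (sqrt (2 * h))) L"
proof (rule real_analytic_onI)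
  fix h assume "h \<in> L"
  define r where "r = sqrt (2 * h)"
  have r: "0 < r" "r < c" "0 < h" using L[OF \<open>h \<in> L\<close>] by (auto simp: r_def)
  define b where "b = (r + c) / 2"
  have b: "0 < b" "r < b" "b < c" using r by (auto simp: b_def)
  obtain W G where W: "open W" "complex_of_real ` {- b..b} \<subseteq> W" and G: "G holomorphic_on W"
    and Gg: "\<And>s. s \<in> {- b..b} \<Longrightarrow> G (of_real s) = of_real (g s)" using ext[OF b(1,3)] by blast
  have "compact (complex_of_real ` {- b..b})"
    by (intro compact_continuous_image continuous_intros) auto
  then obtain e where e: "e > 0" "(\<Union>x\<in>complex_of_real ` {- b..b}. ball x e) \<subseteq> W"
    using compact_subset_open_imp_ball_epsilon_subset[OF _ W] by metis
  \<comment> \<open>The bound \<open>b - r\<close> keeps real points inside the interval on which the extension agrees with \<open>g\<close>.\<close>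
  define d where "d = min e (b - r)"
  have d: "d > 0" using e b by (simp add: d_def)
  have slit: "2 * z \<notin> \<real>\<^sub>\<le>\<^sub>0" if "z \<in> ball (complex_of_real h) h" for z
  proof -
    have "\<bar>Re (of_real h - z)\<bar> < h"
      using that abs_Re_le_cmod[of "of_real h - z"] by (simp add: dist_norm)
    then show ?thesis by (simp add: complex_nonpos_Reals_iff)
  qed
  have "isCont (\<lambda>z. csqrt (2 * z)) (of_real h)"
    by (rule isCont_o2[of _ "\<lambda>z. 2 * z"])
      (use slit[of "of_real h"] r in \<open>auto intro!: continuous_intros continuous_at_csqrt\<close>)
  then obtain \<rho>0 where \<rho>0: "\<rho>0 > 0"
    "\<And>z. dist z (of_real h) < \<rho>0 \<Longrightarrow> dist (csqrt (2 * z)) (csqrt (2 * of_real h)) < d"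
    using d unfolding continuous_at_eps_delta by meson
  define \<rho> where "\<rho> = min \<rho>0 h"
  have \<rho>: "\<rho> > 0" using \<rho>0 r by (simp add: \<rho>_def)
  have csr: "csqrt (2 * of_real y) = of_real (sqrt (2 * y))" if "y \<ge> 0" for y
    using of_real_sqrt[of "2 * y"] that by simp
  have close: "cmod (csqrt (2 * z) - of_real r) < d" if "z \<in> ball (of_real h) \<rho>" for z
    using \<rho>0(2)[of z] that csr[of h] r by (simp add: \<rho>_def dist_commute dist_norm r_def)
  have inW: "csqrt (2 * z) * of_real (cos \<theta>) \<in> W" if z: "z \<in> ball (of_real h) \<rho>" for z \<theta>
  proof -
    have "cmod (csqrt (2 * z) * of_real (cos \<theta>) - of_real (r * cos \<theta>))
        = cmod (csqrt (2 * z) - of_real r) * \<bar>cos \<theta>\<bar>"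
      unfolding of_real_mult left_diff_distrib[symmetric] norm_mult norm_of_real ..
    also have "\<dots> \<le> cmod (csqrt (2 * z) - of_real r) * 1"
      by (intro mult_left_mono) auto
    also have "\<dots> < e" using close[OF z] by (simp add: d_def)
    finally have "csqrt (2 * z) * of_real (cos \<theta>) \<in> ball (of_real (r * cos \<theta>)) e"
      by (simp add: dist_norm norm_minus_commute)
    moreover have "r * cos \<theta> \<in> {- b<..<b}" using r b by (intro mult_cos_in) auto
    then have "complex_of_real (r * cos \<theta>) \<in> complex_of_real ` {- b..b}" by (intro imageI) auto
    ultimately show ?thesis using e(2) by blast
  qed
  define F where "F = (\<lambda>z. 2 * z * integral (cbox 0 (2 * pi))
    (\<lambda>\<theta>. G (csqrt (2 * z) * of_real (cos \<theta>)) * of_real (sin \<theta> ^ (2 * n))))"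
  have G': "(G has_field_derivative deriv G w) (at w)" if "w \<in> W" for w
    using G W(1) that by (rule holomorphic_derivI)
  have contG: "continuous_on W G" "continuous_on W (deriv G)"
    using G W(1) by (auto intro: holomorphic_on_imp_continuous_on holomorphic_deriv)
  have ballslit: "2 * z \<notin> \<real>\<^sub>\<le>\<^sub>0" if "z \<in> ball (complex_of_real h) \<rho>" for z
    using slit[of z] that by (simp add: \<rho>_def)
  have "(\<lambda>z. integral (cbox 0 (2 * pi))
      (\<lambda>\<theta>. G (csqrt (2 * z) * of_real (cos \<theta>)) * of_real (sin \<theta> ^ (2 * n)))) holomorphic_on ball (of_real h) \<rho>"
  proof (rule leibniz_rule_holomorphic)
    fix z :: complex and \<theta> :: real
    assume z: "z \<in> ball (of_real h) \<rho>"
    have "((\<lambda>z. csqrt (2 * z) * of_real (cos \<theta>)) has_field_derivative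
        (inverse (2 * csqrt (2 * z)) * 2) * of_real (cos \<theta>)) (at z)"
      by (intro DERIV_cmult_right DERIV_chain2[of csqrt] has_field_derivative_csqrt ballslit z)
        (auto intro!: derivative_eq_intros)
    from DERIV_cmult_right[OF DERIV_chain2[OF G'[OF inW[OF z]] this]]
    show "((\<lambda>z. G (csqrt (2 * z) * of_real (cos \<theta>)) * of_real (sin \<theta> ^ (2 * n))) has_field_derivative
        deriv G (csqrt (2 * z) * of_real (cos \<theta>)) * ((inverse (2 * csqrt (2 * z)) * 2) * of_real (cos \<theta>))
          * of_real (sin \<theta> ^ (2 * n))) (at z within ball (of_real h) \<rho>)"
      by (rule has_field_derivative_at_within)
  next
    fix z :: complex assume z: "z \<in> ball (of_real h) \<rho>"
    have "continuous_on (cbox 0 (2 * pi)) (\<lambda>\<theta>. G (csqrt (2 * z) * of_real (cos \<theta>)))"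
      by (rule continuous_on_compose2[OF contG(1)]) (use inW[OF z] in \<open>auto intro!: continuous_intros\<close>)
    then show "(\<lambda>\<theta>. G (csqrt (2 * z) * of_real (cos \<theta>)) * of_real (sin \<theta> ^ (2 * n))) integrable_on cbox 0 (2 * pi)"
      by (intro integrable_continuous continuous_intros)
  next
    have c: "continuous_on (ball (of_real h) \<rho> \<times> cbox 0 (2 * pi)) (\<lambda>p. csqrt (2 * fst p))"
    proof (rule continuous_on_compose2[of "- \<real>\<^sub>\<le>\<^sub>0" csqrt])
      show "continuous_on (- \<real>\<^sub>\<le>\<^sub>0) csqrt"
        by (auto intro!: continuous_at_imp_continuous_on continuous_at_csqrt)
    qed (use ballslit in \<open>auto intro!: continuous_intros\<close>)
    have nz: "csqrt (2 * z) \<noteq> 0" if "z \<in> ball (of_real h) \<rho>" for z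
      using ballslit[OF that] by auto
    show "continuous_on (ball (of_real h) \<rho> \<times> cbox 0 (2 * pi)) (\<lambda>(z, \<theta>).
        deriv G (csqrt (2 * z) * of_real (cos \<theta>)) * ((inverse (2 * csqrt (2 * z)) * 2) * of_real (cos \<theta>))
          * of_real (sin \<theta> ^ (2 * n)))"
      unfolding split_beta
      by (intro continuous_intros c continuous_on_compose2[OF contG(2)])
        (use inW nz in auto)
  qed (rule convex_ball)
  then have "F holomorphic_on ball (of_real h) \<rho>"
    unfolding F_def by (intro holomorphic_intros)
  moreover have "F (of_real y) = of_real (2 * y * trig n g (sqrt (2 * y)))" if y: "\<bar>y - h\<bar> < \<rho>" for y
  proof -
    have y0: "y > 0" using y by (auto simp: \<rho>_def)
    have yb: "complex_of_real y \<in> ball (of_real h) \<rho>"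
      using y by (simp add: dist_of_real dist_real_def)
    have "\<bar>sqrt (2 * y) - r\<bar> < d"
      using close[OF yb] csr[of y] y0 by (simp flip: of_real_diff)
    moreover have "sqrt (2 * y) > 0" using y0 by simp
    ultimately have "- b < sqrt (2 * y)" "sqrt (2 * y) < b" using b(1) unfolding d_def by linarith+
    then have sy: "sqrt (2 * y) \<in> {- b<..<b}" by simp
    then have "sqrt (2 * y) * cos \<theta> \<in> {- b..b}" for \<theta> using mult_cos_in[OF sy, of \<theta>] by auto
    then have eq: "G (csqrt (2 * of_real y) * of_real (cos \<theta>)) * of_real (sin \<theta> ^ (2 * n))
        = of_real (g (sqrt (2 * y) * cos \<theta>) * sin \<theta> ^ (2 * n))" for \<theta>
      using Gg[of "sqrt (2 * y) * cos \<theta>"] csr[of y] y0 by simp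
    have "sqrt (2 * y) \<in> {- c<..<c}" using sy b by auto
    from has_integral_of_real[OF trig_has_integral[OF g this, of n]]
    have "((\<lambda>\<theta>. G (csqrt (2 * of_real y) * of_real (cos \<theta>)) * of_real (sin \<theta> ^ (2 * n))) has_integral
        complex_of_real (trig n g (sqrt (2 * y)))) (cbox 0 (2 * pi))"
      unfolding eq cbox_interval .
    then show ?thesis unfolding F_def by (simp add: integral_unique)
  qed
  ultimately show "\<exists>r>0. \<exists>F. F holomorphic_on ball (of_real h) r \<and>
      (\<forall>y. \<bar>y - h\<bar> < r \<longrightarrow> F (of_real y) = of_real (2 * y * trig n g (sqrt (2 * y))))"
    using \<rho> by blast
qed

text \<open>
  The Noshiro-Warschawski criterion: along the segment from \<open>y\<close> to \<open>x\<close>, the component of \<open>f\<close> in the direction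
  \<open>x - y\<close> increases.
\<close>
lemma inj_on_Re_deriv_pos:
  assumes "convex V" and D: "\<And>z. z \<in> V \<Longrightarrow> (f has_field_derivative f' z) (at z)"
    and pos: "\<And>z. z \<in> V \<Longrightarrow> Re (f' z) > 0"
  shows "inj_on f V"
proof (rule inj_onI, rule ccontr)
  fix x y assume xy: "x \<in> V" "y \<in> V" "f x = f y" "x \<noteq> y"
  define d where "d = x - y"
  define \<phi> where "\<phi> = (\<lambda>t. Re (f (y + of_real t * d) * cnj d))"
  have "\<phi> 0 < \<phi> 1"
  proof (rule DERIV_pos_imp_increasing[where f = \<phi>])
    fix t :: real assume t: "0 \<le> t" "t \<le> 1"
    have "y + of_real t * d = (1 - t) *\<^sub>R y + t *\<^sub>R x"
      by (simp add: d_def scaleR_conv_of_real algebra_simps)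
    then have V: "y + of_real t * d \<in> V"
      using convexD[OF assms(1) xy(2,1), of "1 - t" t] t by simp
    have "((\<lambda>t. y + of_real t * d) has_vector_derivative d) (at t)"
      by (auto intro!: derivative_eq_intros)
    from field_vector_diff_chain_at[OF this D[OF V]]
    have "((\<lambda>t. f (y + of_real t * d)) has_vector_derivative d * f' (y + of_real t * d)) (at t)"
      by (simp add: o_def)
    then have "((\<lambda>t. f (y + of_real t * d) * cnj d) has_vector_derivative d * f' (y + of_real t * d) * cnj d) (at t)"
      by (rule has_vector_derivative_mult_left)
    then have "(\<phi> has_real_derivative Re (d * f' (y + of_real t * d) * cnj d)) (at t)"
      unfolding \<phi>_def has_vector_derivative_complex_iff by simp
    moreover have "d * f' (y + of_real t * d) * cnj d = of_real ((cmod d)\<^sup>2) * f' (y + of_real t * d)"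
      by (simp add: complex_norm_square mult_ac del: of_real_power)
    moreover have "(cmod d)\<^sup>2 * Re (f' (y + of_real t * d)) > 0"
      using pos[OF V] xy(4) by (simp add: d_def)
    ultimately show "\<exists>D. (\<phi> has_real_derivative D) (at t) \<and> 0 < D" by auto
  qed simp
  then show False using xy(3) by (simp add: \<phi>_def d_def)
qed

lemma open_rectangle_nhd:
  assumes "open W" "complex_of_real ` {a..b} \<subseteq> W"
  obtains V where "open V" "convex V" "complex_of_real ` {a..b} \<subseteq> V" "V \<subseteq> W"
proof (cases "a \<le> b")
  case False
  then show ?thesis by (intro that[of "{}"]) auto
next
  case True
  have "compact (complex_of_real ` {a..b})"
    by (intro compact_continuous_image continuous_intros) auto
  then obtain e where e: "e > 0" "(\<Union>x\<in>complex_of_real ` {a..b}. ball x e) \<subseteq> W"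
    using compact_subset_open_imp_ball_epsilon_subset[OF _ assms] by metis
  define V where "V = box (Complex (a - e / 2) (- (e / 2))) (Complex (b + e / 2) (e / 2))"
  have "V \<subseteq> W"
  proof
    fix z assume "z \<in> V"
    then have z: "a - e / 2 < Re z" "Re z < b + e / 2" "\<bar>Im z\<bar> < e / 2"
      by (auto simp: V_def in_box_complex_iff)
    define x where "x = max a (min b (Re z))"
    have "\<bar>Re z - x\<bar> < e / 2" using z True e(1) by (auto simp: x_def max_def min_def)
    then have "cmod (z - of_real x) < e"
      using cmod_le[of "z - of_real x"] z(3) by simp
    then have "z \<in> ball (of_real x) e" by (simp add: dist_norm norm_minus_commute)
    moreover have "x \<in> {a..b}" using True by (auto simp: x_def)
    ultimately show "z \<in> W" using e(2) by blast
  qed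
  moreover have "complex_of_real ` {a..b} \<subseteq> V" using e(1) by (auto simp: V_def in_box_complex_iff)
  ultimately show ?thesis by (intro that[of V]) (auto simp: V_def open_box convex_box)
qed

definition quadc :: "complex \<Rightarrow> complex" where
  "quadc z = (3 * z\<^sup>2 + 8 * z + 6) / 6"

lemma quadc_of_real: "quadc (of_real x) = of_real (quad x)"
  by (simp add: quadc_def quad_def)

text \<open>
  A domain on which \<open>sroot\<close> and all weights extend holomorphically with the principal square root.
\<close>
definition regular :: "complex set" where
  "regular = {z. z \<noteq> - 1 \<and> quadc z \<notin> \<real>\<^sub>\<le>\<^sub>0}"

lemma csqrt_quadc_of_real: "csqrt (quadc (of_real x)) = of_real (sqrt (quad x))"
  using quad_pos[of x] by (simp add: quadc_of_real)

lemma open_regular: "open regular"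
proof -
  have "continuous_on UNIV quadc" unfolding quadc_def by (intro continuous_intros) auto
  then have "open (quadc -` (- \<real>\<^sub>\<le>\<^sub>0))"
    by (intro continuous_open_vimage) (auto simp: continuous_on_eq_continuous_at)
  moreover have "regular = (- {- 1}) \<inter> quadc -` (- \<real>\<^sub>\<le>\<^sub>0)" by (auto simp: regular_def)
  moreover have "open (- {- 1 :: complex})" by (rule open_Compl) (rule closed_singleton)
  ultimately show ?thesis by (metis open_Int)
qed

lemma holomorphic_csqrt_quadc: "(\<lambda>z. csqrt (quadc z)) holomorphic_on regular"
  unfolding quadc_def regular_def by (intro holomorphic_intros) (auto simp: quadc_def)

text \<open>
  The derivative of \<open>sroot\<close> is positive on the real interval, hence has positive real part on a convex
  neighbourhood, on which the extension of \<open>sroot\<close> is therefore injective.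
\<close>
lemma sroot_inv_extension:
  assumes b: "0 < b" "b < sroot_max"
  shows "\<exists>W X. open W \<and> complex_of_real ` {- b..b} \<subseteq> W \<and> X holomorphic_on W \<and> X ` W \<subseteq> regular \<and>
     (\<forall>s\<in>{- b..b}. X (of_real s) = of_real (sroot_inv s))"
proof -
  define f where "f = (\<lambda>z. z * csqrt (quadc z))"
  have hol: "f holomorphic_on regular"
    unfolding f_def by (intro holomorphic_intros holomorphic_csqrt_quadc)
  have f_real: "f (of_real x) = of_real (sroot x)" for x
    by (simp add: f_def sroot_def csqrt_quadc_of_real)
  have D: "(f has_field_derivative deriv f z) (at z)" if "z \<in> regular" for z
    using hol open_regular that by (rule holomorphic_derivI)
  have deriv_real: "deriv f (of_real x) = of_real ((x + 1)\<^sup>2 / sqrt (quad x))" if "complex_of_real x \<in> regular" for x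
  proof -
    have "((\<lambda>t. f (of_real t)) has_vector_derivative deriv f (of_real x)) (at x)"
      using D[OF that] by (rule has_vector_derivative_real_field)
    moreover have "((\<lambda>t. f (of_real t)) has_vector_derivative of_real ((x + 1)\<^sup>2 / sqrt (quad x))) (at x)"
      unfolding f_real using DERIV_sroot[of x]
      by (auto simp: has_vector_derivative_complex_iff has_real_derivative_iff_has_vector_derivative
          intro!: has_vector_derivative_of_real)
    ultimately show ?thesis by (rule vector_derivative_unique_at)
  qed
  define U where "U = {z \<in> regular. Re (deriv f z) > 0}"
  have "continuous_on regular (\<lambda>z. Re (deriv f z))"
    by (intro continuous_intros holomorphic_on_imp_continuous_on holomorphic_deriv hol open_regular)
  then have "open (regular \<inter> (\<lambda>z. Re (deriv f z)) -` {0<..})"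
    by (rule continuous_open_preimage) (auto simp: open_regular)
  then have openU: "open U" by (simp add: U_def vimage_def Int_def)
  have realU: "complex_of_real x \<in> U" if "- 1 < x" for x
  proof -
    have "complex_of_real x \<in> regular"
      using that quad_pos[of x] by (auto simp: regular_def quadc_of_real complex_nonpos_Reals_iff complex_eq_iff)
    then show ?thesis using that quad_pos[of x] by (simp add: U_def deriv_real)
  qed
  have bb: "- b \<in> {- sroot_max<..<sroot_max}" "b \<in> {- sroot_max<..<sroot_max}" using b by auto
  have "complex_of_real ` {sroot_inv (- b)..sroot_inv b} \<subseteq> U"
    using realU sroot_inv_strict[OF bb(1)] by auto
  then obtain V where V: "open V" "convex V" "complex_of_real ` {sroot_inv (- b)..sroot_inv b} \<subseteq> V" "V \<subseteq> U"
    using open_rectangle_nhd[OF openU] by metis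
  have inj: "inj_on f V"
    using V(2,4) D by (intro inj_on_Re_deriv_pos[of V f "deriv f"]) (auto simp: U_def)
  have holV: "f holomorphic_on V" using hol V(4) by (auto simp: U_def elim: holomorphic_on_subset)
  obtain X where X: "X holomorphic_on f ` V" "\<And>z. z \<in> V \<Longrightarrow> X (f z) = z"
    using holomorphic_has_inverse[OF holV V(1) inj] by metis
  have key: "complex_of_real s = f (of_real (sroot_inv s)) \<and> complex_of_real (sroot_inv s) \<in> V" if s: "s \<in> {- b..b}" for s
  proof -
    have sc: "s \<in> {- sroot_max..sroot_max}" using s b by auto
    have mono: "sroot_inv s1 \<le> sroot_inv s2" if "s1 \<le> s2" "s1 \<in> {- sroot_max..sroot_max}" "s2 \<in> {- sroot_max..sroot_max}" for s1 s2
      using sroot_strict_mono[of "sroot_inv s2" "sroot_inv s1"] sroot_sroot_inv that sroot_inv_in[of s2] by force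
    have "sroot_inv s \<in> {sroot_inv (- b)..sroot_inv b}" using mono s sc bb by auto
    then show ?thesis using V(3) sroot_sroot_inv[OF sc] by (auto simp: f_real)
  qed
  have "open (f ` V)" by (rule open_mapping_thm3[OF holV V(1) inj])
  moreover have "complex_of_real ` {- b..b} \<subseteq> f ` V" using key by blast
  moreover have "X ` f ` V \<subseteq> regular" using X(2) V(4) by (auto simp: U_def)
  moreover have "X (of_real s) = of_real (sroot_inv s)" if "s \<in> {- b..b}" for s
    using key[OF that] X(2) by metis
  ultimately show ?thesis using X(1) by blast
qed

section \<open>The even part of the raised weights\<close>

lemma real_analytic_cong:
  assumes "open L" "real_analytic_on f L" "\<And>x. x \<in> L \<Longrightarrow> f x = g x"
  shows "real_analytic_on g L"
  unfolding real_analytic_on_def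
proof
  fix x assume x: "x \<in> L"
  obtain e where e: "e > 0" "ball x e \<subseteq> L" using assms(1) x open_contains_ball by metis
  obtain r a where r: "r > 0" and a: "\<forall>y. \<bar>y - x\<bar> < r \<longrightarrow> (\<lambda>n. a n * (y - x) ^ n) sums f y"
    using bspec[OF assms(2)[unfolded real_analytic_on_def] x] by auto
  have "(\<lambda>n. a n * (y - x) ^ n) sums g y" if "\<bar>y - x\<bar> < min r e" for y
  proof -
    have "y \<in> L" using that e(2) by (auto simp: dist_real_def abs_minus_commute)
    then show ?thesis using a that assms(3)[of y] by auto
  qed
  then show "\<exists>r>0. \<exists>a :: nat \<Rightarrow> real. \<forall>y. \<bar>y - x\<bar> < r \<longrightarrow> (\<lambda>n. a n * (y - x) ^ n) sums g y"
    using r e(1) by (intro exI[of _ "min r e"]) auto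
qed

lemma real_analytic_cmult:
  assumes "real_analytic_on f L"
  shows "real_analytic_on (\<lambda>x. c * f x) L"
  unfolding real_analytic_on_def
proof
  fix x assume x: "x \<in> L"
  obtain r a where r: "r > 0" and a: "\<forall>y. \<bar>y - x\<bar> < r \<longrightarrow> (\<lambda>n. a n * (y - x) ^ n) sums f y"
    using bspec[OF assms[unfolded real_analytic_on_def] x] by auto
  have "(\<lambda>n. (c * a n) * (y - x) ^ n) sums (c * f y)" if "\<bar>y - x\<bar> < r" for y
    using sums_mult[of _ _ c] a that by (simp add: mult.assoc)
  then show "\<exists>r>0. \<exists>a :: nat \<Rightarrow> real. \<forall>y. \<bar>y - x\<bar> < r \<longrightarrow> (\<lambda>n. a n * (y - x) ^ n) sums (c * f y)"
    using r by (intro exI[of _ r] conjI exI[of _ "\<lambda>n. c * a n"]) auto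
qed

definition raised :: "nat \<Rightarrow> real \<Rightarrow> real" where
  "raised i s = raised_num i (sroot_inv s + 1) / (18 * (sroot_inv s + 1) ^ 5) * sroot_inv' s"

text \<open>
  The relation between \<open>u + z\<close> and \<open>u z\<close> is the equation \<open>3 u\<^sup>4 - 4 u\<^sup>3 = 3 z\<^sup>4 - 4 z\<^sup>3\<close>, which says that \<open>H(x,0)\<close> takes the
  same value at both points, divided by \<open>u - z\<close>. The upper bound on the sum comes from
  \<open>(u - 1) (z - 1) < 0\<close>.
\<close>
lemma conj_points:
  assumes s: "s \<in> {0<..<sroot_max}"
  defines "u \<equiv> sroot_inv s + 1" and "z \<equiv> sroot_inv (- s) + 1"
  shows "1 < u" "0 < z" "z < 1" "sroot_inv' s = s / (u\<^sup>2 * (u - 1))" "sroot_inv' (- s) = - s / (z\<^sup>2 * (z - 1))"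
    "u * z * (6 * (u + z) - 4) = (u + z)\<^sup>2 * (3 * (u + z) - 4)"
    "4 / 3 < u + z" "u + z < 2"
proof -
  have in1: "s \<in> {- sroot_max<..<sroot_max}" "- s \<in> {- sroot_max<..<sroot_max}" using s by auto
  have sx: "sroot (u - 1) = s" and sz: "sroot (z - 1) = - s"
    using sroot_sroot_inv[of s] sroot_sroot_inv[of "- s"] s by (auto simp: u_def z_def)
  show z0: "0 < z" using sroot_inv_strict[OF in1(2)] by (simp add: z_def)
  have "0 < (u - 1) * sqrt (quad (u - 1))" using sx s by (simp add: sroot_def)
  then show u1: "1 < u" using quad_pos[of "u - 1"] by (simp add: zero_less_mult_iff)
  have "(z - 1) * sqrt (quad (z - 1)) < 0" using sz s by (simp add: sroot_def)
  then show z1: "z < 1" using quad_pos[of "z - 1"] by (simp add: mult_less_0_iff)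
  have q: "sqrt (quad (u - 1)) = s / (u - 1)" "sqrt (quad (z - 1)) = - s / (z - 1)"
    using sx sz u1 z1 by (simp_all add: sroot_def field_simps)
  show "sroot_inv' s = s / (u\<^sup>2 * (u - 1))" "sroot_inv' (- s) = - s / (z\<^sup>2 * (z - 1))"
    unfolding sroot_inv'_def using q by (simp_all add: u_def z_def mult.commute)
  have sq: "6 * (sroot (v - 1))\<^sup>2 = 3 * v ^ 4 - 4 * v ^ 3 + 1" for v
    using quad_pos[of "v - 1"]
    by (simp add: sroot_def power_mult_distrib) (simp add: quad_def field_simps eval_nat_numeral)
  have "3 * u ^ 4 - 4 * u ^ 3 = 3 * z ^ 4 - 4 * z ^ 3"
    using sq[of u] sq[of z] by (simp add: sx sz)
  moreover have "3 * u ^ 4 - 4 * u ^ 3 - (3 * z ^ 4 - 4 * z ^ 3)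
      = (u - z) * ((u + z)\<^sup>2 * (3 * (u + z) - 4) - u * z * (6 * (u + z) - 4))"
    by (simp add: algebra_simps eval_nat_numeral)
  ultimately show rel: "u * z * (6 * (u + z) - 4) = (u + z)\<^sup>2 * (3 * (u + z) - 4)"
    using u1 z1 by simp
  define \<sigma> where "\<sigma> = u + z"
  have \<sigma>: "\<sigma> > 1" using u1 z0 by (simp add: \<sigma>_def)
  have "0 < u * z * (6 * \<sigma> - 4)" using u1 z0 \<sigma> by (intro mult_pos_pos) auto
  then have "0 < \<sigma>\<^sup>2 * (3 * \<sigma> - 4)" using rel by (simp add: \<sigma>_def)
  then show "4 / 3 < u + z" using \<sigma> by (simp add: zero_less_mult_iff \<sigma>_def)
  have "(u - 1) * (z - 1) * (6 * \<sigma> - 4) < 0"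
    using u1 z1 \<sigma> by (intro mult_neg_pos mult_pos_neg) auto
  moreover have "(u - 1) * (z - 1) * (6 * \<sigma> - 4) = (\<sigma> - 2) * (3 * (\<sigma> - 2 / 3)\<^sup>2 + 2 / 3)"
    using rel unfolding \<sigma>_def by (simp add: power2_eq_square algebra_simps) 
  ultimately have "(\<sigma> - 2) * (3 * (\<sigma> - 2 / 3)\<^sup>2 + 2 / 3) < 0 * (3 * (\<sigma> - 2 / 3)\<^sup>2 + 2 / 3)"
    by (simp only: mult_zero_left)
  moreover have "3 * (\<sigma> - 2 / 3)\<^sup>2 + 2 / 3 > 0" by (intro add_nonneg_pos) auto
  ultimately have "\<sigma> - 2 < 0" by (simp only: mult_less_cancel_right_pos)
  then show "u + z < 2" by (simp add: \<sigma>_def)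
qed

definition conj_param :: "real \<Rightarrow> real" where
  "conj_param s = 3 * (sroot_inv s + sroot_inv (- s) + 2) - 4"

lemma conj_param_in: "s \<in> {0<..<sroot_max} \<Longrightarrow> conj_param s \<in> {0<..<2}"
  using conj_points(7,8)[of s] by (simp add: conj_param_def)

text \<open>
  The sum determines the product, hence the pair; the two members are told apart by their position relative to
  1.
\<close>
lemma inj_on_conj_param: "inj_on conj_param {0<..<sroot_max}"
proof (rule inj_onI)
  fix s1 s2 assume s: "s1 \<in> {0<..<sroot_max}" "s2 \<in> {0<..<sroot_max}" and eq: "conj_param s1 = conj_param s2"
  define u1 z1 u2 z2 where uz: "u1 = sroot_inv s1 + 1" "z1 = sroot_inv (- s1) + 1" "u2 = sroot_inv s2 + 1" "z2 = sroot_inv (- s2) + 1"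
  note c1 = conj_points[OF s(1), folded uz] and c2 = conj_points[OF s(2), folded uz]
  have sum: "u1 + z1 = u2 + z2" using eq by (simp add: conj_param_def uz)
  have "u1 * z1 * (6 * (u2 + z2) - 4) = u2 * z2 * (6 * (u2 + z2) - 4)"
    using c1(6) c2(6) unfolding sum by simp
  then have prod: "u1 * z1 = u2 * z2" using c2(7) by simp
  have "(u1 - u2) * (u1 - z2) = 0" using sum prod by algebra
  then have "u1 = u2" using c1(1) c2(3) by auto
  then have "sroot_inv s1 = sroot_inv s2" by (simp add: uz)
  moreover have "sroot (sroot_inv s1) = s1" "sroot (sroot_inv s2) = s2" using s by (auto intro!: sroot_sroot_inv)
  ultimately show "s1 = s2" by metis
qed

lemma raised_pairing:
  assumes s: "s \<in> {0<..<sroot_max}"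
  shows "\<exists>C>0. \<forall>i<3. raised i s + raised i (- s) = C * poly (cheb i) (conj_param s)"
proof -
  define u z where uz: "u = sroot_inv s + 1" "z = sroot_inv (- s) + 1"
  note c = conj_points[OF s, folded uz]
  define t where "t = conj_param s"
  have t: "t > 0" "u + z = (t + 4) / 3" using conj_param_in[OF s] by (simp_all add: t_def conj_param_def uz)
  have rel: "u * z = (u + z)\<^sup>2 * (t / (2 * (t + 2)))"
  proof -
    have "6 * (u + z) - 4 = 2 * (t + 2)" "3 * (u + z) - 4 = t" using t(2) by simp_all
    then have "u * z * (2 * (t + 2)) = (u + z)\<^sup>2 * t" using c(6) by (simp only:)
    then show ?thesis using t(1) by (simp only: times_divide_eq_right) (simp add: eq_divide_eq)
  qed
  define C0 where "C0 = s / 18 * ((u - z) * (u + z) ^ 6) / (u ^ 7 * z ^ 7 * (u - 1) * (1 - z))"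
  define C where "C = C0 / (15552 * (t + 2) ^ 6)"
  have "C0 > 0" unfolding C0_def using s c(1-3)
    by (intro divide_pos_pos mult_pos_pos zero_less_power) auto
  then have "C > 0" using t(1) by (simp add: C_def)
  moreover have "raised i s + raised i (- s) = C * poly (cheb i) t" if i: "i < 3" for i
  proof -
    have "raised i s = s / 18 * (raised_num i u / (u ^ 7 * (u - 1)))"
      unfolding raised_def c(4) uz(1)[symmetric] using c(1) by (simp add: field_simps eval_nat_numeral)
    moreover have "raised i (- s) = - (s / 18 * (raised_num i z / (z ^ 7 * (z - 1))))"
      unfolding raised_def c(5) uz(2)[symmetric] using c(2,3) by (simp add: field_simps eval_nat_numeral)
    ultimately have "raised i s + raised i (- s) = s / 18 * (raised_num i u / (u ^ 7 * (u - 1)) - raised_num i z / (z ^ 7 * (z - 1)))"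
      by (simp add: algebra_simps)
    also have "raised_num i u / (u ^ 7 * (u - 1)) - raised_num i z / (z ^ 7 * (z - 1))
        = (raised_num i u * z ^ 7 * (z - 1) - raised_num i z * u ^ 7 * (u - 1)) / ((u ^ 7 * (u - 1)) * (z ^ 7 * (z - 1)))"
      using c(1-3) by (subst diff_frac_eq) (auto simp: mult_ac)
    also have "\<dots> = - ((u - z) * (u + z) ^ 6 * pairing_num i (u + z) (t / (2 * (t + 2)))) / ((u ^ 7 * (u - 1)) * (z ^ 7 * (z - 1)))"
      unfolding pairing_num_eq[OF rel i] ..
    also have "s / 18 * \<dots> = C0 * pairing_num i (u + z) (t / (2 * (t + 2)))"
    proof -
      have "z ^ 7 * (z - 1) = - (z ^ 7 * (1 - z))" by (simp add: algebra_simps)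
      then show ?thesis by (simp add: C0_def mult_ac)
    qed
    also have "\<dots> = C * poly (cheb i) t"
      unfolding pairing_num_cheb[OF t(1) i, symmetric] C_def t(2) using t(1) by simp
    finally show ?thesis .
  qed
  ultimately show ?thesis unfolding t_def by blast
qed

lemma raised_zeros:
  fixes \<alpha> :: "nat \<Rightarrow> real"
  assumes "k \<le> 3" "\<exists>j<k. \<alpha> j \<noteq> 0"
  defines "g \<equiv> \<lambda>s. \<Sum>j<k. \<alpha> j * raised ([1, 2, 0] ! j) s"
  shows "finite {s \<in> {0<..<sroot_max}. g s + g (- s) = 0}" "card {s \<in> {0<..<sroot_max}. g s + g (- s) = 0} < k"
proof -
  let ?Z = "{s \<in> {0<..<sroot_max}. g s + g (- s) = 0}"
  let ?T = "{t \<in> {0<..<2}. (\<Sum>j<k. \<alpha> j * poly (cheb ([1, 2, 0] ! j)) t) = 0}"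
  have "conj_param ` ?Z \<subseteq> ?T"
  proof (rule image_subsetI)
    fix s assume s: "s \<in> ?Z"
    then obtain C where C: "C > 0" "\<And>i. i < 3 \<Longrightarrow> raised i s + raised i (- s) = C * poly (cheb i) (conj_param s)"
      using raised_pairing[of s] by blast
    have "[1, 2, 0] ! j < (3 :: nat)" if "j < k" for j
      using that assms(1) by (auto simp: nth_Cons split: nat.split)
    then have "g s + g (- s) = (\<Sum>j<k. \<alpha> j * (C * poly (cheb ([1, 2, 0] ! j)) (conj_param s)))"
      unfolding g_def sum.distrib[symmetric] distrib_left[symmetric]
      by (intro sum.cong arg_cong2[of _ _ _ _ "(*)"] C(2)) auto
    also have "\<dots> = C * (\<Sum>j<k. \<alpha> j * poly (cheb ([1, 2, 0] ! j)) (conj_param s))"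
      by (simp add: sum_distrib_left mult_ac)
    finally have "(\<Sum>j<k. \<alpha> j * poly (cheb ([1, 2, 0] ! j)) (conj_param s)) = 0"
      using s C(1) by simp
    then show "conj_param s \<in> ?T" using conj_param_in s by simp
  qed
  moreover have inj: "inj_on conj_param ?Z" by (rule inj_on_subset[OF inj_on_conj_param]) auto
  moreover note cheb_zeros[OF assms(1,2)]
  ultimately show "finite ?Z" "card ?Z < k"
    using inj_on_finite[OF inj] card_inj_on_le[OF inj] by (blast, meson le_less_trans)
qed

section \<open>The Abelian integrals\<close>

lemma comp_sroot_inv_extension:
  assumes Q: "Q holomorphic_on regular" "\<And>x. - 1 < x \<Longrightarrow> Q (of_real x) = of_real (q x)"
    and b: "0 < b" "b < sroot_max"
  shows "\<exists>W G. open W \<and> complex_of_real ` {- b..b} \<subseteq> W \<and> G holomorphic_on W \<and>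
    (\<forall>s\<in>{- b..b}. G (of_real s) = of_real (q (sroot_inv s)))"
proof -
  obtain W X where W: "open W" "complex_of_real ` {- b..b} \<subseteq> W" "X holomorphic_on W" "X ` W \<subseteq> regular"
    and X: "\<forall>s\<in>{- b..b}. X (of_real s) = of_real (sroot_inv s)"
    using sroot_inv_extension[OF b] by metis
  have "(Q \<circ> X) holomorphic_on W" by (rule holomorphic_on_compose_gen[OF W(3) Q(1) W(4)])
  moreover have "(Q \<circ> X) (of_real s) = of_real (q (sroot_inv s))" if s: "s \<in> {- b..b}" for s
    using bspec[OF X s] Q(2)[of "sroot_inv s"] sroot_inv_strict[of s] s b by simp
  ultimately show ?thesis using W(1,2) by (intro exI[of _ W] exI[of _ "Q \<circ> X"]) simp
qed

lemma comp_sroot_inv_analytic: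
  assumes Q: "Q holomorphic_on regular" "\<And>x. - 1 < x \<Longrightarrow> Q (of_real x) = of_real (q x)"
  shows "real_analytic_on (\<lambda>s. q (sroot_inv s)) {- sroot_max<..<sroot_max}"
proof (rule real_analytic_onI)
  fix s assume s: "s \<in> {- sroot_max<..<sroot_max}"
  define b where "b = (\<bar>s\<bar> + sroot_max) / 2"
  have b: "0 < b" "b < sroot_max" "\<bar>s\<bar> < b" using s by (auto simp: b_def sroot_max_def)
  obtain W G where W: "open W" "complex_of_real ` {- b..b} \<subseteq> W" "G holomorphic_on W"
    and G: "\<forall>s\<in>{- b..b}. G (of_real s) = of_real (q (sroot_inv s))"
    using comp_sroot_inv_extension[OF Q b(1,2)] by metis
  have "complex_of_real s \<in> W"
    using bspec[OF W(2)[unfolded image_subset_iff], of s] b(3) by (simp add: abs_less_iff)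
  then obtain e where e: "e > 0" "ball (complex_of_real s) e \<subseteq> W"
    using W(1) open_contains_ball by metis
  define d where "d = min e (b - \<bar>s\<bar>)"
  have "G holomorphic_on ball (of_real s) d"
    by (rule holomorphic_on_subset[OF W(3)]) (use e(2) in \<open>auto simp: d_def\<close>)
  moreover have "G (of_real y) = of_real (q (sroot_inv y))" if "\<bar>y - s\<bar> < d" for y
    using that by (intro bspec[OF G]) (auto simp: d_def)
  ultimately show "\<exists>r>0. \<exists>F. F holomorphic_on ball (of_real s) r \<and>
      (\<forall>y. \<bar>y - s\<bar> < r \<longrightarrow> F (of_real y) = of_real (q (sroot_inv y)))"
    using e(1) b(3) by (intro exI[of _ d] conjI exI[of _ G]) (auto simp: d_def)
qed

lemma regular_nz: "z \<in> regular \<Longrightarrow> z + 1 \<noteq> 0"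
  by (auto simp: regular_def add_eq_0_iff2)

text \<open>
  With \<open>x = sroot_inv s\<close> this is \<open>(x + 1)\<^bsup>i - 2\<^esup>\<close>, written with natural exponents, times \<open>dx/ds\<close>.
\<close>
definition weight :: "nat \<Rightarrow> real \<Rightarrow> real" where
  "weight i s = (sroot_inv s + 1) ^ i / (sroot_inv s + 1)\<^sup>2 * sroot_inv' s"

lemma weight_complex:
  defines "Q \<equiv> \<lambda>i z. (z + 1) ^ i / (z + 1)\<^sup>2 * (csqrt (quadc z) / (z + 1)\<^sup>2)"
  shows "Q i holomorphic_on regular"
    "Q i (of_real x) = of_real ((x + 1) ^ i / (x + 1)\<^sup>2 * (sqrt (quad x) / (x + 1)\<^sup>2))"
proof -
  show "Q i holomorphic_on regular" unfolding Q_def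
    by (intro holomorphic_intros holomorphic_csqrt_quadc) (use regular_nz in auto)
  show "Q i (of_real x) = of_real ((x + 1) ^ i / (x + 1)\<^sup>2 * (sqrt (quad x) / (x + 1)\<^sup>2))"
    unfolding Q_def csqrt_quadc_of_real by simp
qed

lemma raised_complex:
  defines "Q \<equiv> \<lambda>i z. ((15 + 3 * of_nat i) * (z + 1) ^ (i + 3) - (of_nat i - 2) * (z + 1) ^ (i + 2)
     - (of_nat i - 3) * (z + 1) ^ (i + 1) - (of_nat i - 4) * (z + 1) ^ i) / (18 * (z + 1) ^ 5)
       * (csqrt (quadc z) / (z + 1)\<^sup>2)"
  shows "Q i holomorphic_on regular"
    "Q i (of_real x) = of_real (raised_num i (x + 1) / (18 * (x + 1) ^ 5) * (sqrt (quad x) / (x + 1)\<^sup>2))"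
proof -
  show "Q i holomorphic_on regular" unfolding Q_def
    by (intro holomorphic_intros holomorphic_csqrt_quadc) (use regular_nz in auto)
  show "Q i (of_real x) = of_real (raised_num i (x + 1) / (18 * (x + 1) ^ 5) * (sqrt (quad x) / (x + 1)\<^sup>2))"
    unfolding Q_def csqrt_quadc_of_real raised_num_def by simp
qed

lemma weight_analytic: "real_analytic_on (weight i) {- sroot_max<..<sroot_max}"
  using comp_sroot_inv_analytic[OF weight_complex] unfolding weight_def[abs_def] sroot_inv'_def .

lemma raised_analytic: "real_analytic_on (raised i) {- sroot_max<..<sroot_max}"
  using comp_sroot_inv_analytic[OF raised_complex] unfolding raised_def[abs_def] sroot_inv'_def .

lemma smooth_continuous: "smooth L f \<Longrightarrow> continuous_on L f"
  by (intro continuous_at_imp_continuous_on ballI DERIV_isCont[OF smooth_DERIV])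

lemma smooth_weight: "smooth {- sroot_max<..<sroot_max} (weight i)" and smooth_raised: "smooth {- sroot_max<..<sroot_max} (raised i)"
  by (rule real_analytic_smooth, rule weight_analytic, rule real_analytic_smooth, rule raised_analytic)

text \<open>
  In terms of \<open>u\<close>, the function \<open>s * weight i s\<close> is the rational function \<open>R\<close>, because
  \<open>s * sqrt (quad x) = x * quad x\<close> is a cubic.
\<close>
lemma trig_weight_raised:
  assumes r: "r \<in> {- sroot_max<..<sroot_max}" "r \<noteq> 0"
  shows "trig 1 (weight i) r = trig 2 (raised i) r"
proof -
  \<comment> \<open>Chosen so that \<open>weight i s + P' s / 3 = raised i s\<close>; what matters is that \<open>P'\<close> is the derivative of \<open>s * weight i s\<close>.\<close>
  define P' where "P' = (\<lambda>s. 3 * (raised i s - weight i s))"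
  have cont: "continuous_on {- sroot_max<..<sroot_max} (weight i)" "continuous_on {- sroot_max<..<sroot_max} P'"
    unfolding P'_def by (intro continuous_intros smooth_continuous smooth_weight smooth_raised)+
  have "((\<lambda>s. s * weight i s) has_real_derivative P' s) (at s)" if s: "s \<in> {- sroot_max<..<sroot_max}" for s
  proof -
    define R where "R = (\<lambda>u. (3 * u ^ 3 - u\<^sup>2 - u - 1) * u ^ i / (6 * u ^ 4) :: real)"
    define u where "u = sroot_inv s + 1"
    have u: "u > 0" using sroot_inv_strict[OF s] by (simp add: u_def)
    have Dpow: "((\<lambda>u. u ^ i) has_real_derivative real i * u ^ i / u) (at u)"
      using u by (intro DERIV_cong[OF DERIV_pow]) (cases i; simp)
    have Dcub: "((\<lambda>u. 3 * u ^ 3 - u\<^sup>2 - u - 1) has_real_derivative 9 * u\<^sup>2 - 2 * u - 1) (at u)"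
      by (auto intro!: derivative_eq_intros)
    have Dden: "((\<lambda>u. 6 * u ^ 4) has_real_derivative 24 * u ^ 3) (at u)"
      by (auto intro!: derivative_eq_intros)
    have "(R has_real_derivative 3 * (raised_num i u / (18 * u ^ 5) - u ^ i / u\<^sup>2)) (at u)"
      unfolding R_def
    proof (rule DERIV_cong[OF DERIV_divide[OF DERIV_mult[OF Dcub Dpow] Dden]])
      define v where "v = u ^ i"
      have n: "raised_num i u = v * ((15 + 3 * real i) * u ^ 3 - (real i - 2) * u\<^sup>2 - (real i - 3) * u - (real i - 4))"
        unfolding raised_num_def v_def by (simp add: algebra_simps power_add power2_eq_square)
      show "(((9 * u\<^sup>2 - 2 * u - 1) * u ^ i + real i * u ^ i / u * (3 * u ^ 3 - u\<^sup>2 - u - 1)) * (6 * u ^ 4)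
          - (3 * u ^ 3 - u\<^sup>2 - u - 1) * u ^ i * (24 * u ^ 3)) / (6 * u ^ 4 * (6 * u ^ 4))
        = 3 * (raised_num i u / (18 * u ^ 5) - u ^ i / u\<^sup>2)"
        unfolding n v_def[symmetric] using u by (simp add: field_simps eval_nat_numeral)
    qed (use u in simp)
    moreover have "((\<lambda>s. sroot_inv s + 1) has_real_derivative sroot_inv' s) (at s)"
      using DERIV_add[OF DERIV_sroot_inv[OF s] DERIV_const, of 1] by simp
    ultimately have "((\<lambda>s. R (sroot_inv s + 1)) has_real_derivative 3 * (raised_num i u / (18 * u ^ 5) - u ^ i / u\<^sup>2) * sroot_inv' s) (at s)"
      unfolding u_def by (rule DERIV_chain2)
    moreover have "3 * (raised_num i u / (18 * u ^ 5) - u ^ i / u\<^sup>2) * sroot_inv' s = P' s"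
      by (simp add: P'_def raised_def weight_def u_def algebra_simps)
    ultimately have "((\<lambda>s. R (sroot_inv s + 1)) has_real_derivative P' s) (at s)" by simp
    then show ?thesis
    proof (rule has_field_derivative_transform_within_open[OF _ open_greaterThanLessThan s])
      fix s assume s: "s \<in> {- sroot_max<..<sroot_max}"
      define u where "u = sroot_inv s + 1"
      have u: "u > 0" using sroot_inv_strict[OF s] by (simp add: u_def)
      have "s * sqrt (quad (sroot_inv s)) = sroot_inv s * quad (sroot_inv s)"
        using sroot_sroot_inv[of s] s quad_pos[of "sroot_inv s"] unfolding sroot_def
        by (metis abs_of_pos atLeastAtMost_iff greaterThanLessThan_iff less_imp_le mult.assoc real_sqrt_mult_self)
      also have "\<dots> = (3 * u ^ 3 - u\<^sup>2 - u - 1) / 6"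
        by (simp add: u_def quad_def field_simps eval_nat_numeral)
      finally have sq: "s * sqrt (quad (sroot_inv s)) = (3 * u ^ 3 - u\<^sup>2 - u - 1) / 6" .
      have "s * weight i s = s * sqrt (quad (sroot_inv s)) * (u ^ i / u\<^sup>2 / u\<^sup>2)"
        unfolding weight_def sroot_inv'_def u_def[symmetric] by simp
      also have "\<dots> = R u" unfolding sq R_def by (simp add: eval_nat_numeral)
      finally show "R (sroot_inv s + 1) = s * weight i s" by (simp add: u_def)
    qed
  qed
  from trig_raise[OF cont this r]
  have "trig 1 (weight i) r = trig 2 (\<lambda>s. weight i s + P' s / 3) r" .
  moreover have "(\<lambda>s. weight i s + P' s / 3) = raised i" by (rule ext) (simp add: P'_def field_simps)
  ultimately show ?thesis by simp
qed

lemma trig_sum: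
  fixes k :: nat
  assumes "\<And>j. j < k \<Longrightarrow> continuous_on {- c<..<c} (g j)" "r \<in> {- c<..<c}"
  shows "trig n (\<lambda>s. \<Sum>j<k. a j * g j s) r = (\<Sum>j<k. a j * trig n (g j) r)"
proof -
  have "((\<lambda>\<theta>. \<Sum>j<k. a j * (g j (r * cos \<theta>) * sin \<theta> ^ (2 * n))) has_integral (\<Sum>j<k. a j * trig n (g j) r)) {0..2 * pi}"
    by (intro has_integral_sum has_integral_mult_right trig_has_integral[OF assms]) auto
  then show ?thesis
    unfolding trig_def[of n "\<lambda>s. \<Sum>j<k. a j * g j s"]
    by (intro integral_unique) (simp add: sum_distrib_right mult.assoc)
qed

theorem mainTheorem3:
  fixes \<gamma> :: "real \<Rightarrow> real \<Rightarrow> complex" and w :: complex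
  assumes "\<And>h. h \<in> {0<..<1/12} \<Longrightarrow> is_oval h (\<gamma> h)"
    and "\<And>h. h \<in> {0<..<1/12} \<Longrightarrow> winding_number (\<gamma> h) 0 = w"
  shows "ECT_set {0<..<1/12}
           {#abelian_integral \<gamma> 0, abelian_integral \<gamma> 1, abelian_integral \<gamma> 2#}"
proof -
  define L where "L = {0<..<1/12 :: real}"
  have Lh: "0 < h \<and> sqrt (2 * h) < sroot_max" if "h \<in> L" for h
    using that by (auto simp: L_def sroot_max_def)
  have Lr: "sqrt (2 * h) \<in> {- sroot_max<..<sroot_max}" "sqrt (2 * h) \<noteq> 0" if "h \<in> L" for h
  proof -
    have "0 < sqrt (2 * h)" "sqrt (2 * h) < sroot_max" using Lh[OF that] by auto
    then show "sqrt (2 * h) \<in> {- sroot_max<..<sroot_max}" "sqrt (2 * h) \<noteq> 0"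
      unfolding greaterThanLessThan_iff by linarith+
  qed
  have openL: "open L" by (simp add: L_def)
  \<comment> \<open>In this order the Wronskians of the associated polynomials have nonnegative coefficients.\<close>
  define fs where "fs = map (abelian_integral \<gamma>) [1, 2, 0]"
  have I: "abelian_integral \<gamma> i h = - Re w * (2 * h * trig 1 (weight i) (sqrt (2 * h)))" and w: "Re w \<noteq> 0"
    if h: "h \<in> L" for i h
  proof -
    have "continuous_on {-1<..<1 / 3} (\<lambda>x :: real. (x + 1) powi (int i - 2))"
      by (intro continuous_intros) auto
    note * = oval_line_integral[OF _ _ assms(1)[OF h[unfolded L_def]] this]
    have "(sroot_inv s + 1) powi (int i - 2) * sroot_inv' s = weight i s" if "s \<in> {- sroot_max<..<sroot_max}" for s
      using sroot_inv_strict[OF that] by (simp add: weight_def power_int_diff)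
    moreover have "sqrt (2 * h) * cos \<theta> \<in> {- sroot_max<..<sroot_max}" for \<theta>
      by (rule mult_cos_in[OF Lr(1)[OF h]])
    ultimately have e: "(sroot_inv (sqrt (2 * h) * cos \<theta>) + 1) powi (int i - 2) * sroot_inv' (sqrt (2 * h) * cos \<theta>) * (sin \<theta>)\<^sup>2
      = weight i (sqrt (2 * h) * cos \<theta>) * sin \<theta> ^ (2 * 1)" for \<theta> by simp
    have ie: "integral {0..2 * pi} (\<lambda>\<theta>. (sroot_inv (sqrt (2 * h) * cos \<theta>) + 1) powi (int i - 2) *
        sroot_inv' (sqrt (2 * h) * cos \<theta>) * (sin \<theta>)\<^sup>2) = trig 1 (weight i) (sqrt (2 * h))"
      unfolding e trig_def ..
    show "abelian_integral \<gamma> i h = - Re w * (2 * h * trig 1 (weight i) (sqrt (2 * h)))"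
      using *(1) h assms(2) by (simp add: abelian_integral_def ie L_def)
    show "Re w \<noteq> 0" using *(2) h assms(2) by (auto simp: L_def)
  qed
  have an: "real_analytic_on (abelian_integral \<gamma> i) L" for i
  proof (rule real_analytic_cong[OF openL])
    show "real_analytic_on (\<lambda>h. - Re w * (2 * h * trig 1 (weight i) (sqrt (2 * h)))) L"
    proof (rule real_analytic_cmult, rule real_analytic_trig[OF smooth_continuous[OF smooth_weight] _ Lh])
      show "\<exists>W G. open W \<and> complex_of_real ` {- b..b} \<subseteq> W \<and> G holomorphic_on W \<and>
          (\<forall>s\<in>{- b..b}. G (of_real s) = of_real (weight i s))" if "0 < b" "b < sroot_max" for b
        using comp_sroot_inv_extension[OF weight_complex that] unfolding weight_def sroot_inv'_def .
    qed
  qed (simp add: I)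
  have "ECT_system L fs"
  proof (rule ECT_systemI[OF openL])
    show "is_interval L" "L \<noteq> {}" by (auto simp: L_def is_interval_1 intro!: exI[of _ "1/24"])
    show "real_analytic_on f L" if "f \<in> set fs" for f using that an by (auto simp: fs_def)
    fix k h and \<alpha> :: "nat \<Rightarrow> real"
    assume "k \<le> length fs" and h: "h \<in> L" and \<alpha>: "\<exists>j<k. \<alpha> j \<noteq> 0"
    then have k: "k \<le> 3" by (simp add: fs_def)
    define e :: "nat \<Rightarrow> nat" where "e = (\<lambda>j. [1, 2, 0] ! j)"
    have fs: "fs ! j = abelian_integral \<gamma> (e j)" if "j < k" for j
      using that k unfolding fs_def e_def by (intro nth_map) simp
    define F where "F = (\<lambda>y. \<Sum>j<k. \<alpha> j * (fs ! j) y)"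
    define g where "g = (\<lambda>s. \<Sum>j<k. \<alpha> j * raised (e j) s)"
    have smg: "smooth {- sroot_max<..<sroot_max} g"
      unfolding g_def by (intro smooth_sum smooth_mult smooth_const smooth_raised)
    have sF: "smooth L F"
      unfolding F_def by (intro smooth_sum smooth_mult smooth_const) (simp add: fs real_analytic_smooth an)
    have eq: "F y * (2 * y) = - Re w * ((2 * y) ^ 2 * trig 2 g (sqrt (2 * y)))" if y: "y \<in> L" for y
    proof -
      note r = Lr[OF y]
      have "F y = (\<Sum>j<k. \<alpha> j * (- Re w * (2 * y * trig 2 (raised (e j)) (sqrt (2 * y)))))"
        unfolding F_def by (intro sum.cong refl) (simp only: lessThan_iff fs I[OF y] trig_weight_raised[OF r])
      also have "\<dots> = - Re w * (2 * y * (\<Sum>j<k. \<alpha> j * trig 2 (raised (e j)) (sqrt (2 * y))))"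
        unfolding sum_distrib_left by (intro sum.cong refl) (simp only: mult_ac)
      also have "(\<Sum>j<k. \<alpha> j * trig 2 (raised (e j)) (sqrt (2 * y))) = trig 2 g (sqrt (2 * y))"
        unfolding g_def by (rule trig_sum[OF smooth_continuous[OF smooth_raised] r(1), symmetric])
      finally show ?thesis by (simp add: power2_eq_square)
    qed
    show "\<not> vanishes k (\<lambda>y. \<Sum>j<k. \<alpha> j * (fs ! j) y) h"
    proof
      assume "vanishes k (\<lambda>y. \<Sum>j<k. \<alpha> j * (fs ! j) y) h"
      moreover have "smooth L (\<lambda>y. 2 * y)"
      proof -
        have "poly [:0, 2:] = (\<lambda>y :: real. 2 * y)" by (rule ext) simp
        then show ?thesis using smooth_poly[of L "[:0, 2:]"] by (simp only:)
      qed
      ultimately have "vanishes k (\<lambda>y. F y * (2 * y)) h"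
        unfolding F_def[symmetric] by (intro vanishes_mult[OF openL h sF])
      moreover have "vanishes k (\<lambda>y. F y * (2 * y)) h \<longleftrightarrow>
          vanishes k (\<lambda>y. - Re w * ((2 * y) ^ 2 * trig 2 g (sqrt (2 * y)))) h"
        by (rule vanishes_cong[OF openL h]) (rule eq)
      ultimately have v: "vanishes k (\<lambda>y. - Re w * ((2 * y) ^ 2 * trig 2 g (sqrt (2 * y)))) h"
        by blast
      have trig0: "trig (2 - j) g (sqrt (2 * h)) = 0" if "j < k" for j
        by (rule vanishes_trig[OF smooth_DERIV[OF smg] smooth_continuous[OF smooth_deriv[OF _ smg]] openL Lh h _ _ v that])
          (use w[OF h] k in auto)
      have "0 < k" using \<alpha> by auto
      have "trig i g (sqrt (2 * h)) = 0" if "i \<in> {3 - k..3 - k + (k - 1)}" for i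
      proof -
        have "2 - i < k" "i = 2 - (2 - i)" using that k \<open>0 < k\<close> by auto
        then show ?thesis using trig0[of "2 - i"] by simp
      qed
      moreover have "\<exists>i\<in>{3 - k..3 - k + (k - 1)}. trig i g (sqrt (2 * h)) \<noteq> 0"
      proof (rule trig_moments_nonzero[OF smooth_continuous[OF smg]])
        show "sqrt (2 * h) \<in> {0<..<sroot_max}" using Lh[OF h] by simp
        show "finite {s \<in> {0<..<sroot_max}. g s + g (- s) = 0}"
          using raised_zeros(1)[OF k \<alpha>] by (simp add: g_def e_def)
        show "card {s \<in> {0<..<sroot_max}. g s + g (- s) = 0} \<le> k - 1"
          using raised_zeros(2)[OF k \<alpha>] by (simp add: g_def e_def)
      qed
      ultimately show False by blast
    qed
  qed
  moreover have "mset fs = {#abelian_integral \<gamma> 0, abelian_integral \<gamma> 1, abelian_integral \<gamma> 2#}"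
    by (simp add: fs_def)
  ultimately show ?thesis unfolding ECT_set_def L_def by blast
qed

end
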